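(* Let $\Sigma$ be a finite alphabet and let $\psi$ be a sentence of $\mathrm{FO}^2(\leq_1,\lesssim_2,S_2)$ over $\Sigma$ (a two-variable first-order sentence over the vocabulary $\langle\leq_1,\lesssim_2,S_2,\sigma:\sigma\in\Sigma\rangle$). Then there is a pebble-intervals automaton $\mathcal A$ with $L(\psi)=L(\mathcal A)$, where $L(\psi)$ is the set of string projections of the data words over $\Sigma$ satisfying $\psi$.
   Context: Data words. A data word over a finite alphabet $\Sigma$ is a finite (possibly empty) structure $\mathcal D$ over $\langle\leq_1,\lesssim_2,S_2,\sigma:\sigma\in\Sigma\rangle$ with universe $D$, where $\leq_1$ is a linear order, $\lesssim_2$ is a total preorder (transitive total relation), $S_2$ is its induced successor relation ($S_2(x,y)$ iff $x<_2y$ and there is no $z$ with $x<_2z<_2y$, where $x<_2y$ means $x\lesssim_2y$ and not $y\lesssim_2x$), and the $\sigma\in\Sigma$ are unary relations partitioning $D$ (each element satisfies exactly one). The string projection of $\mathcal D$ is the string $w$ of length $|D|$ with $w(\ell)=\sigma$ iff $\mathcal D\models\sigma(d)$ for the $\ell$-th element $d$ of $D$ with respect to $\leq_1$; the empty data word projects to $\varepsilon$. $L(\psi)$ is the set of string projections of data words $\mathcal D$ with $\mathcal D\models\psi$. Pebble-intervals automaton (PIA), with $[n]=\{1,\dots,n\}$: a tuple $(\Sigma,m,Q,q_{\mathrm{init}},F,\delta)$ with $\Sigma$ a finite alphabet, $m\in\mathbb N$ the number of pebbles, $Q$ a finite set of states, $q_{\mathrm{init}}\in Q$, $F\subseteq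 Q$, and $\delta\subseteq (Q\times Q)\cup(Q\times \mathrm{Move}_m\times\Sigma\times Q)$, where $\mathrm{Move}_m$ is the set of all symbols $\mathrm{move}_k(i,j)$ with $k\in[m]$, $i\in[m]\cup\{\rhd\}$, $j\in[m]\cup\{\lhd\}$, $i\ne j$. Semantics on a string $u\in\Sigma^\star$: a configuration is $(q,\rho,N)$ with $q\in Q$, $\rho:[m]\to[|u|]\cup\{\bot\}$ a pebble assignment (two distinct pebbles are never on the same position of $[|u|]$; $\bot$ means not placed), and $N\subseteq[|u|]$ the set of already read positions. Put $\hat\rho(i)=\rho(i)$ for $i\in[m]$, $\hat\rho(\rhd)=0$, $\hat\rho(\lhd)=|u|+1$. The initial configuration is $(q_{\mathrm{init}},\rho_\bot,\emptyset)$ with $\rho_\bot\equiv\bot$. One step from $(q,\rho,N)$ to $(q',\rho',N')$ is possible if either $(q,q')\in\delta$, $\rho'=\rho$, $N'=N$; or there is $\ell\in[|u|]\setminus N$ with $(q,\mathrm{move}_k(i,j),u(\ell),q')\in\delta$, $\hat\rho(i)<\ell<\hat\rho(j)$ (in particular pebbles among $i,j$ must be placed), $\rho'=\rho[k\mapsto\ell]$, $N'=N\cup\{\ell\}$. A configuration is accepting if $q\in F$ and $N=[|u|]$. The PIA accepts $u$ if some finite sequence of steps leads from the initial to an accepting configuration; $L(\mathcal A)$ is the set of accepted strings. *)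

theory Defs
  imports Main
begin

section \<open>Two-variable first-order logic\<close>

datatype var = VX | VY

text \<open>
  The remaining Boolean connectives and the universal quantifier are definable as usual
  (also over the empty structure, where \<open>Neg (Ex x (Neg (Eq x x)))\<close> is true).
\<close>

datatype 'a fo2 =
    Le1 var var
  | Le2 var var
  | S2 var var
  | Lab 'a var
  | Eq var var
  | Neg "'a fo2"
  | Conj "'a fo2" "'a fo2"
  | Ex var "'a fo2"

fun fv :: "'a fo2 \<Rightarrow> var set" where
  "fv (Le1 x y) = {x, y}"
| "fv (Le2 x y) = {x, y}"
| "fv (S2 x y) = {x, y}"
| "fv (Lab a x) = {x}"
| "fv (Eq x y) = {x, y}"
| "fv (Neg \<phi>) = fv \<phi>"
| "fv (Conj \<phi> \<psi>) = fv \<phi> \<union> fv \<psi>"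
| "fv (Ex x \<phi>) = fv \<phi> - {x}"

definition sentence_over :: "'a set \<Rightarrow> 'a fo2 \<Rightarrow> bool" where
  "sentence_over \<Sigma> \<psi> \<longleftrightarrow> set_fo2 \<psi> \<subseteq> \<Sigma> \<and> fv \<psi> = {}"


section \<open>Data words\<close>

record ('d, 'a) dword =
  univ :: "'d set"
  le1 :: "'d rel"
  le2 :: "'d rel"
  lab :: "'a \<Rightarrow> 'd set"

text \<open>
  The relation \<open>S\<^sub>2\<close> is determined by \<open>le2\<close>, so it is a function of the structure
  and not a further component.
\<close>

definition data_word :: "'a set \<Rightarrow> ('d, 'a) dword \<Rightarrow> bool" where
  "data_word \<Sigma> D \<longleftrightarrow>
     finite (univ D) \<and>
     linear_order_on (univ D) (le1 D) \<and>
     preorder_on (univ D) (le2 D) \<and> total_on (univ D) (le2 D) \<and>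
     (\<forall>a\<in>\<Sigma>. lab D a \<subseteq> univ D) \<and>
     (\<forall>d\<in>univ D. \<exists>!a. a \<in> \<Sigma> \<and> d \<in> lab D a)"

definition less2 :: "('d, 'a) dword \<Rightarrow> 'd \<Rightarrow> 'd \<Rightarrow> bool" where
  "less2 D x y \<longleftrightarrow> (x, y) \<in> le2 D \<and> (y, x) \<notin> le2 D"

definition succ2 :: "('d, 'a) dword \<Rightarrow> 'd \<Rightarrow> 'd \<Rightarrow> bool" where
  "succ2 D x y \<longleftrightarrow> less2 D x y \<and> \<not> (\<exists>z\<in>univ D. less2 D x z \<and> less2 D z y)"

fun sat :: "('d, 'a) dword \<Rightarrow> (var \<Rightarrow> 'd) \<Rightarrow> 'a fo2 \<Rightarrow> bool" where
  "sat D v (Le1 x y) \<longleftrightarrow> (v x, v y) \<in> le1 D"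
| "sat D v (Le2 x y) \<longleftrightarrow> (v x, v y) \<in> le2 D"
| "sat D v (S2 x y) \<longleftrightarrow> succ2 D (v x) (v y)"
| "sat D v (Lab a x) \<longleftrightarrow> v x \<in> lab D a"
| "sat D v (Eq x y) \<longleftrightarrow> v x = v y"
| "sat D v (Neg \<phi>) \<longleftrightarrow> \<not> sat D v \<phi>"
| "sat D v (Conj \<phi> \<psi>) \<longleftrightarrow> sat D v \<phi> \<and> sat D v \<psi>"
| "sat D v (Ex x \<phi>) \<longleftrightarrow> (\<exists>d\<in>univ D. sat D (v(x := d)) \<phi>)"

text \<open>
  For a sentence the valuation is irrelevant (\<open>models_iff_sat\<close> below).  It is deliberately not
  required to take values in the universe, which may be empty.
\<close>

definition models :: "('d, 'a) dword \<Rightarrow> 'a fo2 \<Rightarrow> bool" where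
  "models D \<psi> \<longleftrightarrow> (\<forall>v. sat D v \<psi>)"

text \<open>
  The list \<open>ds\<close> enumerates the universe increasingly with respect to \<open>le1\<close>.
\<close>

definition string_projection :: "'a set \<Rightarrow> ('d, 'a) dword \<Rightarrow> 'a list \<Rightarrow> bool" where
  "string_projection \<Sigma> D w \<longleftrightarrow>
     w \<in> lists \<Sigma> \<and>
     (\<exists>ds. distinct ds \<and> set ds = univ D \<and> sorted_wrt (\<lambda>x y. (x, y) \<in> le1 D) ds \<and>
           length w = length ds \<and>
           (\<forall>l<length ds. \<forall>a\<in>\<Sigma>. w ! l = a \<longleftrightarrow> ds ! l \<in> lab D a))"

text \<open>
  Data words are finite, so up to isomorphism their universe is a set of natural numbers;
  \<open>lang_fo2I\<close> below shows that no data word over another type is lost.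
\<close>

definition lang_fo2 :: "'a set \<Rightarrow> 'a fo2 \<Rightarrow> 'a list set" where
  "lang_fo2 \<Sigma> \<psi> =
     {w. \<exists>D :: (nat, 'a) dword. data_word \<Sigma> D \<and> models D \<psi> \<and> string_projection \<Sigma> D w}"


section \<open>Pebble-intervals automata\<close>

datatype ref = Pebble nat | LeftEnd | RightEnd

text \<open>\<open>Move k i j\<close> stands for $move_k(i,j)$.\<close>

datatype move = Move nat ref ref

definition moves :: "nat \<Rightarrow> move set" where
  "moves m = {Move k i j | k i j.
     k \<in> {1..m} \<and> i \<in> Pebble ` {1..m} \<union> {LeftEnd} \<and> j \<in> Pebble ` {1..m} \<union> {RightEnd} \<and> i \<noteq> j}"

datatype ('a, 'q) trans = Silent 'q 'q | Read 'q move 'a 'q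

record ('a, 'q) pia =
  alphabet :: "'a set"
  pebbles :: nat
  states :: "'q set"
  init :: 'q
  final :: "'q set"
  delta :: "('a, 'q) trans set"

definition is_pia :: "('a, 'q) pia \<Rightarrow> bool" where
  "is_pia A \<longleftrightarrow>
     finite (alphabet A) \<and> finite (states A) \<and> init A \<in> states A \<and> final A \<subseteq> states A \<and>
     delta A \<subseteq>
       {Silent q q' | q q'. q \<in> states A \<and> q' \<in> states A} \<union>
       {Read q mv a q' | q mv a q'.
          q \<in> states A \<and> mv \<in> moves (pebbles A) \<and> a \<in> alphabet A \<and> q' \<in> states A}"

text \<open>
  A configuration consists of a state, a pebble assignment (\<open>None\<close> for pebbles that are not placed)
  and the set of positions already read.  Positions of a string \<open>u\<close> are \<open>1, \<dots>, length u\<close>.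
\<close>

type_synonym 'q config = "'q \<times> (nat \<Rightarrow> nat option) \<times> nat set"

definition is_config :: "('a, 'q) pia \<Rightarrow> 'a list \<Rightarrow> 'q config \<Rightarrow> bool" where
  "is_config A u = (\<lambda>(q, \<rho>, N).
     q \<in> states A \<and>
     dom \<rho> \<subseteq> {1..pebbles A} \<and> ran \<rho> \<subseteq> {1..length u} \<and> inj_on \<rho> (dom \<rho>) \<and>
     N \<subseteq> {1..length u})"

fun pos :: "'a list \<Rightarrow> (nat \<Rightarrow> nat option) \<Rightarrow> ref \<Rightarrow> nat option" where
  "pos u \<rho> (Pebble i) = \<rho> i"
| "pos u \<rho> LeftEnd = Some 0"
| "pos u \<rho> RightEnd = Some (length u + 1)"

inductive step :: "('a, 'q) pia \<Rightarrow> 'a list \<Rightarrow> 'q config \<Rightarrow> 'q config \<Rightarrow> bool"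
  for A :: "('a, 'q) pia" and u :: "'a list" where
  silent: "Silent q q' \<in> delta A \<Longrightarrow> step A u (q, \<rho>, N) (q', \<rho>, N)"
| read: "l \<in> {1..length u} - N \<Longrightarrow>
    Read q (Move k i j) (u ! (l - 1)) q' \<in> delta A \<Longrightarrow>
    pos u \<rho> i = Some x \<Longrightarrow> pos u \<rho> j = Some y \<Longrightarrow> x < l \<Longrightarrow> l < y \<Longrightarrow>
    step A u (q, \<rho>, N) (q', \<rho>(k \<mapsto> l), N \<union> {l})"

definition initial_config :: "('a, 'q) pia \<Rightarrow> 'q config" where
  "initial_config A = (init A, \<lambda>_. None, {})"

definition accepting :: "('a, 'q) pia \<Rightarrow> 'a list \<Rightarrow> 'q config \<Rightarrow> bool" where
  "accepting A u = (\<lambda>(q, \<rho>, N). q \<in> final A \<and> N = {1..length u})"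

definition lang_pia :: "('a, 'q) pia \<Rightarrow> 'a list set" where
  "lang_pia A =
     {u \<in> lists (alphabet A). \<exists>c. (step A u)\<^sup>*\<^sup>* (initial_config A) c \<and> accepting A u c}"


section \<open>Basic properties\<close>

lemma sat_cong: "(\<And>x. x \<in> fv \<phi> \<Longrightarrow> v x = v' x) \<Longrightarrow> sat D v \<phi> \<longleftrightarrow> sat D v' \<phi>"
proof (induction \<phi> arbitrary: v v')
  case (Ex x \<phi>)
  have "sat D (v(x := d)) \<phi> \<longleftrightarrow> sat D (v'(x := d)) \<phi>" for d
    using Ex.prems by (intro Ex.IH) auto
  then show ?case by simp
next
  case (Neg \<phi>)
  have "sat D v \<phi> \<longleftrightarrow> sat D v' \<phi>" using Neg.prems by (intro Neg.IH) simp
  then show ?case by simp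
next
  case (Conj \<phi> \<psi>)
  have "sat D v \<phi> \<longleftrightarrow> sat D v' \<phi>" "sat D v \<psi> \<longleftrightarrow> sat D v' \<psi>"
    using Conj.prems by (auto intro!: Conj.IH)
  then show ?case by simp
qed auto

lemma models_iff_sat: "sentence_over \<Sigma> \<psi> \<Longrightarrow> models D \<psi> \<longleftrightarrow> sat D v \<psi>"
  unfolding models_def sentence_over_def using sat_cong[of \<psi>] by blast

definition map_dword :: "('d \<Rightarrow> 'e) \<Rightarrow> ('d, 'a) dword \<Rightarrow> ('e, 'a) dword" where
  "map_dword h D = \<lparr>univ = h ` univ D, le1 = map_prod h h ` le1 D, le2 = map_prod h h ` le2 D,
     lab = (\<lambda>a. h ` (lab D a \<inter> univ D))\<rparr>"

lemma data_word_dest: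
  assumes "data_word \<Sigma> D"
  shows "finite (univ D)" "le1 D \<subseteq> univ D \<times> univ D" "le2 D \<subseteq> univ D \<times> univ D"
  using assms
  by (auto simp: data_word_def linear_order_on_def partial_order_on_def preorder_on_def)

lemma map_prod_mem:
  assumes "inj_on h U" "r \<subseteq> U \<times> U" "x \<in> U" "y \<in> U"
  shows "(h x, h y) \<in> map_prod h h ` r \<longleftrightarrow> (x, y) \<in> r"
proof
  assume "(h x, h y) \<in> map_prod h h ` r"
  then obtain a b where ab: "(a, b) \<in> r" "h x = h a" "h y = h b" by auto
  then have "a \<in> U" "b \<in> U" using assms(2) by auto
  then have "x = a" "y = b" using ab(2,3) assms(1,3,4) by (auto dest: inj_onD)
  then show "(x, y) \<in> r" using ab(1) by simp
next
  assume "(x, y) \<in> r"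
  then show "(h x, h y) \<in> map_prod h h ` r" by (rule map_prod_imageI)
qed

lemma image_mem:
  assumes "inj_on h U" "x \<in> U"
  shows "h x \<in> h ` (S \<inter> U) \<longleftrightarrow> x \<in> S"
  using inj_on_image_mem_iff[OF assms, of "S \<inter> U"] assms(2) by simp

lemma data_word_map:
  assumes D: "data_word \<Sigma> D" and h: "inj_on h (univ D)"
  shows "data_word \<Sigma> (map_dword h D)"
proof -
  note sub = data_word_dest(2,3)[OF D]
  note mem = map_prod_mem[OF h sub(1)] map_prod_mem[OF h sub(2)]
  have tr: "trans (map_prod h h ` r)" if "trans r" "r \<subseteq> univ D \<times> univ D" for r
  proof (rule transI)
    fix x y z assume "(x, y) \<in> map_prod h h ` r" "(y, z) \<in> map_prod h h ` r"
    then obtain a b c d where *: "(a, b) \<in> r" "(c, d) \<in> r" "x = h a" "y = h b" "y = h c" "z = h d"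
      by auto
    then have "b = c" using that(2) h by (auto simp: inj_on_def)
    then have "(a, d) \<in> r" using * that(1) by (auto dest: transD)
    then show "(x, z) \<in> map_prod h h ` r" using * by force
  qed
  have an: "antisym (map_prod h h ` le1 D)"
  proof (rule antisymI)
    fix x y assume a: "(x, y) \<in> map_prod h h ` le1 D" "(y, x) \<in> map_prod h h ` le1 D"
    then obtain p q where *: "(p, q) \<in> le1 D" "x = h p" "y = h q" by auto
    then have "p \<in> univ D" "q \<in> univ D" using sub by auto
    then have "(q, p) \<in> le1 D" using a(2) * mem(1) by simp
    then show "x = y" using * D
      by (auto simp: data_word_def linear_order_on_def partial_order_on_def dest: antisymD)
  qed
  have lb: "\<exists>!a. a \<in> \<Sigma> \<and> h d \<in> h ` (lab D a \<inter> univ D)" if "d \<in> univ D" for d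
    using D that by (simp add: image_mem[OF h that] data_word_def)
  have rt: "refl_on (h ` univ D) (map_prod h h ` r) \<and> total_on (h ` univ D) (map_prod h h ` r)"
    if "refl_on (univ D) r" "total_on (univ D) r" for r
    using that unfolding refl_on_def total_on_def by force
  have D': "trans (le1 D)" "trans (le2 D)" "refl_on (univ D) (le1 D)" "refl_on (univ D) (le2 D)"
    "total_on (univ D) (le1 D)" "total_on (univ D) (le2 D)"
    using D by (auto simp: data_word_def linear_order_on_def partial_order_on_def preorder_on_def)
  have "map_prod h h ` r \<subseteq> h ` univ D \<times> h ` univ D" if "r \<subseteq> univ D \<times> univ D" for r
    using that by auto
  note sub' = this[OF sub(1)] this[OF sub(2)]
  have lb': "\<forall>d\<in>h ` univ D. \<exists>!a. a \<in> \<Sigma> \<and> d \<in> h ` (lab D a \<inter> univ D)"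
    by (intro ballI, erule imageE, hypsubst, rule lb)
  have "finite (h ` univ D)" "\<forall>a\<in>\<Sigma>. h ` (lab D a \<inter> univ D) \<subseteq> h ` univ D"
    using data_word_dest(1)[OF D] by auto
  then show ?thesis
    unfolding data_word_def linear_order_on_def partial_order_on_def preorder_on_def map_dword_def
      dword.select_convs
    by (intro conjI lb' sub' an tr[OF D'(1) sub(1)] tr[OF D'(2) sub(2)]
        rt[OF D'(3,5), THEN conjunct1] rt[OF D'(3,5), THEN conjunct2]
        rt[OF D'(4,6), THEN conjunct1] rt[OF D'(4,6), THEN conjunct2])
qed

lemma succ2_map:
  assumes D: "data_word \<Sigma> D" and h: "inj_on h (univ D)" and "x \<in> univ D" "y \<in> univ D"
  shows "succ2 (map_dword h D) (h x) (h y) \<longleftrightarrow> succ2 D x y"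
proof -
  have "less2 (map_dword h D) (h a) (h b) \<longleftrightarrow> less2 D a b" if "a \<in> univ D" "b \<in> univ D" for a b
    using map_prod_mem[OF h data_word_dest(3)[OF D]] that by (simp add: less2_def map_dword_def)
  then show ?thesis
    using assms(3,4) by (simp add: succ2_def) (simp add: map_dword_def)
qed

lemma sat_map:
  assumes D: "data_word \<Sigma> D" and h: "inj_on h (univ D)"
  shows "(\<And>x. x \<in> fv \<phi> \<Longrightarrow> v x \<in> univ D \<and> v' x = h (v x)) \<Longrightarrow>
    sat (map_dword h D) v' \<phi> \<longleftrightarrow> sat D v \<phi>"
proof (induction \<phi> arbitrary: v v')
  case (Le1 x y)
  then show ?case
    using map_prod_mem[OF h data_word_dest(2)[OF D]] by (simp add: map_dword_def)
next
  case (Le2 x y)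
  then show ?case
    using map_prod_mem[OF h data_word_dest(3)[OF D]] by (simp add: map_dword_def)
next
  case (S2 x y)
  then show ?case using succ2_map[OF D h] by simp
next
  case (Lab a x)
  then show ?case using image_mem[OF h] by (simp add: map_dword_def)
next
  case (Eq x y)
  then show ?case using h by (auto simp: inj_on_def)
next
  case (Neg \<phi>)
  have "sat (map_dword h D) v' \<phi> \<longleftrightarrow> sat D v \<phi>" using Neg.prems by (intro Neg.IH) simp
  then show ?case by simp
next
  case (Conj \<phi> \<psi>)
  have "sat (map_dword h D) v' \<phi> \<longleftrightarrow> sat D v \<phi>" "sat (map_dword h D) v' \<psi> \<longleftrightarrow> sat D v \<psi>"
    using Conj.prems by (auto intro!: Conj.IH)
  then show ?case by simp
next
  case (Ex x \<phi>)
  have "sat (map_dword h D) (v'(x := h d)) \<phi> \<longleftrightarrow> sat D (v(x := d)) \<phi>" if "d \<in> univ D" for d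
    using Ex.prems that by (intro Ex.IH) auto
  then show ?case by (simp add: map_dword_def)
qed

lemma string_projection_map:
  assumes D: "data_word \<Sigma> D" and h: "inj_on h (univ D)" and w: "string_projection \<Sigma> D w"
  shows "string_projection \<Sigma> (map_dword h D) w"
proof -
  obtain ds where ds: "distinct ds" "set ds = univ D" "sorted_wrt (\<lambda>x y. (x, y) \<in> le1 D) ds"
    "length w = length ds" "\<forall>l<length ds. \<forall>a\<in>\<Sigma>. w ! l = a \<longleftrightarrow> ds ! l \<in> lab D a" "w \<in> lists \<Sigma>"
    using w by (auto simp: string_projection_def)
  have "sorted_wrt (\<lambda>x y. (x, y) \<in> map_prod h h ` le1 D) (map h ds)"
    unfolding sorted_wrt_map by (rule sorted_wrt_mono_rel[OF _ ds(3)]) force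
  moreover have "h (ds ! l) \<in> h ` (lab D a \<inter> univ D) \<longleftrightarrow> ds ! l \<in> lab D a" if "l < length ds" for l a
  proof (rule image_mem[OF h])
    show "ds ! l \<in> univ D" using that ds(2) nth_mem by blast
  qed
  ultimately show ?thesis
    unfolding string_projection_def using ds h
    by (intro conjI exI[of _ "map h ds"]) (simp_all add: map_dword_def distinct_map)
qed

lemma lang_fo2I:
  fixes D :: "('d, 'a) dword"
  assumes "sentence_over \<Sigma> \<psi>" and D: "data_word \<Sigma> D" and "models D \<psi>" "string_projection \<Sigma> D w"
  shows "w \<in> lang_fo2 \<Sigma> \<psi>"
proof -
  obtain h :: "'d \<Rightarrow> nat" where h: "inj_on h (univ D)"
    using data_word_dest(1)[OF D] finite_imp_inj_to_nat_seg by blast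
  have "sat D v \<psi>" for v using assms(3) by (simp add: models_def)
  then have "models (map_dword h D) \<psi>"
    using sat_map[OF D h, of \<psi>] assms(1) by (auto simp: models_def sentence_over_def)
  then show ?thesis
    using data_word_map[OF D h] string_projection_map[OF D h assms(4)]
    unfolding lang_fo2_def by blast
qed

text \<open>Every data word has exactly one string projection.\<close>

lemma string_projection_unique:
  assumes D: "data_word \<Sigma> D" and w: "string_projection \<Sigma> D w" and w': "string_projection \<Sigma> D w'"
  shows "w = w'"
proof -
  let ?R = "\<lambda>x y. (x, y) \<in> le1 D"
  obtain ds where ds: "distinct ds" "set ds = univ D" "sorted_wrt ?R ds"
    "length w = length ds" "\<forall>l<length ds. \<forall>a\<in>\<Sigma>. w ! l = a \<longleftrightarrow> ds ! l \<in> lab D a" "w \<in> lists \<Sigma>"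
    using w by (auto simp: string_projection_def)
  obtain es where es: "distinct es" "set es = univ D" "sorted_wrt ?R es"
    "length w' = length es" "\<forall>l<length es. \<forall>a\<in>\<Sigma>. w' ! l = a \<longleftrightarrow> es ! l \<in> lab D a" "w' \<in> lists \<Sigma>"
    using w' by (auto simp: string_projection_def)
  have anti: "antisym (le1 D)"
    using D by (auto simp: data_word_def linear_order_on_def partial_order_on_def)
  have "xs = ys" if "distinct xs" "distinct ys" "set xs = set ys" "sorted_wrt ?R xs"
    "sorted_wrt ?R ys" for xs ys
    using that
  proof (induction xs arbitrary: ys)
    case (Cons x xs)
    then obtain y ys' where ys: "ys = y # ys'" by (cases ys) auto
    have "x = y"
    proof (rule ccontr)
      assume "x \<noteq> y"
      then have "(x, y) \<in> le1 D" "(y, x) \<in> le1 D" using Cons.prems ys by auto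
      then show False using anti \<open>x \<noteq> y\<close> by (auto dest: antisymD)
    qed
    moreover have "xs = ys'" using Cons.prems ys \<open>x = y\<close> by (intro Cons.IH) auto
    ultimately show ?case using ys by simp
  qed simp
  then have "ds = es" using ds es by simp
  show ?thesis
  proof (rule nth_equalityI)
    show "length w = length w'" using ds(4) es(4) \<open>ds = es\<close> by simp
    fix i assume "i < length w"
    then have "i < length ds" "w ! i \<in> \<Sigma>" using ds(4,6) by auto
    then have "ds ! i \<in> lab D (w ! i)" using ds(5) by blast
    then have "w' ! i = w ! i"
      using es(5) \<open>i < length ds\<close> \<open>w ! i \<in> \<Sigma>\<close> \<open>ds = es\<close> by blast
    then show "w ! i = w' ! i" by simp
  qed
qed

lemma string_projection_exists:
  assumes D: "data_word \<Sigma> D"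
  shows "\<exists>w. string_projection \<Sigma> D w"
proof -
  let ?R = "\<lambda>x y. (x, y) \<in> le1 D"
  have lin: "trans (le1 D)" "total_on (univ D) (le1 D)"
    using D by (auto simp: data_word_def linear_order_on_def partial_order_on_def preorder_on_def)
  have "\<exists>ds. distinct ds \<and> set ds = S \<and> sorted_wrt ?R ds" if "finite S" "S \<subseteq> univ D" for S
    using that
  proof (induction S rule: finite_induct)
    case (insert x S)
    then obtain ds where ds: "distinct ds" "set ds = S" "sorted_wrt ?R ds" by auto
    have tot: "(x, y) \<in> le1 D" if "y \<in> S" "(y, x) \<notin> le1 D" for y
      using lin(2) insert.hyps insert.prems that unfolding total_on_def by auto
    let ?P = "\<lambda>y. (y, x) \<in> le1 D"
    let ?es = "filter ?P ds @ x # filter (\<lambda>y. \<not> ?P y) ds"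
    have tr: "(y, z) \<in> le1 D" if "(y, x) \<in> le1 D" "(x, z) \<in> le1 D" for y z
      using lin(1) that by (rule transD)
    have "sorted_wrt ?R ?es"
      unfolding sorted_wrt_append sorted_wrt.simps
      using ds(2,3) tot tr by (simp add: sorted_wrt_filter)
    moreover have "distinct ?es" "set ?es = insert x S" using ds insert.hyps by auto
    ultimately show ?case by blast
  qed simp
  then obtain ds where ds: "distinct ds" "set ds = univ D" "sorted_wrt ?R ds"
    using data_word_dest(1)[OF D] by blast
  have ex: "\<exists>!a. a \<in> \<Sigma> \<and> d \<in> lab D a" if "d \<in> univ D" for d
    using D that by (simp add: data_word_def)
  define f where "f d = (THE a. a \<in> \<Sigma> \<and> d \<in> lab D a)" for d
  have f: "f d \<in> \<Sigma> \<and> d \<in> lab D (f d)" if "d \<in> univ D" for d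
    unfolding f_def using theI'[OF ex[OF that]] .
  have g: "f (ds ! l) = a \<longleftrightarrow> ds ! l \<in> lab D a" if "l < length ds" "a \<in> \<Sigma>" for l a
  proof -
    have "ds ! l \<in> univ D" using that(1) ds(2) nth_mem by blast
    from f[OF this] ex[OF this] that(2) show ?thesis by blast
  qed
  have "string_projection \<Sigma> D (map f ds)"
    unfolding string_projection_def
  proof (intro conjI exI[of _ ds] ds allI impI ballI)
    show "map f ds \<in> lists \<Sigma>" using f ds(2) by auto
  qed (simp_all add: g)
  then show ?thesis by blast
qed

text \<open>
  The requirements on configurations need not be repeated in the definition of steps:
  they hold initially and are preserved, since a pebble is only ever placed on an unread position.
\<close>

lemma reachable_is_config:
  assumes A: "is_pia A" and "(step A u)\<^sup>*\<^sup>* (initial_config A) c"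
  shows "is_config A u c"
proof -
  have "is_config A u c \<and> ran (fst (snd c)) \<subseteq> snd (snd c)"
    using assms(2)
  proof (induction rule: rtranclp_induct)
    case base
    then show ?case
      using A by (auto simp: initial_config_def is_config_def is_pia_def)
  next
    case (step c c')
    from step.hyps(2) step.IH show ?case
    proof cases
      case (silent q q' \<rho> N)
      then show ?thesis using step.IH A by (auto simp: is_config_def is_pia_def)
    next
      case (read l N q k i j q' \<rho> x y)
      have qk: "q' \<in> states A" "k \<in> {1..pebbles A}"
        using read(4) A by (auto simp: is_pia_def moves_def)
      have c: "dom \<rho> \<subseteq> {1..pebbles A}" "ran \<rho> \<subseteq> N" "inj_on \<rho> (dom \<rho>)" "N \<subseteq> {1..length u}"
        using step.IH read(1) by (auto simp: is_config_def)
      have r: "ran (\<rho>(k \<mapsto> l)) \<subseteq> N \<union> {l}"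
        using c(2) by (auto simp: ran_def split: if_splits)
      have new: "\<rho> z \<noteq> Some l" for z
        using c(2) read(3) by (auto simp: ran_def)
      have "inj_on (\<rho>(k \<mapsto> l)) (dom (\<rho>(k \<mapsto> l)))"
        using c(3) new unfolding inj_on_def by (auto simp: dom_def)
      moreover have "dom (\<rho>(k \<mapsto> l)) \<subseteq> {1..pebbles A}" "N \<union> {l} \<subseteq> {1..length u}"
        using qk(2) c(1,4) read(3) by auto
      moreover from this have "ran (\<rho>(k \<mapsto> l)) \<subseteq> {1..length u}"
        using r by (meson order_trans)
      ultimately show ?thesis
        unfolding read(2) is_config_def prod.case fst_conv snd_conv
        using qk(1) r by (intro conjI)
    qed
  qed
  then show ?thesis by simp
qed

end

theory Submission
  imports Defs
begin

text \<open>
  Label every element by its letter together with the set of subformulas \<open>Ex x \<phi>\<close> that hold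
  there.  Whether such a labelling is correct can be checked at each element separately, from the
  labels found to its left and to its right in five ranges of rows (classes of \<open>le2\<close>) relative to
  its own row: at least two below, just below, equal, just above, at least two above.

  The automaton sweeps over the rows upwards and keeps pebbles on the leftmost and the rightmost
  element of every label in each of the five ranges around the current row.  These determine the
  labels to the left and right of any position.  Since a pebble is placed by reading, the extremal
  elements of the rows above are read before their row is reached; which of them belong to the next
  row is guessed.  Everything else in a row is read while that row is current, between two pebbles
  with the same label, which is what prevents the automaton from lying about the extrema.
\<close>

section \<open>Local correctness of labellings\<close>

text \<open>With two variables, the truth of \<open>Ex x \<phi>\<close> depends on one element only.
  It can be treated as a colour of that element, and what remains is a quantifier-free condition on
  pairs. Five ranges of rows are needed because \<open>S2\<close> separates row difference one from
  larger differences, in both directions. The obstacle is that a position is read once and a pebble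
  can only go to an unread position. The extrema of a later row are therefore consumed early and
  have to stay extremal, or be dropped safely, in every range through which they pass. This works
  because an advance of the current row only refines the tag classes above it and only merges those
  below it: new extrema arise only where the topmost range splits. Soundness is not argued forwards:
  the marking forgets a position once its tag is dropped, and the extreme ranges lump unboundedly
  many rows together. The rows are instead reconstructed from the end of a run. The empty word has
  no position at which a check could be made, so it is decided separately.\<close>

fun other :: "var \<Rightarrow> var" where
  "other VX = VY"
| "other VY = VX"

fun exs :: "'a fo2 \<Rightarrow> 'a fo2 set" where
  "exs (Neg \<phi>) = exs \<phi>"
| "exs (Conj \<phi> \<psi>) = exs \<phi> \<union> exs \<psi>"
| "exs (Ex x \<phi>) = insert (Ex x \<phi>) (exs \<phi>)"
| "exs _ = {}"

lemma finite_exs: "finite (exs \<phi>)"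
  by (induction \<phi>) auto

lemma exs_trans: "\<chi> \<in> exs \<phi> \<Longrightarrow> exs \<chi> \<subseteq> exs \<phi>"
  by (induction \<phi>) auto

type_synonym 'a label = "'a \<times> 'a fo2 set"

text \<open>\<open>g\<close>, \<open>c\<close> and \<open>r\<close> give label, column and row of
  each variable. A quantified formula is not evaluated but looked up at the variable it may still
  depend on. \<open>S2\<close> becomes difference one because rows will be numbered without
  gaps.\<close>

fun ev :: "'a fo2 \<Rightarrow> (var \<Rightarrow> 'a label) \<Rightarrow> (var \<Rightarrow> int) \<Rightarrow> (var \<Rightarrow> int) \<Rightarrow> bool" where
  "ev (Le1 x y) g c r \<longleftrightarrow> c x \<le> c y"
| "ev (Le2 x y) g c r \<longleftrightarrow> r x \<le> r y"
| "ev (S2 x y) g c r \<longleftrightarrow> r y = r x + 1"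
| "ev (Lab a x) g c r \<longleftrightarrow> fst (g x) = a"
| "ev (Eq x y) g c r \<longleftrightarrow> c x = c y"
| "ev (Neg \<phi>) g c r \<longleftrightarrow> \<not> ev \<phi> g c r"
| "ev (Conj \<phi> \<psi>) g c r \<longleftrightarrow> ev \<phi> g c r \<and> ev \<psi> g c r"
| "ev (Ex x \<phi>) g c r \<longleftrightarrow> Ex x \<phi> \<in> snd (g (other x))"

lemma ev_cong:
  assumes "\<And>x y. c x \<le> c y \<longleftrightarrow> c' x \<le> c' y" "\<And>x y. r x \<le> r y \<longleftrightarrow> r' x \<le> r' y"
    "\<And>x y. r y = r x + 1 \<longleftrightarrow> r' y = r' x + 1"
  shows "ev \<phi> g c r \<longleftrightarrow> ev \<phi> g c' r'"
proof (induction \<phi>)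
  case (Eq x y)
  have "c x = c y \<longleftrightarrow> c' x = c' y" using assms(1)[of x y] assms(1)[of y x] by linarith
  then show ?case by simp
qed (use assms in simp_all)

text \<open>
  \<open>Le2\<close> and \<open>S2\<close> only see differences of rows up to truncation to $[-2, 2]$.
\<close>

definition lev :: "int \<Rightarrow> int" where
  "lev d = max (-2) (min 2 d)"

type_synonym 'a tag = "'a label \<times> int"

definition tags :: "(nat \<Rightarrow> 'g) \<Rightarrow> (nat \<Rightarrow> int) \<Rightarrow> int \<Rightarrow> nat set \<Rightarrow> ('g \<times> int) set" where
  "tags lb row t S = (\<lambda>q. (lb q, lev (row q - t))) ` S"

text \<open>
  \<open>A\<close> and \<open>B\<close> are the tags found to the left and to the right of an element with label \<open>g\<close>.
  Only signs and truncated differences matter to \<open>ev\<close>, so the element itself is placed at $(0, 0)$.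
\<close>

definition good :: "'a fo2 \<Rightarrow> 'a tag set \<Rightarrow> 'a label \<Rightarrow> 'a tag set \<Rightarrow> bool" where
  "good \<psi> A g B \<longleftrightarrow> ev \<psi> (\<lambda>_. g) (\<lambda>_. 0) (\<lambda>_. 0) \<and>
     (\<forall>v \<phi>. Ex v \<phi> \<in> exs \<psi> \<longrightarrow>
        (Ex v \<phi> \<in> snd g \<longleftrightarrow>
           ev \<phi> (\<lambda>_. g) (\<lambda>_. 0) (\<lambda>_. 0) \<or>
           (\<exists>(h, k)\<in>A. ev \<phi> ((\<lambda>_. g)(v := h)) ((\<lambda>_. 0)(v := -1)) ((\<lambda>_. 0)(v := k))) \<or>
           (\<exists>(h, k)\<in>B. ev \<phi> ((\<lambda>_. g)(v := h)) ((\<lambda>_. 0)(v := 1)) ((\<lambda>_. 0)(v := k)))))"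

text \<open>
  Rows are numbered from 2, so that at the start of the sweep, where the current row is 0, all
  elements have level 2.
\<close>

definition rows :: "nat set \<Rightarrow> (nat \<Rightarrow> int) \<Rightarrow> bool" where
  "rows V row \<longleftrightarrow> (\<forall>p\<in>V. 2 \<le> row p \<and> (2 < row p \<longrightarrow> (\<exists>q\<in>V. row q = row p - 1)))"

section \<open>Data words in normal form: grids over the positions of a string\<close>

definition grid :: "'a list \<Rightarrow> (nat \<Rightarrow> int) \<Rightarrow> (nat, 'a) dword" where
  "grid u row = \<lparr>univ = {1..length u}, le1 = {(p, q). p \<in> {1..length u} \<and> q \<in> {1..length u} \<and> p \<le> q},
     le2 = {(p, q). p \<in> {1..length u} \<and> q \<in> {1..length u} \<and> row p \<le> row q},
     lab = (\<lambda>a. {p \<in> {1..length u}. u ! (p - 1) = a})\<rparr>"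

text \<open>If \<open>row q\<close> exceeded \<open>row p\<close> by more than one, the inhabited
  row just below \<open>q\<close> would lie strictly between the two; \<open>rows\<close> supplies
  it because \<open>row q\<close> exceeds the bottom row 2.\<close>

lemma succ2_grid:
  assumes "rows {1..length u} row" "p \<in> {1..length u}" "q \<in> {1..length u}"
  shows "succ2 (grid u row) p q \<longleftrightarrow> row q = row p + 1"
proof
  assume s: "succ2 (grid u row) p q"
  have lt: "row p < row q" using s assms by (auto simp: succ2_def less2_def grid_def)
  show "row q = row p + 1"
  proof (rule ccontr)
    assume n: "row q \<noteq> row p + 1"
    have "2 \<le> row p" using assms by (auto simp: rows_def)
    then have "2 < row q" using lt by simp
    then obtain z where "z \<in> {1..length u}" "row z = row q - 1" using assms by (auto simp: rows_def)
    then have "less2 (grid u row) p z \<and> less2 (grid u row) z q" "z \<in> univ (grid u row)"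
      using lt n assms by (auto simp: less2_def grid_def)
    then show False using s by (auto simp: succ2_def)
  qed
qed (use assms in \<open>auto simp: succ2_def less2_def grid_def\<close>)

lemma data_word_grid:
  assumes "u \<in> lists \<Sigma>"
  shows "data_word \<Sigma> (grid u row)" "string_projection \<Sigma> (grid u row) u"
proof -
  have "\<exists>!a. a \<in> \<Sigma> \<and> d \<in> {p \<in> {1..length u}. u ! (p - 1) = a}" if "d \<in> {1..length u}" for d
  proof -
    have "d - 1 < length u" using that by auto
    then have "u ! (d - 1) \<in> set u" by (rule nth_mem)
    then have "u ! (d - 1) \<in> \<Sigma>" using assms by auto
    then show ?thesis using that by auto
  qed
  then show "data_word \<Sigma> (grid u row)"
    by (auto simp: data_word_def grid_def linear_order_on_def partial_order_on_def preorder_on_def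
        refl_on_def total_on_def trans_def antisym_def)
  have "sorted_wrt (\<lambda>x y. (x, y) \<in> le1 (grid u row)) [1..<Suc (length u)]"
    by (rule sorted_wrt_mono_rel[OF _ sorted_wrt_upt]) (auto simp: grid_def)
  then show "string_projection \<Sigma> (grid u row) u"
    unfolding string_projection_def using assms
    by (intro conjI exI[of _ "[1..<Suc (length u)]"])
      (auto simp: grid_def nth_append simp del: upt_Suc)
qed

text \<open>Two rankings are composed. \<open>f x\<close> counts the elements strictly below
  \<open>x\<close>; this represents the preorder but skips values. Counting the values of
  \<open>f\<close> below \<open>f x\<close> closes the gaps, and the offset 2 makes the bottom row
  number 2.\<close>

lemma total_preorder_rows:
  assumes fin: "finite U" and le: "preorder_on U le" "total_on U le"
  shows "\<exists>row :: 'd \<Rightarrow> int. (\<forall>x\<in>U. \<forall>y\<in>U. (x, y) \<in> le \<longleftrightarrow> row x \<le> row y) \<and>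
    (\<forall>x\<in>U. 2 \<le> row x \<and> (2 < row x \<longrightarrow> (\<exists>y\<in>U. row y = row x - 1)))"
proof -
  have tr: "trans le" and rf: "\<And>x. x \<in> U \<Longrightarrow> (x, x) \<in> le"
    using le by (auto simp: preorder_on_def refl_on_def)
  define f where "f x = card {y \<in> U. (x, y) \<notin> le}" for x
  have f: "(x, y) \<in> le \<longleftrightarrow> f x \<le> f y" if "x \<in> U" "y \<in> U" for x y
  proof
    assume "(x, y) \<in> le"
    then have "{z \<in> U. (x, z) \<notin> le} \<subseteq> {z \<in> U. (y, z) \<notin> le}" using transD[OF tr] by blast
    then show "f x \<le> f y" unfolding f_def using fin by (intro card_mono) auto
  next
    assume "f x \<le> f y"
    show "(x, y) \<in> le"
    proof (rule ccontr)
      assume n: "(x, y) \<notin> le"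
      then have yx: "(y, x) \<in> le" using le(2) rf that unfolding total_on_def by metis
      have "{z \<in> U. (y, z) \<notin> le} \<subseteq> {z \<in> U. (x, z) \<notin> le}" using transD[OF tr yx] by blast
      moreover have "y \<in> {z \<in> U. (x, z) \<notin> le} - {z \<in> U. (y, z) \<notin> le}" using n rf that by auto
      ultimately have "{z \<in> U. (y, z) \<notin> le} \<subset> {z \<in> U. (x, z) \<notin> le}" by blast
      then have "f y < f x" unfolding f_def using fin by (intro psubset_card_mono) auto
      then show False using \<open>f x \<le> f y\<close> by simp
    qed
  qed
  define B where "B x = {w \<in> f ` U. w < f x}" for x
  have finB: "finite (B x)" for x using fin by (simp add: B_def)
  define row where "row x = 2 + int (card (B x))" for x
  have row: "f x \<le> f y \<longleftrightarrow> row x \<le> row y" if "x \<in> U" "y \<in> U" for x y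
  proof
    assume "f x \<le> f y"
    then have "B x \<subseteq> B y" by (auto simp: B_def)
    then have "card (B x) \<le> card (B y)" by (rule card_mono[OF finB])
    then show "row x \<le> row y" by (simp add: row_def)
  next
    assume a: "row x \<le> row y"
    show "f x \<le> f y"
    proof (rule ccontr)
      assume "\<not> f x \<le> f y"
      then have "f y < f x" by simp
      then have "f y \<in> B x - B y" "B y \<subseteq> B x" using that(2) by (auto simp: B_def)
      then have "B y \<subset> B x" by blast
      then have "card (B y) < card (B x)" by (rule psubset_card_mono[OF finB])
      then show False using a by (simp add: row_def)
    qed
  qed
  have "\<exists>y\<in>U. row y = row x - 1" if "x \<in> U" "2 < row x" for x
  proof -
    have "B x \<noteq> {}" using that(2) by (auto simp: row_def)
    then have M: "Max (B x) \<in> B x" using finB by simp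
    then obtain y where y: "y \<in> U" "Max (B x) = f y" by (auto simp: B_def)
    \<comment> \<open>\<open>f y\<close> is the largest value below \<open>f x\<close>, so passing
      from \<open>x\<close> to \<open>y\<close> loses exactly this one value.\<close>
    have "B y = B x - {f y}"
    proof -
      have "w < f y" if "w \<in> B x" "w \<noteq> f y" for w
        using Max_ge[OF finB that(1)] y(2) that(2) by simp
      then show ?thesis using M y(2) by (auto simp: B_def)
    qed
    then have "card (B x) = Suc (card (B y))" using M y(2) card_Suc_Diff1[OF finB, of "f y" x] by simp
    then show ?thesis using y(1) by (auto simp: row_def)
  qed
  moreover have "2 \<le> row x" for x by (simp add: row_def)
  moreover have "(x, y) \<in> le \<longleftrightarrow> row x \<le> row y" if "x \<in> U" "y \<in> U" for x y
    using f row that by simp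
  ultimately show ?thesis by (intro exI[of _ row]) simp
qed

text \<open>Sending position \<open>p\<close> to \<open>ds ! (p - 1)\<close> is an isomorphism from
  the grid onto the data word; the shift by one is due to lists being indexed from 0. Valuations are
  related on free variables only, since for sentences they may take values outside the
  universe.\<close>

lemma sat_grid:
  assumes D: "data_word \<Sigma> D" and w: "w \<in> lists \<Sigma>"
    and ds: "distinct ds" "set ds = univ D" "sorted_wrt (\<lambda>x y. (x, y) \<in> le1 D) ds"
      "length w = length ds" "\<forall>l<length ds. \<forall>a\<in>\<Sigma>. w ! l = a \<longleftrightarrow> ds ! l \<in> lab D a"
    and row: "\<forall>x\<in>univ D. \<forall>y\<in>univ D. (x, y) \<in> le2 D \<longleftrightarrow> row x \<le> row y"
  shows "set_fo2 \<phi> \<subseteq> \<Sigma> \<Longrightarrow> \<forall>x\<in>fv \<phi>. f x \<in> {1..length w} \<and> v x = ds ! (f x - 1) \<Longrightarrow>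
    sat D v \<phi> \<longleftrightarrow> sat (grid w (\<lambda>p. row (ds ! (p - 1)))) f \<phi>"
proof (induction \<phi> arbitrary: f v)
  let ?G = "grid w (\<lambda>p. row (ds ! (p - 1)))"
  have mem: "ds ! (p - 1) \<in> univ D" if "p \<in> {1..length w}" for p
  proof -
    have "p - 1 < length ds" using that ds(4) by auto
    then show ?thesis using ds(2) nth_mem by blast
  qed
  have an: "antisym (le1 D)" and rf: "refl_on (univ D) (le1 D)"
    using D by (auto simp: data_word_def linear_order_on_def partial_order_on_def preorder_on_def)
  have le1: "(ds ! (p - 1), ds ! (q - 1)) \<in> le1 D \<longleftrightarrow> p \<le> q"
    if "p \<in> {1..length w}" "q \<in> {1..length w}" for p q
  proof -
    have lt: "(ds ! i, ds ! j) \<in> le1 D" if "i < j" "j < length ds" for i j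
      using ds(3) that by (simp add: sorted_wrt_iff_nth_less)
    have ne: "ds ! i \<noteq> ds ! j" if "i < j" "j < length ds" for i j
      using ds(1) that by (simp add: nth_eq_iff_index_eq)
    consider "p < q" | "p = q" | "q < p" by linarith
    then show ?thesis
    proof cases
      case 1
      then show ?thesis using lt[of "p - 1" "q - 1"] that ds(4) by auto
    next
      case 2
      then show ?thesis using rf mem[OF that(1)] by (auto simp: refl_on_def)
    next
      case 3
      then have "q - 1 < p - 1" "p - 1 < length ds" using that ds(4) by auto
      then show ?thesis using lt[of "q - 1" "p - 1"] ne[of "q - 1" "p - 1"] an 3
        by (auto dest: antisymD)
    qed
  qed
  have univ: "univ D = (\<lambda>p. ds ! (p - 1)) ` {1..length w}"
  proof -
    have "\<exists>p\<in>{1..length w}. d = ds ! (p - 1)" if "d \<in> set ds" for d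
    proof -
      obtain i where "i < length ds" "d = ds ! i" using \<open>d \<in> set ds\<close> by (metis in_set_conv_nth)
      then show ?thesis using ds(4) by (intro bexI[of _ "Suc i"]) auto
    qed
    then show ?thesis using mem ds(2) by auto
  qed
  have less2: "less2 ?G p q \<longleftrightarrow> less2 D (ds ! (p - 1)) (ds ! (q - 1))"
    if "p \<in> {1..length w}" "q \<in> {1..length w}" for p q
    using row mem that by (auto simp: less2_def grid_def)
  {
    case (Le1 x y)
    then show ?case using le1 by (auto simp: grid_def)
  next
    case (Le2 x y)
    then show ?case using row mem by (auto simp: grid_def)
  next
    case (S2 x y)
    have "univ ?G = {1..length w}" by (simp add: grid_def)
    then show ?case using S2 less2 unfolding succ2_def sat.simps univ by auto
  next
    case (Lab a x)
    then have "f x - 1 < length ds" "a \<in> \<Sigma>" using ds(4) by auto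
    then show ?case using Lab ds(5) by (auto simp: grid_def)
  next
    case (Eq x y)
    then have "f x - 1 < length ds" "f y - 1 < length ds" using ds(4) by auto
    then show ?case using Eq nth_eq_iff_index_eq[OF ds(1)] by auto
  next
    case (Neg \<phi>)
    have "sat D v \<phi> \<longleftrightarrow> sat ?G f \<phi>" using Neg.prems by (intro Neg.IH) auto
    then show ?case by simp
  next
    case (Conj \<phi>1 \<phi>2)
    have "sat D v \<phi>1 \<longleftrightarrow> sat ?G f \<phi>1" "sat D v \<phi>2 \<longleftrightarrow> sat ?G f \<phi>2"
      using Conj.prems by (intro Conj.IH; simp)+
    then show ?case by simp
  next
    case (Ex x \<phi>)
    have "sat D (v(x := ds ! (p - 1))) \<phi> \<longleftrightarrow> sat ?G (f(x := p)) \<phi>" if "p \<in> {1..length w}" for p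
      using Ex.prems that by (intro Ex.IH) auto
    moreover have "univ ?G = {1..length w}" by (simp add: grid_def)
    ultimately show ?case by (simp add: univ)
  }
qed

lemma lang_fo2_grid:
  assumes "sentence_over \<Sigma> \<psi>"
  shows "u \<in> lang_fo2 \<Sigma> \<psi> \<longleftrightarrow>
    u \<in> lists \<Sigma> \<and> (\<exists>row. rows {1..length u} row \<and> models (grid u row) \<psi>)"
proof
  assume "u \<in> lang_fo2 \<Sigma> \<psi>"
  then obtain D :: "(nat, 'a) dword" where D: "data_word \<Sigma> D" "models D \<psi>" "string_projection \<Sigma> D u"
    unfolding lang_fo2_def by blast
  obtain ds where ds: "distinct ds" "set ds = univ D" "sorted_wrt (\<lambda>x y. (x, y) \<in> le1 D) ds"
      "length u = length ds" "\<forall>l<length ds. \<forall>a\<in>\<Sigma>. u ! l = a \<longleftrightarrow> ds ! l \<in> lab D a"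
      and u: "u \<in> lists \<Sigma>"
    using D(3) unfolding string_projection_def by blast
  have "finite (univ D)" "preorder_on (univ D) (le2 D)" "total_on (univ D) (le2 D)"
    using D(1) by (simp_all add: data_word_def)
  from total_preorder_rows[OF this] obtain row :: "nat \<Rightarrow> int"
    where row: "\<forall>x\<in>univ D. \<forall>y\<in>univ D. (x, y) \<in> le2 D \<longleftrightarrow> row x \<le> row y"
      "\<forall>x\<in>univ D. 2 \<le> row x \<and> (2 < row x \<longrightarrow> (\<exists>y\<in>univ D. row y = row x - 1))"
    by blast
  let ?row = "\<lambda>p. row (ds ! (p - 1))"
  have mem: "ds ! (p - 1) \<in> univ D" if "p \<in> {1..length u}" for p
  proof -
    have "p - 1 < length ds" using that ds(4) by auto
    then show ?thesis using ds(2) nth_mem by blast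
  qed
  have surj: "\<exists>p\<in>{1..length u}. d = ds ! (p - 1)" if "d \<in> univ D" for d
  proof -
    have "d \<in> set ds" using that ds(2) by simp
    then obtain i where "i < length ds" "d = ds ! i" by (metis in_set_conv_nth)
    then show ?thesis using ds(4) by (intro bexI[of _ "Suc i"]) auto
  qed
  have "rows {1..length u} ?row"
    unfolding rows_def
  proof (intro ballI conjI impI)
    fix p assume p: "p \<in> {1..length u}"
    show "2 \<le> ?row p" using row(2) mem[OF p] by simp
    assume "2 < ?row p"
    then obtain d where d: "d \<in> univ D" "row d = ?row p - 1" using row(2) mem[OF p] by blast
    from surj[OF d(1)] d(2) show "\<exists>q\<in>{1..length u}. ?row q = ?row p - 1" by auto
  qed
  moreover have "sat (grid u ?row) f \<psi>" for f
  proof -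
    \<comment> \<open>Any valuation serves here: \<psi> has no free variables, so the second
      condition is vacuous.\<close>
    have "set_fo2 \<psi> \<subseteq> \<Sigma>" "\<forall>x\<in>fv \<psi>. f x \<in> {1..length u} \<and> undefined x = ds ! (f x - 1)"
      using assms by (simp_all add: sentence_over_def)
    then have "sat D undefined \<psi> \<longleftrightarrow> sat (grid u ?row) f \<psi>"
      by (rule sat_grid[OF D(1) u ds row(1)])
    then show ?thesis using D(2) by (simp add: models_def)
  qed
  ultimately show "u \<in> lists \<Sigma> \<and> (\<exists>row. rows {1..length u} row \<and> models (grid u row) \<psi>)"
    using u unfolding models_def by (intro conjI exI[of _ ?row]) simp_all
next
  assume "u \<in> lists \<Sigma> \<and> (\<exists>row. rows {1..length u} row \<and> models (grid u row) \<psi>)"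
  then obtain row where "u \<in> lists \<Sigma>" "models (grid u row) \<psi>" by blast
  then show "u \<in> lang_fo2 \<Sigma> \<psi>" using data_word_grid[of u \<Sigma> row] unfolding lang_fo2_def by blast
qed

section \<open>Locally correct labellings are exactly the semantic ones\<close>

lemma ev_positions:
  assumes "p \<in> {1..n}"
  shows "(\<exists>q\<in>{1..n}. ev \<phi> (\<lambda>x. lb (((\<lambda>_. p)(v := q)) x)) (\<lambda>x. int (((\<lambda>_. p)(v := q)) x))
      (\<lambda>x. row (((\<lambda>_. p)(v := q)) x))) \<longleftrightarrow>
    ev \<phi> (\<lambda>_. lb p) (\<lambda>_. 0) (\<lambda>_. 0) \<or>
    (\<exists>(h, k)\<in>tags lb row (row p) {q \<in> {1..n}. q < p}.
       ev \<phi> ((\<lambda>_. lb p)(v := h)) ((\<lambda>_. 0)(v := -1)) ((\<lambda>_. 0)(v := k))) \<or>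
    (\<exists>(h, k)\<in>tags lb row (row p) {q \<in> {1..n}. p < q}.
       ev \<phi> ((\<lambda>_. lb p)(v := h)) ((\<lambda>_. 0)(v := 1)) ((\<lambda>_. 0)(v := k)))"
proof -
  let ?E = "\<lambda>q. ev \<phi> (\<lambda>x. lb (((\<lambda>_. p)(v := q)) x)) (\<lambda>x. int (((\<lambda>_. p)(v := q)) x))
      (\<lambda>x. row (((\<lambda>_. p)(v := q)) x))"
  have lb: "(\<lambda>x. lb (((\<lambda>_. p)(v := q)) x)) = (\<lambda>_. lb p)(v := lb q)" for q by auto
  have eq: "?E p \<longleftrightarrow> ev \<phi> (\<lambda>_. lb p) (\<lambda>_. 0) (\<lambda>_. 0)"
    by (subst lb, subst fun_upd_triv, rule ev_cong) auto
  \<comment> \<open>Moving \<open>p\<close> to the origin leaves the sign of the column and the row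
    difference of \<open>q\<close>. Truncation to [-2, 2] still tells whether that difference is
    negative, zero or positive and whether it is 1 or -1, which is all that \<open>ev_cong\<close>
    asks for.\<close>
  have lt: "?E q \<longleftrightarrow> ev \<phi> ((\<lambda>_. lb p)(v := lb q)) ((\<lambda>_. 0)(v := -1)) ((\<lambda>_. 0)(v := lev (row q - row p)))"
    if "q < p" for q
    unfolding lb using that by (intro ev_cong) (auto simp: lev_def max_def min_def)
  have gt: "?E q \<longleftrightarrow> ev \<phi> ((\<lambda>_. lb p)(v := lb q)) ((\<lambda>_. 0)(v := 1)) ((\<lambda>_. 0)(v := lev (row q - row p)))"
    if "p < q" for q
    unfolding lb using that by (intro ev_cong) (auto simp: lev_def max_def min_def)
  let ?A = "{q \<in> {1..n}. q < p}" and ?B = "{q \<in> {1..n}. p < q}"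
  have S: "{1..n} = insert p (?A \<union> ?B)" using assms by auto
  have disj: "(\<exists>q\<in>S. P q) \<longleftrightarrow> P p \<or> (\<exists>q\<in>A. P q) \<or> (\<exists>q\<in>B. P q)"
    if "S = insert p (A \<union> B)" for S A B and P :: "nat \<Rightarrow> bool"
    unfolding that by blast
  have "(\<exists>q\<in>{1..n}. ?E q) \<longleftrightarrow> ?E p \<or> (\<exists>q\<in>?A. ?E q) \<or> (\<exists>q\<in>?B. ?E q)"
    by (rule disj[OF S])
  moreover have "(\<exists>q\<in>?A. ?E q) \<longleftrightarrow> (\<exists>q\<in>?A. ev \<phi> ((\<lambda>_. lb p)(v := lb q)) ((\<lambda>_. 0)(v := -1))
      ((\<lambda>_. 0)(v := lev (row q - row p))))"
    by (rule bex_cong[OF refl], rule lt) simp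
  moreover have "(\<exists>q\<in>?B. ?E q) \<longleftrightarrow> (\<exists>q\<in>?B. ev \<phi> ((\<lambda>_. lb p)(v := lb q)) ((\<lambda>_. 0)(v := 1))
      ((\<lambda>_. 0)(v := lev (row q - row p))))"
    by (rule bex_cong[OF refl], rule gt) simp
  ultimately show ?thesis unfolding tags_def bex_simps prod.case eq by simp
qed

definition good_labelling :: "'a fo2 \<Rightarrow> 'a list \<Rightarrow> (nat \<Rightarrow> 'a label) \<Rightarrow> (nat \<Rightarrow> int) \<Rightarrow> bool" where
  "good_labelling \<psi> u lb row \<longleftrightarrow> rows {1..length u} row \<and> (\<forall>p\<in>{1..length u}.
     fst (lb p) = u ! (p - 1) \<and> snd (lb p) \<subseteq> exs \<psi> \<and>
     good \<psi> (tags lb row (row p) {q \<in> {1..length u}. q < p}) (lb p)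
       (tags lb row (row p) {q \<in> {1..length u}. p < q}))"

text \<open>The structural induction shared by both directions of the equivalence below. The
  quantifier case stays a premise because it has different reasons: in one direction the labels are
  defined by truth, in the other it follows from local correctness and the induction hypothesis for
  the body.\<close>

lemma sat_iff_ev:
  assumes "rows {1..length u} row" "\<And>p. p \<in> {1..length u} \<Longrightarrow> fst (lb p) = u ! (p - 1)"
    and Exs: "\<And>v \<phi> f. Ex v \<phi> \<in> exs \<psi> \<Longrightarrow> \<forall>x. f x \<in> {1..length u} \<Longrightarrow>
      (\<And>f. \<forall>x. f x \<in> {1..length u} \<Longrightarrow>
        sat (grid u row) f \<phi> \<longleftrightarrow> ev \<phi> (\<lambda>x. lb (f x)) (\<lambda>x. int (f x)) (\<lambda>x. row (f x))) \<Longrightarrow>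
      sat (grid u row) f (Ex v \<phi>) \<longleftrightarrow> Ex v \<phi> \<in> snd (lb (f (other v)))"
  shows "exs \<phi> \<subseteq> exs \<psi> \<Longrightarrow> \<forall>x. f x \<in> {1..length u} \<Longrightarrow>
    sat (grid u row) f \<phi> \<longleftrightarrow> ev \<phi> (\<lambda>x. lb (f x)) (\<lambda>x. int (f x)) (\<lambda>x. row (f x))"
proof (induction \<phi> arbitrary: f)
  case (Lab a x)
  then have "f x \<in> {1..length u}" by simp
  then show ?case using assms(2)[of "f x"] by (simp add: grid_def)
next
  case (S2 x y)
  then show ?case using succ2_grid[OF assms(1)] by simp
next
  case (Ex v \<phi>)
  have "sat (grid u row) f (Ex v \<phi>) \<longleftrightarrow> Ex v \<phi> \<in> snd (lb (f (other v)))"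
  proof (rule Exs)
    show "Ex v \<phi> \<in> exs \<psi>" "\<forall>x. f x \<in> {1..length u}" using Ex.prems by simp_all
    show "sat (grid u row) f \<phi> \<longleftrightarrow> ev \<phi> (\<lambda>x. lb (f x)) (\<lambda>x. int (f x)) (\<lambda>x. row (f x))"
      if "\<forall>x. f x \<in> {1..length u}" for f
      using Ex.prems that by (intro Ex.IH) simp_all
  qed
  then show ?case by simp
qed (simp_all add: grid_def)

text \<open>This is where having only two variables enters the semantics: overwriting one of them
  leaves a valuation that remembers a single element.\<close>

lemma fun_upd_var: "(f :: var \<Rightarrow> 'b)(v := q) = (\<lambda>_. f (other v))(v := q)"
proof
  show "(f(v := q)) x = ((\<lambda>_. f (other v))(v := q)) x" for x
    by (cases x; cases v; simp)
qed

text \<open>From left to right, every position is labelled with the formulas true there. Conversely,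
  local correctness at each position forces the labels to be these truth values, by induction from
  inner to outer quantifiers, and \<open>good\<close> also asserts \<psi> itself.\<close>

lemma models_iff_good_labelling:
  assumes "rows {1..length u} row" "u \<noteq> []" "fv \<psi> = {}"
  shows "models (grid u row) \<psi> \<longleftrightarrow> (\<exists>lb. good_labelling \<psi> u lb row)"
proof
  let ?G = "grid u row"
  assume m: "models ?G \<psi>"
  define lb where "lb p = (u ! (p - 1), {\<chi> \<in> exs \<psi>. sat ?G (\<lambda>_. p) \<chi>})" for p
  have se: "sat ?G f \<phi> \<longleftrightarrow> ev \<phi> (\<lambda>x. lb (f x)) (\<lambda>x. int (f x)) (\<lambda>x. row (f x))"
    if "exs \<phi> \<subseteq> exs \<psi>" "\<forall>x. f x \<in> {1..length u}" for \<phi> f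
  proof (rule sat_iff_ev[OF assms(1) _ _ that])
    fix v \<phi> and f :: "var \<Rightarrow> nat" assume "Ex v \<phi> \<in> exs \<psi>" "\<forall>x. f x \<in> {1..length u}"
    then show "sat ?G f (Ex v \<phi>) \<longleftrightarrow> Ex v \<phi> \<in> snd (lb (f (other v)))"
      using fun_upd_var[of f v] by (simp add: lb_def)
  qed (simp add: lb_def)
  have "good \<psi> (tags lb row (row p) {q \<in> {1..length u}. q < p}) (lb p)
       (tags lb row (row p) {q \<in> {1..length u}. p < q})" if p: "p \<in> {1..length u}" for p
    unfolding good_def
  proof (intro conjI allI impI)
    have "sat ?G (\<lambda>_. p) \<psi>" using m by (simp add: models_def)
    then have "ev \<psi> (\<lambda>_. lb p) (\<lambda>_. int p) (\<lambda>_. row p)" using se[of \<psi> "\<lambda>_. p"] p by simp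
    then show "ev \<psi> (\<lambda>_. lb p) (\<lambda>_. 0) (\<lambda>_. 0)"
      using ev_cong[of "\<lambda>_. int p" "\<lambda>_. 0" "\<lambda>_. row p" "\<lambda>_. 0" \<psi>] by simp
  next
    fix v \<phi> assume e: "Ex v \<phi> \<in> exs \<psi>"
    have "exs \<phi> \<subseteq> exs \<psi>" using exs_trans[OF e] by simp
    then have "sat ?G (\<lambda>_. p) (Ex v \<phi>) \<longleftrightarrow>
      (\<exists>q\<in>{1..length u}. ev \<phi> (\<lambda>x. lb (((\<lambda>_. p)(v := q)) x)) (\<lambda>x. int (((\<lambda>_. p)(v := q)) x))
        (\<lambda>x. row (((\<lambda>_. p)(v := q)) x)))"
      using se[of \<phi> "(\<lambda>_. p)(v := q)" for q] p by (simp add: grid_def)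
    then show "Ex v \<phi> \<in> snd (lb p) \<longleftrightarrow> ev \<phi> (\<lambda>_. lb p) (\<lambda>_. 0) (\<lambda>_. 0) \<or>
    (\<exists>(h, k)\<in>tags lb row (row p) {q \<in> {1..length u}. q < p}.
       ev \<phi> ((\<lambda>_. lb p)(v := h)) ((\<lambda>_. 0)(v := -1)) ((\<lambda>_. 0)(v := k))) \<or>
    (\<exists>(h, k)\<in>tags lb row (row p) {q \<in> {1..length u}. p < q}.
       ev \<phi> ((\<lambda>_. lb p)(v := h)) ((\<lambda>_. 0)(v := 1)) ((\<lambda>_. 0)(v := k)))"
      unfolding ev_positions[OF p, symmetric] using e by (simp add: lb_def)
  qed
  then have "good_labelling \<psi> u lb row" using assms(1) by (auto simp: good_labelling_def lb_def)
  then show "\<exists>lb. good_labelling \<psi> u lb row" by blast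
next
  let ?G = "grid u row"
  assume "\<exists>lb. good_labelling \<psi> u lb row"
  then obtain lb where lb: "\<And>p. p \<in> {1..length u} \<Longrightarrow> fst (lb p) = u ! (p - 1)"
     "\<And>p. p \<in> {1..length u} \<Longrightarrow>
      good \<psi> (tags lb row (row p) {q \<in> {1..length u}. q < p}) (lb p)
       (tags lb row (row p) {q \<in> {1..length u}. p < q})"
    unfolding good_labelling_def by blast
  have se: "sat ?G f \<phi> \<longleftrightarrow> ev \<phi> (\<lambda>x. lb (f x)) (\<lambda>x. int (f x)) (\<lambda>x. row (f x))"
    if "exs \<phi> \<subseteq> exs \<psi>" "\<forall>x. f x \<in> {1..length u}" for \<phi> f
  proof (rule sat_iff_ev[OF assms(1) lb(1) _ that])
    fix v \<phi> and f :: "var \<Rightarrow> nat" assume e: "Ex v \<phi> \<in> exs \<psi>" and f: "\<forall>x. f x \<in> {1..length u}"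
      and IH: "\<And>f. \<forall>x. f x \<in> {1..length u} \<Longrightarrow>
        sat ?G f \<phi> \<longleftrightarrow> ev \<phi> (\<lambda>x. lb (f x)) (\<lambda>x. int (f x)) (\<lambda>x. row (f x))"
    define p where "p = f (other v)"
    have p: "p \<in> {1..length u}" using f by (simp add: p_def)
    have "sat ?G f (Ex v \<phi>) \<longleftrightarrow> (\<exists>q\<in>{1..length u}. sat ?G ((\<lambda>_. p)(v := q)) \<phi>)"
      using fun_upd_var[of f v] by (simp add: p_def grid_def)
    also have "\<dots> \<longleftrightarrow> (\<exists>q\<in>{1..length u}. ev \<phi> (\<lambda>x. lb (((\<lambda>_. p)(v := q)) x))
        (\<lambda>x. int (((\<lambda>_. p)(v := q)) x)) (\<lambda>x. row (((\<lambda>_. p)(v := q)) x)))"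
      using p IH by (intro bex_cong refl) auto
    also have "\<dots> \<longleftrightarrow> Ex v \<phi> \<in> snd (lb p)"
      unfolding ev_positions[OF p] using lb(2)[OF p] e unfolding good_def by blast
    finally show "sat ?G f (Ex v \<phi>) \<longleftrightarrow> Ex v \<phi> \<in> snd (lb (f (other v)))" by (simp add: p_def)
  qed
  \<comment> \<open>A sentence is checked at positions, so one position must exist.\<close>
  have one: "1 \<in> {1..length u}" using assms(2) by (cases u) auto
  have "ev \<psi> (\<lambda>_. lb 1) (\<lambda>_. 0) (\<lambda>_. 0)" using lb(2)[OF one] by (simp add: good_def)
  then have "ev \<psi> (\<lambda>_. lb 1) (\<lambda>_. int 1) (\<lambda>_. row 1)"
    using ev_cong[of "\<lambda>_. int 1" "\<lambda>_. 0" "\<lambda>_. row 1" "\<lambda>_. 0" \<psi>] by simp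
  then have "sat ?G (\<lambda>_. 1) \<psi>" using se[of \<psi> "\<lambda>_. 1"] one by simp
  then show "models ?G \<psi>" unfolding models_def using sat_cong[of \<psi>] assms(3) by blast
qed

section \<open>Marking machines\<close>

definition rename_states :: "('q \<Rightarrow> 'r) \<Rightarrow> ('a, 'q) pia \<Rightarrow> ('a, 'r) pia" where
  "rename_states h A = \<lparr>alphabet = alphabet A, pebbles = pebbles A, states = h ` states A,
     init = h (init A), final = h ` final A, delta = map_trans id h ` delta A\<rparr>"

lemma is_pia_rename_states:
  assumes "is_pia A"
  shows "is_pia (rename_states h A)"
proof -
  have "map_trans id h t \<in>
    {Silent q q' | q q'. q \<in> h ` states A \<and> q' \<in> h ` states A} \<union>
    {Read q mv a q' | q mv a q'.
       q \<in> h ` states A \<and> mv \<in> moves (pebbles A) \<and> a \<in> alphabet A \<and> q' \<in> h ` states A}"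
    if "t \<in> delta A" for t
    using assms that unfolding is_pia_def by (cases t) auto
  then show ?thesis using assms by (auto simp: is_pia_def rename_states_def)
qed

lemma step_rename_states:
  assumes "step A u (q, \<rho>, N) (q', \<rho>', N')"
  shows "step (rename_states h A) u (h q, \<rho>, N) (h q', \<rho>', N')"
  using assms
proof cases
  case silent
  then have "Silent (h q) (h q') \<in> delta (rename_states h A)"
    by (force simp: rename_states_def)
  then show ?thesis using silent by (auto intro: step.silent)
next
  case (read l k i j x y)
  then have "Read (h q) (Move k i j) (u ! (l - 1)) (h q') \<in> delta (rename_states h A)"
    by (force simp: rename_states_def)
  from step.read[OF read(3) this read(5-8)] show ?thesis using read(1,2) by simp
qed

lemma step_rename_statesD:
  assumes A: "is_pia A" and h: "inj_on h (states A)" and q: "q \<in> states A"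
    and s: "step (rename_states h A) u (h q, \<rho>, N) (r, \<rho>', N')"
  shows "\<exists>q'\<in>states A. r = h q' \<and> step A u (q, \<rho>, N) (q', \<rho>', N')"
  using s
proof cases
  case silent
  then obtain t where t: "t \<in> delta A" "Silent (h q) r = map_trans id h t"
    by (auto simp: rename_states_def)
  then obtain q1 q' where *: "t = Silent q1 q'" "h q = h q1" "r = h q'" by (cases t) auto
  then have "q1 \<in> states A" "q' \<in> states A" using A t(1) by (auto simp: is_pia_def)
  moreover have "q = q1" using inj_onD[OF h *(2) q] calculation by simp
  ultimately show ?thesis using * t(1) silent by (auto intro!: bexI[of _ q'] step.silent)
next
  case (read l k i j x y)
  then obtain t where t: "t \<in> delta A" "Read (h q) (Move k i j) (u ! (l - 1)) r = map_trans id h t"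
    by (auto simp: rename_states_def)
  then obtain q1 q' where *: "t = Read q1 (Move k i j) (u ! (l - 1)) q'" "h q = h q1" "r = h q'"
    by (cases t) auto
  then have "q1 \<in> states A" "q' \<in> states A" using A t(1) by (auto simp: is_pia_def)
  moreover have "q = q1" using inj_onD[OF h *(2) q] calculation by simp
  moreover have "Read q (Move k i j) (u ! (l - 1)) q' \<in> delta A" using * t(1) calculation(3) by simp
  from step.read[OF read(3) this read(5-8)] have "step A u (q, \<rho>, N) (q', \<rho>', N')"
    using read(1,2) by simp
  ultimately show ?thesis using *(3) by blast
qed

lemma lang_pia_rename_states:
  assumes A: "is_pia A" and h: "inj_on h (states A)"
  shows "lang_pia (rename_states h A) = lang_pia A"
proof -
  let ?A = "rename_states h A"
  have fwd: "(step ?A u)\<^sup>*\<^sup>* (initial_config ?A) (h q, \<rho>, N)"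
    if "(step A u)\<^sup>*\<^sup>* (initial_config A) c" "c = (q, \<rho>, N)" for u c q \<rho> N
    using that
  proof (induction arbitrary: q \<rho> N rule: rtranclp_induct)
    case base
    then show ?case by (simp add: initial_config_def rename_states_def)
  next
    case (step c c')
    obtain q1 \<rho>1 N1 where c: "c = (q1, \<rho>1, N1)" by (cases c)
    then show ?case
      using step step_rename_states[of A u q1 \<rho>1 N1 q \<rho> N h] by (auto intro: rtranclp.rtrancl_into_rtrancl)
  qed
  have bwd: "\<exists>q\<in>states A. r = h q \<and> (step A u)\<^sup>*\<^sup>* (initial_config A) (q, \<rho>, N)"
    if "(step ?A u)\<^sup>*\<^sup>* (initial_config ?A) c" "c = (r, \<rho>, N)" for u c r \<rho> N
    using that
  proof (induction arbitrary: r \<rho> N rule: rtranclp_induct)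
    case base
    then show ?case using A
      by (intro bexI[of _ "init A"]) (auto simp: initial_config_def rename_states_def is_pia_def)
  next
    case (step c c')
    obtain r1 \<rho>1 N1 where c: "c = (r1, \<rho>1, N1)" by (cases c)
    obtain q1 where q1: "q1 \<in> states A" "r1 = h q1" "(step A u)\<^sup>*\<^sup>* (initial_config A) (q1, \<rho>1, N1)"
      using step.IH[OF c] by blast
    then obtain q where "q \<in> states A" "r = h q" "step A u (q1, \<rho>1, N1) (q, \<rho>, N)"
      using step_rename_statesD[OF A h, of q1 u \<rho>1 N1 r \<rho> N] step.hyps(2) step.prems c by auto
    then show ?case using rtranclp.rtrancl_into_rtrancl[OF q1(3)] by auto
  qed
  show ?thesis
  proof (intro equalityI subsetI)
    fix u assume "u \<in> lang_pia ?A"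
    then obtain r \<rho> where r: "(step ?A u)\<^sup>*\<^sup>* (initial_config ?A) (r, \<rho>, {1..length u})"
        "r \<in> h ` final A" and u: "u \<in> lists (alphabet A)"
      by (auto simp: lang_pia_def accepting_def rename_states_def)
    then obtain q where q: "q \<in> states A" "r = h q"
        "(step A u)\<^sup>*\<^sup>* (initial_config A) (q, \<rho>, {1..length u})"
      using bwd by blast
    obtain f where "f \<in> final A" "h q = h f" using r(2) q(2) by auto
    moreover from this have "f \<in> states A" using A by (auto simp: is_pia_def)
    ultimately have "q \<in> final A" using inj_onD[OF h] q(1) by metis
    then show "u \<in> lang_pia A" using q(3) u by (auto simp: lang_pia_def accepting_def)
  next
    fix u assume "u \<in> lang_pia A"
    then obtain q \<rho> where "(step A u)\<^sup>*\<^sup>* (initial_config A) (q, \<rho>, {1..length u})"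
        "q \<in> final A" and u: "u \<in> lists (alphabet A)"
      by (auto simp: lang_pia_def accepting_def)
    then have "(step ?A u)\<^sup>*\<^sup>* (initial_config ?A) (h q, \<rho>, {1..length u})" "h q \<in> final ?A"
      using fwd by (auto simp: rename_states_def)
    moreover have "u \<in> lists (alphabet ?A)" using u by (simp add: rename_states_def)
    ultimately show "u \<in> lang_pia ?A" by (auto simp: lang_pia_def accepting_def)
  qed
qed

lemma pia_nat_states:
  fixes A :: "('a, 'q) pia"
  assumes "is_pia A"
  shows "\<exists>A' :: ('a, nat) pia. is_pia A' \<and> alphabet A' = alphabet A \<and> lang_pia A' = lang_pia A"
proof -
  have "finite (states A)" using assms by (simp add: is_pia_def)
  then obtain h :: "'q \<Rightarrow> nat" where h: "inj_on h (states A)"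
    using finite_imp_inj_to_nat_seg by blast
  show ?thesis
  proof (intro exI conjI)
    show "is_pia (rename_states h A)" using assms by (rule is_pia_rename_states)
    show "lang_pia (rename_states h A) = lang_pia A" using assms h by (rule lang_pia_rename_states)
  qed (simp add: rename_states_def)
qed


text \<open>
  A marking machine abstracts from the names of pebbles: it attaches tags to positions, and all
  it can test about a position is which tags occur to its left and to its right.
\<close>

definition left :: "(nat \<Rightarrow> 't option) \<Rightarrow> nat \<Rightarrow> 't set" where
  "left L p = {t. \<exists>q<p. L q = Some t}"

definition right :: "(nat \<Rightarrow> 't option) \<Rightarrow> nat \<Rightarrow> 't set" where
  "right L p = {t. \<exists>q>p. L q = Some t}"

text \<open>A state of the automaton lists the live pebbles from left to right, together with their tags.\<close>

type_synonym ('p, 't) mstate = "'p \<times> (nat \<times> 't) list"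

type_synonym ('p, 't) mconfig = "'p \<times> (nat \<Rightarrow> 't option) \<times> nat set"

text \<open>\<open>M\<close> bounds the number of positions tagged at the same time, that is, of
  pebbles. Only \<open>ins\<close> sees a letter. \<open>shift\<close> may inspect the contexts of
  all live positions at once, since a state stores the whole ordered list of tags.\<close>

locale marking_machine =
  fixes \<Sigma> :: "'a set" and Ph :: "'p set" and T :: "'t set" and M :: nat
    and ins :: "'p \<Rightarrow> 't set \<Rightarrow> 't \<Rightarrow> 't set \<Rightarrow> 'a \<Rightarrow> bool"
    and del :: "'p \<Rightarrow> 't set \<Rightarrow> 't \<Rightarrow> 't set \<Rightarrow> bool"
    and shift :: "'p \<Rightarrow> 'p \<Rightarrow> ('t set \<times> 't \<times> 't set) set \<Rightarrow> bool"
    and retag :: "'p \<Rightarrow> 'p \<Rightarrow> 't \<Rightarrow> 't \<Rightarrow> bool"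
    and start :: 'p
    and acc :: "'p \<Rightarrow> 't set \<Rightarrow> bool"
  assumes finite_alphabet: "finite \<Sigma>" and finite_phases: "finite Ph" and finite_tags: "finite T"
    and start: "start \<in> Ph"
begin

text \<open>\<open>delete\<close> leaves \<open>N\<close> alone: a position that has lost its tag
  stays read and can never be tagged again.\<close>

inductive mstep :: "'a list \<Rightarrow> ('p, 't) mconfig \<Rightarrow> ('p, 't) mconfig \<Rightarrow> bool" for u where
  insert: "p \<in> {1..length u} - N \<Longrightarrow> t \<in> T \<Longrightarrow> card (dom L) < M \<Longrightarrow>
    ins ph (left L p) t (right L p) (u ! (p - 1)) \<Longrightarrow>
    mstep u (ph, L, N) (ph, L(p \<mapsto> t), N \<union> {p})"
| delete: "L p = Some t \<Longrightarrow> del ph (left L p) t (right L p) \<Longrightarrow>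
    mstep u (ph, L, N) (ph, L(p := None), N)"
| shift: "ph' \<in> Ph \<Longrightarrow> shift ph ph' {(left L p, t, right L p) | p t. L p = Some t} \<Longrightarrow>
    dom L' = dom L \<Longrightarrow> ran L' \<subseteq> T \<Longrightarrow>
    (\<And>p t t'. L p = Some t \<Longrightarrow> L' p = Some t' \<Longrightarrow> retag ph ph' t t') \<Longrightarrow>
    mstep u (ph, L, N) (ph', L', N)"

definition mlang :: "'a list set" where
  "mlang = {u \<in> lists \<Sigma>. \<exists>ph L. (mstep u)\<^sup>*\<^sup>* (start, \<lambda>_. None, {}) (ph, L, {1..length u}) \<and> acc ph (ran L)}"

section \<open>The pebble automaton of a marking machine\<close>

definition lref :: "(nat \<times> 't) list \<Rightarrow> ref" where
  "lref as = (if as = [] then LeftEnd else Pebble (fst (last as)))"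

definition rref :: "(nat \<times> 't) list \<Rightarrow> ref" where
  "rref bs = (if bs = [] then RightEnd else Pebble (fst (hd bs)))"

definition mstates :: "('p, 't) mstate set" where
  "mstates = Ph \<times> {xs. set xs \<subseteq> {1..M} \<times> T \<and> distinct (map fst xs)}"

text \<open>A position belongs between \<open>as\<close> and \<open>bs\<close> exactly if it lies
  between the last pebble of \<open>as\<close> and the first of \<open>bs\<close>. The move into
  this interval therefore guarantees that the tags on both sides are those stored in the state.
  Deletion is silent: the pebble stays where it is, but its name leaves the list and becomes free
  for reuse.\<close>

definition mtrans :: "('a, ('p, 't) mstate) trans set" where
  "mtrans =
    {Read (ph, as @ bs) (Move k (lref as) (rref bs)) a (ph, as @ (k, t) # bs) | ph as bs k t a.
       (ph, as @ bs) \<in> mstates \<and> (ph, as @ (k, t) # bs) \<in> mstates \<and> a \<in> \<Sigma> \<and>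
       ins ph (snd ` set as) t (snd ` set bs) a} \<union>
    {Silent (ph, as @ (k, t) # bs) (ph, as @ bs) | ph as bs k t.
       (ph, as @ (k, t) # bs) \<in> mstates \<and> del ph (snd ` set as) t (snd ` set bs)} \<union>
    {Silent (ph, xs) (ph', ys) | ph xs ph' ys.
       (ph, xs) \<in> mstates \<and> (ph', ys) \<in> mstates \<and> map fst xs = map fst ys \<and>
       shift ph ph' {(snd ` set as, t, snd ` set bs) | as k t bs. xs = as @ (k, t) # bs} \<and>
       list_all2 (\<lambda>x y. retag ph ph' (snd x) (snd y)) xs ys}"

definition mpia :: "('a, ('p, 't) mstate) pia" where
  "mpia = \<lparr>alphabet = \<Sigma>, pebbles = M, states = mstates, init = (start, []),
     final = {(ph, xs) \<in> mstates. acc ph (snd ` set xs)}, delta = mtrans\<rparr>"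

lemma length_mstates:
  assumes "set xs \<subseteq> {1..M} \<times> T" "distinct (map fst xs)"
  shows "length xs \<le> M"
proof -
  have "length xs = card (fst ` set xs)" using distinct_card[OF assms(2)] by simp
  also have "\<dots> \<le> card {1..M}" using assms(1) by (intro card_mono) auto
  finally show ?thesis by simp
qed

lemma finite_mstates: "finite mstates"
proof -
  have "finite {xs. set xs \<subseteq> {1..M} \<times> T \<and> length xs \<le> M}"
    using finite_tags by (intro finite_lists_length_le) simp
  then have "finite {xs :: (nat \<times> 't) list. set xs \<subseteq> {1..M} \<times> T \<and> distinct (map fst xs)}"
    by (rule finite_subset[rotated]) (use length_mstates in blast)
  then show ?thesis unfolding mstates_def using finite_phases by simp
qed

lemma is_pia_mpia: "is_pia mpia"
proof -
  have "Move k (lref as) (rref bs) \<in> moves M" if "(ph, as @ (k, t) # bs) \<in> mstates" for ph as k t bs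
  proof -
    have s: "set as \<subseteq> {1..M} \<times> T" "set bs \<subseteq> {1..M} \<times> T" "k \<in> {1..M}" "distinct (map fst (as @ bs))"
      using that by (auto simp: mstates_def)
    have l: "as = [] \<or> last as \<in> set as" and h: "bs = [] \<or> hd bs \<in> set bs"
      using last_in_set[of as] hd_in_set[of bs] by blast+
    have "lref as \<in> Pebble ` {1..M} \<union> {LeftEnd}" using l s(1) by (auto simp: lref_def)
    moreover have "rref bs \<in> Pebble ` {1..M} \<union> {RightEnd}" using h s(2) by (auto simp: rref_def)
    moreover have "lref as \<noteq> rref bs"
    proof
      assume "lref as = rref bs"
      then have "as \<noteq> []" "bs \<noteq> []" "fst (last as) = fst (hd bs)"
        by (auto simp: lref_def rref_def split: if_splits)
      moreover from this have "fst (last as) \<in> fst ` set as" "fst (hd bs) \<in> fst ` set bs"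
        using l h by blast+
      moreover have "fst ` set as \<inter> fst ` set bs = {}" using s(4) by simp
      ultimately show False by (metis disjoint_iff)
    qed
    ultimately show ?thesis using s(3) by (simp add: moves_def)
  qed
  moreover have "(ph, as @ bs) \<in> mstates" if "(ph, as @ (k, t) # bs) \<in> mstates" for ph as k t bs
    using that by (auto simp: mstates_def)
  ultimately have "mtrans \<subseteq> {Silent q q' | q q'. q \<in> mstates \<and> q' \<in> mstates} \<union>
    {Read q mv a q' | q mv a q'. q \<in> mstates \<and> mv \<in> moves M \<and> a \<in> \<Sigma> \<and> q' \<in> mstates}"
    unfolding mtrans_def by fast
  moreover have "(start, []) \<in> mstates" using start by (simp add: mstates_def)
  ultimately show ?thesis
    using finite_alphabet finite_mstates by (auto simp: is_pia_def mpia_def)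
qed

text \<open>Only pebbles in the list are constrained; \<rho> may still hold stale positions of
  pebbles dropped earlier. Listed pebbles are placed, so \<open>the\<close> never meets
  \<open>None\<close>.\<close>

definition represents :: "(nat \<times> 't) list \<Rightarrow> (nat \<Rightarrow> nat option) \<Rightarrow> (nat \<Rightarrow> 't option) \<Rightarrow> bool" where
  "represents xs \<rho> L \<longleftrightarrow>
     sorted_wrt (\<lambda>x y. the (\<rho> (fst x)) < the (\<rho> (fst y))) xs \<and> (\<forall>x\<in>set xs. \<rho> (fst x) \<noteq> None) \<and>
     (\<forall>p t. L p = Some t \<longleftrightarrow> (\<exists>k. (k, t) \<in> set xs \<and> \<rho> k = Some p))"

lemma representsD:
  assumes "represents xs \<rho> L"
  shows "(k, t) \<in> set xs \<Longrightarrow> \<exists>p. \<rho> k = Some p \<and> L p = Some t"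
    "L p = Some t \<Longrightarrow> \<exists>k. (k, t) \<in> set xs \<and> \<rho> k = Some p"
  using assms unfolding represents_def by (metis fst_conv not_None_eq)+

text \<open>\<open>S\<close> is empty when \<open>p\<close> is about to be tagged and is the single
  pebble on \<open>p\<close> when \<open>p\<close> is live, so one statement covers both
  uses.\<close>

lemma represents_left_right:
  assumes R: "represents xs \<rho> L" and xs: "set xs = set as \<union> S \<union> set bs"
    and "\<And>x. x \<in> S \<Longrightarrow> the (\<rho> (fst x)) = p"
    "\<And>x. x \<in> set as \<Longrightarrow> the (\<rho> (fst x)) < p" "\<And>x. x \<in> set bs \<Longrightarrow> p < the (\<rho> (fst x))"
  shows "left L p = snd ` set as" "right L p = snd ` set bs"
proof -
  have L: "L q = Some t \<longleftrightarrow> (\<exists>x\<in>set xs. snd x = t \<and> the (\<rho> (fst x)) = q)" for q t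
  proof
    assume "L q = Some t"
    then obtain k where "(k, t) \<in> set xs" "\<rho> k = Some q" using representsD(2)[OF R] by blast
    then show "\<exists>x\<in>set xs. snd x = t \<and> the (\<rho> (fst x)) = q" by (intro bexI[of _ "(k, t)"]) simp_all
  next
    assume "\<exists>x\<in>set xs. snd x = t \<and> the (\<rho> (fst x)) = q"
    then obtain k where "(k, t) \<in> set xs" "the (\<rho> k) = q" by auto
    then show "L q = Some t" using representsD(1)[OF R, of k t] by auto
  qed
  have as: "x \<in> set as \<longleftrightarrow> x \<in> set xs \<and> the (\<rho> (fst x)) < p" for x
    using xs assms(3-5)[of x] by auto
  have bs: "x \<in> set bs \<longleftrightarrow> x \<in> set xs \<and> p < the (\<rho> (fst x))" for x
    using xs assms(3-5)[of x] by auto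
  show "left L p = snd ` set as" unfolding left_def L using as by auto
  show "right L p = snd ` set bs" unfolding right_def L using bs by auto
qed

lemma represents_middle:
  assumes R: "represents (as @ (k, t) # bs) \<rho> L"
  shows "\<exists>p. \<rho> k = Some p \<and> L p = Some t \<and> left L p = snd ` set as \<and> right L p = snd ` set bs"
proof -
  obtain p where p: "\<rho> k = Some p" "L p = Some t" using representsD(1)[OF R, of k t] by auto
  have "left L p = snd ` set as" "right L p = snd ` set bs"
    using R p(1) represents_left_right[OF R, of as "{(k, t)}" bs p]
    by (simp_all add: represents_def sorted_wrt_append)
  then show ?thesis using p by blast
qed

lemma represents_contexts:
  assumes R: "represents xs \<rho> L"
  shows "{(left L p, t, right L p) | p t. L p = Some t} =
    {(snd ` set as, t, snd ` set bs) | as k t bs. xs = as @ (k, t) # bs}" (is "?A = ?B")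
proof (intro equalityI subsetI)
  fix c assume "c \<in> ?A"
  then obtain p t where c: "c = (left L p, t, right L p)" "L p = Some t" by blast
  then obtain k where k: "(k, t) \<in> set xs" "\<rho> k = Some p" using representsD(2)[OF R] by blast
  then obtain as bs where xs: "xs = as @ (k, t) # bs" by (meson split_list)
  then show "c \<in> ?B" using represents_middle[of as k t bs \<rho> L] R k(2) c(1) by auto
next
  fix c assume "c \<in> ?B"
  then obtain as k t bs where c: "c = (snd ` set as, t, snd ` set bs)" "xs = as @ (k, t) # bs" by blast
  then obtain p where "L p = Some t" "left L p = snd ` set as" "right L p = snd ` set bs"
    using represents_middle[of as k t bs \<rho> L] R by auto
  then show "c \<in> ?A" using c(1) by force
qed

lemma represents_insert:
  assumes R: "represents (as @ bs) \<rho> L"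
    and p: "\<And>x. x \<in> set as \<Longrightarrow> the (\<rho> (fst x)) < p" "\<And>x. x \<in> set bs \<Longrightarrow> p < the (\<rho> (fst x))"
    and k: "k \<notin> fst ` set (as @ bs)"
  shows "represents (as @ (k, t) # bs) (\<rho>(k \<mapsto> p)) (L(p \<mapsto> t))"
proof -
  have neq: "fst x \<noteq> k" if "x \<in> set as \<union> set bs" for x using k that by auto
  have same: "the ((\<rho>(k \<mapsto> p)) (fst x)) = the (\<rho> (fst x))" if "x \<in> set as \<union> set bs" for x
    using neq[OF that] by simp
  have "sorted_wrt (\<lambda>x y. the ((\<rho>(k \<mapsto> p)) (fst x)) < the ((\<rho>(k \<mapsto> p)) (fst y))) (as @ (k, t) # bs)"
  proof -
    let ?S = "\<lambda>x y. the (\<rho> (fst x)) < the (\<rho> (fst y))"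
    let ?S' = "\<lambda>x y. the ((\<rho>(k \<mapsto> p)) (fst x)) < the ((\<rho>(k \<mapsto> p)) (fst y))"
    have s: "sorted_wrt ?S as" "sorted_wrt ?S bs" "\<forall>x\<in>set as. \<forall>y\<in>set bs. ?S x y"
      using R by (auto simp: represents_def sorted_wrt_append)
    have "sorted_wrt ?S' as" by (rule sorted_wrt_mono_rel[OF _ s(1)]) (use same in auto)
    moreover have "sorted_wrt ?S' bs" by (rule sorted_wrt_mono_rel[OF _ s(2)]) (use same in auto)
    ultimately show ?thesis using s(3) same p by (simp add: sorted_wrt_append)
  qed
  moreover have "\<forall>x\<in>set (as @ (k, t) # bs). (\<rho>(k \<mapsto> p)) (fst x) \<noteq> None"
    using R by (auto simp: represents_def)
  moreover have "(L(p \<mapsto> t)) q = Some t' \<longleftrightarrow>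
      (\<exists>k'. (k', t') \<in> set (as @ (k, t) # bs) \<and> (\<rho>(k \<mapsto> p)) k' = Some q)" for q t'
  proof (cases "q = p")
    case True
    have "\<rho> k' \<noteq> Some p" if "(k', t') \<in> set as \<union> set bs" for k'
      using p[of "(k', t')"] that by auto
    then show ?thesis using True neq by fastforce
  next
    case False
    have "L q = Some t' \<longleftrightarrow> (\<exists>k'. (k', t') \<in> set as \<union> set bs \<and> \<rho> k' = Some q)"
      using R by (simp add: represents_def)
    then show ?thesis using False neq by fastforce
  qed
  ultimately show ?thesis unfolding represents_def by blast
qed

lemma represents_delete:
  assumes R: "represents (as @ (k, t) # bs) \<rho> L" and p: "\<rho> k = Some p"
  shows "represents (as @ bs) \<rho> (L(p := None))"
proof -
  have ne: "\<rho> k' \<noteq> Some p" if "(k', t') \<in> set as \<union> set bs" for k' t'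
    using R p that by (fastforce simp: represents_def sorted_wrt_append)
  have "(L(p := None)) q = Some t' \<longleftrightarrow> (\<exists>k'. (k', t') \<in> set (as @ bs) \<and> \<rho> k' = Some q)" for q t'
  proof (cases "q = p")
    case True
    then show ?thesis using ne by auto
  next
    case False
    have "L q = Some t' \<longleftrightarrow> (\<exists>k'. (k', t') \<in> set (as @ (k, t) # bs) \<and> \<rho> k' = Some q)"
      using R unfolding represents_def by blast
    then show ?thesis using False p by auto
  qed
  moreover have "sorted_wrt (\<lambda>x y. the (\<rho> (fst x)) < the (\<rho> (fst y))) (as @ bs)"
    "\<forall>x\<in>set (as @ bs). \<rho> (fst x) \<noteq> None"
    using R by (auto simp: represents_def sorted_wrt_append)
  ultimately show ?thesis unfolding represents_def by blast
qed

lemma represents_dom: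
  assumes "represents xs \<rho> L"
  shows "dom L = (\<lambda>x. the (\<rho> (fst x))) ` set xs" "card (dom L) = length xs" "ran L = snd ` set xs"
proof -
  show d: "dom L = (\<lambda>x. the (\<rho> (fst x))) ` set xs"
    using representsD[OF assms] by (force simp: dom_def)
  have "sorted_wrt (<) (map (\<lambda>x. the (\<rho> (fst x))) xs)"
    using assms by (simp add: represents_def sorted_wrt_map)
  then have "distinct (map (\<lambda>x. the (\<rho> (fst x))) xs)" using strict_sorted_iff by blast
  then show "card (dom L) = length xs" unfolding d using distinct_card by fastforce
  show "ran L = snd ` set xs"
    using representsD[OF assms] by (force simp: ran_def)
qed

lemma represents_retag:
  assumes R: "represents xs \<rho> L" and ys: "map fst xs = map fst ys"
  shows "\<exists>L'. represents ys \<rho> L' \<and> dom L' = dom L"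
proof -
  let ?pos = "\<lambda>x :: nat \<times> 't. the (\<rho> (fst x))"
  have pos: "map ?pos xs = map ?pos ys"
    using arg_cong[OF ys, of "map (\<lambda>k. the (\<rho> k))"] by (simp add: comp_def)
  have "sorted_wrt (<) (map ?pos xs)" using R by (simp add: represents_def sorted_wrt_map)
  then have s: "sorted_wrt (<) (map ?pos ys)" unfolding pos .
  have fs: "fst ` set xs = fst ` set ys" using arg_cong[OF ys, of set] by simp
  have nn: "\<rho> k \<noteq> None" if "k \<in> fst ` set ys" for k
    using R that unfolding fs[symmetric] represents_def by blast
  define L' where "L' = map_of (map (\<lambda>x. (?pos x, snd x)) ys)"
  have "distinct (map fst (map (\<lambda>x. (?pos x, snd x)) ys))"
    using s by (simp add: comp_def strict_sorted_iff)
  then have 1: "L' p = Some t \<longleftrightarrow> (p, t) \<in> set (map (\<lambda>x. (?pos x, snd x)) ys)" for p t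
    unfolding L'_def by (rule map_of_eq_Some_iff)
  have 2: "(p, t) \<in> set (map (\<lambda>x. (?pos x, snd x)) ys) \<longleftrightarrow> (\<exists>k. (k, t) \<in> set ys \<and> the (\<rho> k) = p)" for p t
    by (auto simp: image_iff Bex_def)
  have 3: "the (\<rho> k) = p \<longleftrightarrow> \<rho> k = Some p" if "(k, t) \<in> set ys" for k p t
    using nn[OF image_eqI[OF _ that]] by auto
  have L': "L' p = Some t \<longleftrightarrow> (\<exists>k. (k, t) \<in> set ys \<and> \<rho> k = Some p)" for p t
    unfolding 1 2 using 3 by (intro ex_cong1 conj_cong refl) simp_all
  have R': "represents ys \<rho> L'"
    unfolding represents_def
  proof (intro conjI ballI allI)
    show "sorted_wrt (\<lambda>x y. ?pos x < ?pos y) ys" using s by (simp add: sorted_wrt_map)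
    show "\<rho> (fst x) \<noteq> None" if "x \<in> set ys" for x using nn[OF imageI[OF that]] .
  qed (rule L')
  have "?pos ` set xs = ?pos ` set ys" using arg_cong[OF pos, of set] by simp
  then have "dom L' = dom L" using represents_dom(1)[OF R] represents_dom(1)[OF R'] by simp
  then show ?thesis using R' by blast
qed

section \<open>Bisimulation between automaton and marking machine\<close>

definition rel :: "'a list \<Rightarrow> ('p, 't) mstate config \<Rightarrow> ('p, 't) mconfig \<Rightarrow> bool" where
  "rel u = (\<lambda>(q, \<rho>, N) (ph, L, N'). q \<in> mstates \<and> fst q = ph \<and> N' = N \<and> dom L \<subseteq> N \<and>
     N \<subseteq> {1..length u} \<and> represents (snd q) \<rho> L)"

lemma rel_iff: "rel u ((ph, xs), \<rho>, N) (ph', L, N') \<longleftrightarrow>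
  (ph, xs) \<in> mstates \<and> ph = ph' \<and> N' = N \<and> dom L \<subseteq> N \<and> N \<subseteq> {1..length u} \<and> represents xs \<rho> L"
  by (auto simp: rel_def)

lemma rel_initial: "rel u (initial_config mpia) (start, \<lambda>_. None, {})"
  using start by (simp add: initial_config_def mpia_def rel_iff represents_def mstates_def)

lemma mtrans_cases [consumes 1, case_names read delete shift]:
  assumes "tr \<in> mtrans"
  obtains (read) ph as bs k t a where "tr = Read (ph, as @ bs) (Move k (lref as) (rref bs)) a (ph, as @ (k, t) # bs)"
      "(ph, as @ bs) \<in> mstates" "(ph, as @ (k, t) # bs) \<in> mstates" "a \<in> \<Sigma>"
      "ins ph (snd ` set as) t (snd ` set bs) a"
  | (delete) ph as bs k t where "tr = Silent (ph, as @ (k, t) # bs) (ph, as @ bs)"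
      "(ph, as @ (k, t) # bs) \<in> mstates" "del ph (snd ` set as) t (snd ` set bs)"
  | (shift) ph xs ph' ys where "tr = Silent (ph, xs) (ph', ys)"
      "(ph, xs) \<in> mstates" "(ph', ys) \<in> mstates" "map fst xs = map fst ys"
      "shift ph ph' {(snd ` set as, t, snd ` set bs) | as k t bs. xs = as @ (k, t) # bs}"
      "list_all2 (\<lambda>x y. retag ph ph' (snd x) (snd y)) xs ys"
  using assms unfolding mtrans_def by blast

lemma step_imp_mstep:
  assumes s: "step mpia u c c'" and r: "rel u c m"
  shows "\<exists>m'. mstep u m m' \<and> rel u c' m'"
  using s
proof cases
  case (silent q q' \<rho> N)
  then have "Silent q q' \<in> mtrans" by (simp add: mpia_def)
  then show ?thesis
  proof (cases rule: mtrans_cases)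
    case (delete ph as bs k t)
    obtain L where m: "m = (ph, L, N)" and R: "represents (as @ (k, t) # bs) \<rho> L"
      and dom: "dom L \<subseteq> N" "N \<subseteq> {1..length u}"
      using r silent(1) delete(1) by (cases m) (auto simp: rel_iff)
    obtain p where p: "\<rho> k = Some p" "L p = Some t" "left L p = snd ` set as" "right L p = snd ` set bs"
      using represents_middle[OF R] by blast
    have "mstep u m (ph, L(p := None), N)"
      unfolding m using p delete by (intro mstep.delete) auto
    moreover have "rel u c' (ph, L(p := None), N)"
      using silent(2) delete(1,2) dom represents_delete[OF R p(1)]
      by (auto simp: rel_iff mstates_def)
    ultimately show ?thesis by blast
  next
    case (shift ph xs ph' ys)
    obtain L where m: "m = (ph, L, N)" and R: "represents xs \<rho> L"
      and dom: "dom L \<subseteq> N" "N \<subseteq> {1..length u}"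
      using r silent(1) shift(1) by (cases m) (auto simp: rel_iff)
    obtain L' where R': "represents ys \<rho> L'" "dom L' = dom L" using represents_retag[OF R shift(4)] by blast
    have "mstep u m (ph', L', N)"
      unfolding m
    proof (rule mstep.shift)
      show "ph' \<in> Ph" "ran L' \<subseteq> T"
        using shift(3) represents_dom(3)[OF R'(1)] by (auto simp: mstates_def)
      show "shift ph ph' {(left L p, t, right L p) | p t. L p = Some t}"
        unfolding represents_contexts[OF R] by (rule shift(5))
      show "dom L' = dom L" by fact
      fix p t t' assume "L p = Some t" "L' p = Some t'"
      then obtain k k' where k: "(k, t) \<in> set xs" "(k', t') \<in> set ys" "\<rho> k = Some p" "\<rho> k' = Some p"
        using representsD(2)[OF R] representsD(2)[OF R'(1)] by blast
      obtain i j where i: "i < length xs" "xs ! i = (k, t)" and j: "j < length ys" "ys ! j = (k', t')"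
        using k(1,2) by (auto simp: in_set_conv_nth)
      have len: "length xs = length ys" using map_eq_imp_length_eq[OF shift(4)] .
      have fj: "fst (xs ! j) = k'" using j len arg_cong[OF shift(4), of "\<lambda>zs. zs ! j"] by simp
      have so: "sorted_wrt (\<lambda>x y. the (\<rho> (fst x)) < the (\<rho> (fst y))) xs" using R by (simp add: represents_def)
      \<comment> \<open>Positions increase strictly along the list, so the entries of
        \<open>xs\<close> and \<open>ys\<close> whose pebbles sit on \<open>p\<close> have the same
        index, where \<open>list_all2\<close> compares their tags.\<close>
      have "i = j"
      proof (rule ccontr)
        assume "i \<noteq> j"
        then have "the (\<rho> (fst (xs ! i))) \<noteq> the (\<rho> (fst (xs ! j)))"
          using so i(1) j(1) len unfolding sorted_wrt_iff_nth_less by (metis nat_neq_iff)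
        then show False using i(2) fj k by simp
      qed
      then show "retag ph ph' t t'" using shift(6) i j by (auto simp: list_all2_conv_all_nth)
    qed
    moreover have "rel u c' (ph', L', N)"
      using silent(2) shift(1,3) dom R' by (auto simp: rel_iff)
    ultimately show ?thesis by blast
  qed auto
next
  case (read l N q k i j q' \<rho> x y)
  then have "Read q (Move k i j) (u ! (l - 1)) q' \<in> mtrans" by (simp add: mpia_def)
  then show ?thesis
  proof (cases rule: mtrans_cases)
    case (read ph as bs k' t a)
    note tr = read
    note rd = \<open>c = (q, \<rho>, N)\<close> \<open>c' = (q', \<rho>(k \<mapsto> l), N \<union> {l})\<close> \<open>l \<in> {1..length u} - N\<close>
      \<open>pos u \<rho> i = Some x\<close> \<open>pos u \<rho> j = Some y\<close> \<open>x < l\<close> \<open>l < y\<close>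
    obtain L where m: "m = (ph, L, N)" and R: "represents (as @ bs) \<rho> L"
      and dom: "dom L \<subseteq> N" "N \<subseteq> {1..length u}"
      using r rd(1) tr(1) by (cases m) (auto simp: rel_iff)
    have so: "sorted_wrt (\<lambda>x y. the (\<rho> (fst x)) < the (\<rho> (fst y))) as"
      "sorted_wrt (\<lambda>x y. the (\<rho> (fst x)) < the (\<rho> (fst y))) bs"
      using R by (auto simp: represents_def sorted_wrt_append)
    have as: "the (\<rho> (fst z)) < l" if "z \<in> set as" for z
    proof -
      have ne: "as \<noteq> []" using that by auto
      then have la: "the (\<rho> (fst (last as))) = x" using rd(4) tr(1) by (simp add: lref_def)
      have "as = butlast as @ [last as]" using ne by simp
      then have "z \<in> set (butlast as) \<or> z = last as" "\<forall>z\<in>set (butlast as). the (\<rho> (fst z)) < x"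
        using that so(1) la by (metis Un_iff empty_iff insert_iff list.set set_append)
          (metis \<open>as = butlast as @ [last as]\<close> la list.set_intros(1) so(1) sorted_wrt_append)
      then show ?thesis using la rd(6) by auto
    qed
    have bs: "l < the (\<rho> (fst z))" if z: "z \<in> set bs" for z
    proof -
      obtain b bs' where b: "bs = b # bs'" using z by (cases bs) auto
      then have "the (\<rho> (fst b)) = y" using rd(5) tr(1) by (simp add: rref_def)
      then show ?thesis using that so(2) b rd(7) by auto
    qed
    have k: "k = k'" "k \<notin> fst ` set (as @ bs)" "t \<in> T" using tr(1,3) by (auto simp: mstates_def)
    have lr: "left L l = snd ` set as" "right L l = snd ` set bs"
      using represents_left_right[OF R, of as "{}" bs l] as bs by simp_all
    have "length (as @ (k', t) # bs) \<le> M"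
      using tr(3) by (intro length_mstates) (simp_all add: mstates_def)
    then have "card (dom L) < M" using represents_dom(2)[OF R] by simp
    then have "mstep u m (ph, L(l \<mapsto> t), N \<union> {l})"
      unfolding m using tr(1,5) rd(3) k lr by (intro mstep.insert) auto
    moreover have "rel u c' (ph, L(l \<mapsto> t), N \<union> {l})"
      using rd(2,3) tr(1,3) k(1) dom represents_insert[OF R as bs k(2)]
      by (auto simp: rel_iff)
    ultimately show ?thesis by blast
  qed auto
qed

lemma mstep_imp_step:
  assumes s: "mstep u m m'" and r: "rel u c m" and u: "u \<in> lists \<Sigma>"
  shows "\<exists>c'. step mpia u c c' \<and> rel u c' m'"
  using s
proof cases
  case (insert p N t L ph)
  obtain xs \<rho> where c: "c = ((ph, xs), \<rho>, N)" and R: "represents xs \<rho> L" "(ph, xs) \<in> mstates"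
    "dom L \<subseteq> N" "N \<subseteq> {1..length u}"
    using r insert(1) by (cases c) (auto simp: rel_iff)
  let ?pos = "\<lambda>x :: nat \<times> 't. the (\<rho> (fst x))"
  define as bs where "as = takeWhile (\<lambda>x. ?pos x < p) xs" and "bs = dropWhile (\<lambda>x. ?pos x < p) xs"
  have xs: "xs = as @ bs" by (simp add: as_def bs_def)
  have so: "sorted_wrt (\<lambda>x y. ?pos x < ?pos y) xs" and nn: "\<And>x. x \<in> set xs \<Longrightarrow> \<rho> (fst x) \<noteq> None"
    using R(1) by (auto simp: represents_def)
  have np: "?pos x \<noteq> p" if "x \<in> set xs" for x
    using that represents_dom(1)[OF R(1)] R(3) insert(3) by auto
  have as: "?pos x < p" if "x \<in> set as" for x using that unfolding as_def by (auto dest: set_takeWhileD)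
  have bs: "p < ?pos x" if z: "x \<in> set bs" for x
  proof -
    obtain b bs' where b: "bs = b # bs'" using z by (cases bs) auto
    then have "\<not> ?pos b < p" using bs_def by (metis hd_dropWhile list.distinct(1) list.sel(1))
    then have "p < ?pos b" using np[of b] xs b by auto
    then show ?thesis using that b so xs by (auto simp: sorted_wrt_append)
  qed
  \<comment> \<open>Fewer than \<open>M\<close> positions are live, so some pebble name is not in
    the list.\<close>
  have "\<exists>k. k \<in> {1..M} - fst ` set xs"
  proof -
    have "length xs < M" using represents_dom(2)[OF R(1)] insert(5) by simp
    then have "card (fst ` set xs) < card {1..M}"
      using card_image_le[of "set xs" fst] card_length[of xs] by simp
    then show ?thesis using card_mono[of "fst ` set xs" "{1..M}"] by fastforce
  qed
  then obtain k where k: "k \<in> {1..M}" "k \<notin> fst ` set xs" by blast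
  have lr: "left L p = snd ` set as" "right L p = snd ` set bs"
    using represents_left_right[OF R(1), of as "{}" bs p] as bs by (simp_all add: xs)
  have st: "(ph, as @ (k, t) # bs) \<in> mstates" using R(2) k insert(4) by (auto simp: mstates_def xs)
  have "u ! (p - 1) \<in> \<Sigma>"
  proof -
    have "p - 1 < length u" using insert(3) by auto
    then show ?thesis using u nth_mem by blast
  qed
  then have tr: "Read (ph, as @ bs) (Move k (lref as) (rref bs)) (u ! (p - 1)) (ph, as @ (k, t) # bs)
      \<in> delta mpia"
    using R(2) st insert(6) lr unfolding mpia_def mtrans_def xs by auto
  have i: "\<exists>x. pos u \<rho> (lref as) = Some x \<and> x < p"
  proof (cases "as = []")
    case True
    then show ?thesis using insert(3) by (simp add: lref_def)
  next
    case False
    then show ?thesis using nn[of "last as"] as[of "last as"] xs by (auto simp: lref_def)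
  qed
  have j: "\<exists>y. pos u \<rho> (rref bs) = Some y \<and> p < y"
  proof (cases "bs = []")
    case True
    then show ?thesis using insert(3) by (simp add: rref_def)
  next
    case False
    then show ?thesis using nn[of "hd bs"] bs[of "hd bs"] xs by (auto simp: rref_def)
  qed
  obtain x y where xy: "pos u \<rho> (lref as) = Some x" "x < p" "pos u \<rho> (rref bs) = Some y" "p < y"
    using i j by blast
  have "step mpia u c ((ph, as @ (k, t) # bs), \<rho>(k \<mapsto> p), N \<union> {p})"
    unfolding c xs by (rule step.read[OF insert(3) tr xy(1,3,2,4)])
  moreover have "rel u ((ph, as @ (k, t) # bs), \<rho>(k \<mapsto> p), N \<union> {p}) m'"
    using insert(2,3) R st k(2) as bs represents_insert[of as bs \<rho> L p k t] by (auto simp: rel_iff xs)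
  ultimately show ?thesis by blast
next
  case (delete L p t ph N)
  obtain xs \<rho> where c: "c = ((ph, xs), \<rho>, N)" and R: "represents xs \<rho> L" "(ph, xs) \<in> mstates"
    "dom L \<subseteq> N" "N \<subseteq> {1..length u}"
    using r delete(1) by (cases c) (auto simp: rel_iff)
  obtain k where k: "(k, t) \<in> set xs" "\<rho> k = Some p" using representsD(2)[OF R(1) delete(3)] by blast
  then obtain as bs where xs: "xs = as @ (k, t) # bs" by (meson split_list)
  have lr: "left L p = snd ` set as" "right L p = snd ` set bs"
    using represents_middle[of as k t bs \<rho> L] R(1) xs k(2) by auto
  have "Silent (ph, xs) (ph, as @ bs) \<in> delta mpia"
    using R(2) delete(4) lr unfolding mpia_def mtrans_def xs by auto
  then have "step mpia u c ((ph, as @ bs), \<rho>, N)" unfolding c by (rule step.silent)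
  moreover have "rel u ((ph, as @ bs), \<rho>, N) m'"
    using delete(2) R xs represents_delete[of as k t bs \<rho> L p] k(2) by (auto simp: rel_iff mstates_def)
  ultimately show ?thesis by blast
next
  case (shift ph' ph L L' N)
  obtain xs \<rho> where c: "c = ((ph, xs), \<rho>, N)" and R: "represents xs \<rho> L" "(ph, xs) \<in> mstates"
    "dom L \<subseteq> N" "N \<subseteq> {1..length u}"
    using r shift(1) by (cases c) (auto simp: rel_iff)
  let ?pos = "\<lambda>x :: nat \<times> 't. the (\<rho> (fst x))"
  define ys where "ys = map (\<lambda>x. (fst x, the (L' (?pos x)))) xs"
  have ys: "map fst xs = map fst ys" by (simp add: ys_def)
  have dL: "L (?pos x) = Some (snd x)" "\<exists>t'. L' (?pos x) = Some t'" if "x \<in> set xs" for x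
  proof -
    show "L (?pos x) = Some (snd x)" using representsD(1)[OF R(1), of "fst x" "snd x"] that by auto
    then have "?pos x \<in> dom L'" using shift(5) by auto
    then show "\<exists>t'. L' (?pos x) = Some t'" by auto
  qed
  have "retag ph ph' (snd x) (the (L' (?pos x)))" "the (L' (?pos x)) \<in> T" if "x \<in> set xs" for x
    using dL[OF that] shift(6,7) by (auto simp: ran_def)
  then have la: "list_all2 (\<lambda>x y. retag ph ph' (snd x) (snd y)) xs ys" and st: "(ph', ys) \<in> mstates"
    using R(2) shift(3) by (auto simp: ys_def list_all2_conv_all_nth mstates_def comp_def)
  have "Silent (ph, xs) (ph', ys) \<in> delta mpia"
    using R(2) st ys shift(4) la unfolding mpia_def mtrans_def represents_contexts[OF R(1)] by auto
  then have "step mpia u c ((ph', ys), \<rho>, N)" unfolding c by (rule step.silent)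
  moreover have "rel u ((ph', ys), \<rho>, N) m'"
  proof -
    obtain L'' where L'': "represents ys \<rho> L''" "dom L'' = dom L" using represents_retag[OF R(1) ys] by blast
    \<comment> \<open>\<open>represents_retag\<close> yields only some marking represented by
      \<open>ys\<close>; it is identified with the given \<open>L'\<close>, from which the tags of
      \<open>ys\<close> were taken.\<close>
    have "L'' p = L' p" for p
    proof (cases "L'' p")
      case None
      then have "p \<notin> dom L'" using L''(2) shift(5) by auto
      then show ?thesis using None by (simp add: domIff)
    next
      case (Some t)
      then obtain k where "(k, t) \<in> set ys" "\<rho> k = Some p" using representsD(2)[OF L''(1)] by blast
      then obtain x where "x \<in> set xs" "t = the (L' p)" "?pos x = p" by (auto simp: ys_def)
      then show ?thesis using dL(2) Some by fastforce
    qed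
    then have "L'' = L'" by blast
    then show ?thesis using L'' R st shift(2) by (auto simp: rel_iff)
  qed
  ultimately show ?thesis by blast
qed

lemma lang_mpia: "lang_pia mpia = mlang"
proof (intro equalityI subsetI)
  fix u assume "u \<in> lang_pia mpia"
  then obtain ph xs \<rho> where u: "u \<in> lists \<Sigma>" "acc ph (snd ` set xs)"
    and run: "(step mpia u)\<^sup>*\<^sup>* (initial_config mpia) ((ph, xs), \<rho>, {1..length u})"
    by (auto simp: lang_pia_def accepting_def mpia_def)
  have "\<exists>m. (mstep u)\<^sup>*\<^sup>* (start, \<lambda>_. None, {}) m \<and> rel u c m"
    if "(step mpia u)\<^sup>*\<^sup>* (initial_config mpia) c" for c
    using that
  proof (induction rule: rtranclp_induct)
    case base
    show ?case using rel_initial by blast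
  next
    case (step c c')
    then show ?case using step_imp_mstep by (meson rtranclp.rtrancl_into_rtrancl)
  qed
  from this[OF run] obtain m where
    "(mstep u)\<^sup>*\<^sup>* (start, \<lambda>_. None, {}) m" "rel u ((ph, xs), \<rho>, {1..length u}) m" by blast
  moreover from this obtain L where "m = (ph, L, {1..length u})" "represents xs \<rho> L"
    by (cases m) (auto simp: rel_iff)
  ultimately show "u \<in> mlang" using u represents_dom(3) unfolding mlang_def by fastforce
next
  fix u assume "u \<in> mlang"
  then obtain ph L where u: "u \<in> lists \<Sigma>" "acc ph (ran L)"
    and run: "(mstep u)\<^sup>*\<^sup>* (start, \<lambda>_. None, {}) (ph, L, {1..length u})"
    by (auto simp: mlang_def)
  have "\<exists>c. (step mpia u)\<^sup>*\<^sup>* (initial_config mpia) c \<and> rel u c m"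
    if "(mstep u)\<^sup>*\<^sup>* (start, \<lambda>_. None, {}) m" for m
    using that
  proof (induction rule: rtranclp_induct)
    case base
    show ?case using rel_initial by blast
  next
    case (step m m')
    then show ?case using mstep_imp_step u(1) by (meson rtranclp.rtrancl_into_rtrancl)
  qed
  from this[OF run] obtain ph' xs \<rho> N where
    c: "(step mpia u)\<^sup>*\<^sup>* (initial_config mpia) ((ph', xs), \<rho>, N)"
      "rel u ((ph', xs), \<rho>, N) (ph, L, {1..length u})" by auto
  then have "accepting mpia u ((ph', xs), \<rho>, N)"
    using u(2) represents_dom(3)[of xs \<rho> L] by (auto simp: rel_iff accepting_def mpia_def)
  then show "u \<in> lang_pia mpia" using c(1) u(1) by (auto simp: lang_pia_def mpia_def)
qed

theorem mlang_pia: "\<exists>A :: ('a, nat) pia. is_pia A \<and> alphabet A = \<Sigma> \<and> lang_pia A = mlang"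
  using pia_nat_states[OF is_pia_mpia] lang_mpia by (simp add: mpia_def)

end

section \<open>The sweep over the rows\<close>

text \<open>
  \<open>Init\<close> guesses the extrema of the whole word.  In phase \<open>Ins\<close> the extrema that have become
  relevant by the last advance of the current row are read, in phase \<open>Chk\<close> the rest of the current
  row is read and checked.
\<close>

datatype phase = Init | Ins | Chk

lemma finite_phase: "finite (UNIV :: phase set)"
proof -
  have "(UNIV :: phase set) = {Init, Ins, Chk}" using phase.exhaust by blast
  then show ?thesis by (metis finite.emptyI finite_insert)
qed

text \<open>
  In phase \<open>Ins\<close> the levels 1 and 2 are not distinguished, because both stem from level 2 before
  the advance, where the extrema were complete.
\<close>

definition merge :: "phase \<Rightarrow> int \<Rightarrow> int" where
  "merge ph l = (if ph = Ins then min 1 l else l)"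

definition covers :: "phase \<Rightarrow> ('g \<times> int) set \<Rightarrow> 'g \<Rightarrow> int \<Rightarrow> bool" where
  "covers ph A g l \<longleftrightarrow> (\<exists>l'. (g, l') \<in> A \<and> merge ph l' = merge ph l)"

text \<open>The sweep is independent of logic: it enforces an arbitrary local condition
  \<open>ok\<close> on the tags to the left, the own label and the tags to the right.
  \<open>empty_ok\<close> is the separate verdict on the empty word.\<close>

locale grid_machine =
  fixes \<Sigma> :: "'a set" and G :: "'g set" and letter :: "'g \<Rightarrow> 'a"
    and ok :: "('g \<times> int) set \<Rightarrow> 'g \<Rightarrow> ('g \<times> int) set \<Rightarrow> bool" and empty_ok :: bool
  assumes finite_alph: "finite \<Sigma>" and finite_labels: "finite G"
begin

definition T :: "('g \<times> int) set" where
  "T = G \<times> {-2..2}"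

text \<open>In \<open>Init\<close> nothing can be demanded of the guessed extrema. They are
  vindicated later, since every further position must be read between two live positions with its
  own label and a level that the phase does not tell apart from its own.\<close>

definition ins :: "phase \<Rightarrow> ('g \<times> int) set \<Rightarrow> 'g \<times> int \<Rightarrow> ('g \<times> int) set \<Rightarrow> 'a \<Rightarrow> bool" where
  "ins ph A = (\<lambda>(g, l) B a. letter g = a \<and>
     (case ph of Init \<Rightarrow> l = 2
      | Ins \<Rightarrow> 1 \<le> l \<and> covers ph A g l \<and> covers ph B g l
      | Chk \<Rightarrow> l = 0 \<and> covers ph A g l \<and> covers ph B g l))"

text \<open>The same tag must remain on both sides, so no other position loses a tag from its left
  or right context. A position of the current row is checked at this moment; one below it was
  checked when its row was left.\<close>

definition del :: "phase \<Rightarrow> ('g \<times> int) set \<Rightarrow> 'g \<times> int \<Rightarrow> ('g \<times> int) set \<Rightarrow> bool" where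
  "del ph A = (\<lambda>(g, l) B. ph = Chk \<and> (g, l) \<in> A \<inter> B \<and> (l < 0 \<or> l = 0 \<and> ok A g B))"

text \<open>Leaving a row checks those of its positions that are still live. The last condition
  excludes gaps: elements two or more rows up require an element in the next row.\<close>

definition shift :: "phase \<Rightarrow> phase \<Rightarrow> (('g \<times> int) set \<times> ('g \<times> int) \<times> ('g \<times> int) set) set \<Rightarrow> bool" where
  "shift ph ph' X \<longleftrightarrow> ph = Init \<and> ph' = Ins \<or> ph = Ins \<and> ph' = Chk \<or>
     ph = Chk \<and> ph' = Ins \<and> (\<forall>A g B. (A, (g, 0), B) \<in> X \<longrightarrow> ok A g B) \<and>
     ((\<exists>A g B. (A, (g, 2), B) \<in> X) \<longrightarrow> (\<exists>A g B. (A, (g, 1), B) \<in> X))"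

lemma shift_ChkD:
  assumes "shift Chk ph' X"
  shows "(A, (g, 0), B) \<in> X \<Longrightarrow> ok A g B"
    "(A, (g, 2), B) \<in> X \<Longrightarrow> \<exists>A g B. (A, (g, 1), B) \<in> X"
  using assms unfolding shift_def by simp_all blast+

lemma shift_ChkI:
  assumes "\<And>A g B. (A, (g, 0), B) \<in> X \<Longrightarrow> ok A g B"
    "\<And>A g B. (A, (g, 2), B) \<in> X \<Longrightarrow> \<exists>A g B. (A, (g, 1), B) \<in> X"
  shows "shift Chk Ins X"
  using assms unfolding shift_def by simp blast

text \<open>An advance lowers every level by one, with -2 absorbing. Level 2 may become 1 or remain
  2; this is the guess of who belongs to the row after the new current one.\<close>

definition retag :: "phase \<Rightarrow> phase \<Rightarrow> 'g \<times> int \<Rightarrow> 'g \<times> int \<Rightarrow> bool" where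
  "retag ph ph' = (\<lambda>(g, l) (g', l'). g' = g \<and>
     (if ph = Ins then l' = l else if l = 2 then l' \<in> {1, 2} else l' = max (-2) (l - 1)))"

text \<open>Nothing can be deleted in \<open>Init\<close>, so an empty marking there means that
  nothing was read. Otherwise the sweep must have passed every live position.\<close>

definition acc :: "phase \<Rightarrow> ('g \<times> int) set \<Rightarrow> bool" where
  "acc ph X \<longleftrightarrow> ph = Init \<and> X = {} \<and> empty_ok \<or> ph = Ins \<and> X \<noteq> {} \<and> (\<forall>(g, l)\<in>X. l < 0)"

text \<open>
  There are \<open>5 * card G\<close> tags, hence at most \<open>10 * card G\<close> extremal positions; those of two
  consecutive rows and one further position may be live at the same time.
\<close>

sublocale marking_machine \<Sigma> UNIV T "20 * card G + 2" ins del shift retag Init acc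
  by unfold_locales (simp_all add: finite_alph finite_phase finite_labels T_def)

definition inv :: "'a list \<Rightarrow> (phase, 'g \<times> int) mconfig \<Rightarrow> bool" where
  "inv u = (\<lambda>(ph, L, N). dom L \<subseteq> N \<and> N \<subseteq> {1..length u} \<and> ran L \<subseteq> T \<and>
     (ph = Init \<longrightarrow> dom L = N \<and> snd ` ran L \<subseteq> {2}))"

lemma inv_mstep:
  assumes "mstep u c c'" "inv u c"
  shows "inv u c'"
  using assms
proof cases
  case (insert p N t L ph)
  have i: "dom L \<subseteq> N" "N \<subseteq> {1..length u}" "ran L \<subseteq> T" "ph = Init \<longrightarrow> dom L = N \<and> snd ` ran L \<subseteq> {2}"
    using assms(2) by (simp_all add: inv_def insert(1))
  have r: "ran (L(p \<mapsto> t)) \<subseteq> insert t (ran L)" by (auto simp: ran_def)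
  moreover have "snd t = 2" if "ph = Init" using insert(6) that by (cases t) (simp add: ins_def)
  moreover have "dom (L(p \<mapsto> t)) = dom L \<union> {p}" by simp
  ultimately show ?thesis
    unfolding inv_def insert(2) prod.case
  proof (intro conjI impI)
    show "ran (L(p \<mapsto> t)) \<subseteq> T" using r i(3) insert(4) by (meson insert_subset order_trans)
    assume "ph = Init"
    then show "snd ` ran (L(p \<mapsto> t)) \<subseteq> {2}" "dom (L(p \<mapsto> t)) = N \<union> {p}"
      using i(4) image_mono[OF r, of snd] \<open>ph = Init \<Longrightarrow> snd t = 2\<close> by auto
  qed (use i insert(3) in auto)
next
  case (delete L p t ph N)
  have "ran (L(p := None)) \<subseteq> ran L" by (auto simp: ran_def)
  then show ?thesis using assms(2) delete by (auto simp: inv_def del_def)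
next
  case (shift ph' ph L L' N)
  have "ph' \<noteq> Init" using shift(4) by (auto simp: shift_def)
  then show ?thesis using assms(2) shift(1,2,5,6) by (simp add: inv_def)
qed

section \<open>Soundness\<close>

text \<open>
  This invariant is propagated backwards along an accepting run: the live and the unread positions
  can be labelled and put into rows, numbered relative to the current row, such that all checks
  that are still to be made succeed.
\<close>

definition valid :: "'a list \<Rightarrow> (phase, 'g \<times> int) mconfig \<Rightarrow> (nat \<Rightarrow> 'g) \<Rightarrow> (nat \<Rightarrow> int) \<Rightarrow> bool" where
  "valid u = (\<lambda>(ph, L, N) lb row. let U = {1..length u} - N; V = dom L \<union> U in
     (\<forall>p\<in>dom L. L p = Some (lb p, lev (row p))) \<and>
     (\<forall>p\<in>U. letter (lb p) = u ! (p - 1) \<and> lb p \<in> G \<and>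
        (if ph = Init then 2 \<le> row p
         else 0 \<le> row p \<and> covers ph (left L p) (lb p) (lev (row p)) \<and> covers ph (right L p) (lb p) (lev (row p)))) \<and>
     (\<forall>p\<in>V. 0 \<le> row p \<longrightarrow>
        ok (tags lb row (row p) {q \<in> V. q < p}) (lb p) (tags lb row (row p) {q \<in> V. p < q})) \<and>
     (\<forall>p\<in>V. (if ph = Init then 2 else 1) < row p \<longrightarrow> (\<exists>q\<in>V. row q = row p - 1)))"

lemma validD:
  assumes "valid u (ph, L, N) lb row"
  shows "L p = Some t \<Longrightarrow> t = (lb p, lev (row p))"
    "p \<in> {1..length u} - N \<Longrightarrow> letter (lb p) = u ! (p - 1) \<and> lb p \<in> G"
    "p \<in> {1..length u} - N \<Longrightarrow> ph = Init \<Longrightarrow> 2 \<le> row p"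
    "p \<in> {1..length u} - N \<Longrightarrow> ph \<noteq> Init \<Longrightarrow> 0 \<le> row p"
    "p \<in> {1..length u} - N \<Longrightarrow> ph \<noteq> Init \<Longrightarrow>
       covers ph (left L p) (lb p) (lev (row p)) \<and> covers ph (right L p) (lb p) (lev (row p))"
    "p \<in> dom L \<union> ({1..length u} - N) \<Longrightarrow> 0 \<le> row p \<Longrightarrow>
       ok (tags lb row (row p) {q \<in> dom L \<union> ({1..length u} - N). q < p}) (lb p)
         (tags lb row (row p) {q \<in> dom L \<union> ({1..length u} - N). p < q})"
    "p \<in> dom L \<union> ({1..length u} - N) \<Longrightarrow> (if ph = Init then 2 else 1) < row p \<Longrightarrow>
       \<exists>q\<in>dom L \<union> ({1..length u} - N). row q = row p - 1"
proof -
  let ?U = "{1..length u} - N" and ?V = "dom L \<union> ({1..length u} - N)"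
  note v = assms[unfolded valid_def Let_def prod.case]
  have live: "\<forall>p\<in>dom L. L p = Some (lb p, lev (row p))" by (rule v[THEN conjunct1])
  have U: "\<forall>p\<in>?U. letter (lb p) = u ! (p - 1) \<and> lb p \<in> G \<and>
        (if ph = Init then 2 \<le> row p
         else 0 \<le> row p \<and> covers ph (left L p) (lb p) (lev (row p)) \<and> covers ph (right L p) (lb p) (lev (row p)))"
    by (rule v[THEN conjunct2, THEN conjunct1])
  have ok: "\<forall>p\<in>?V. 0 \<le> row p \<longrightarrow>
        ok (tags lb row (row p) {q \<in> ?V. q < p}) (lb p) (tags lb row (row p) {q \<in> ?V. p < q})"
    by (rule v[THEN conjunct2, THEN conjunct2, THEN conjunct1])
  have con: "\<forall>p\<in>?V. (if ph = Init then 2 else 1) < row p \<longrightarrow> (\<exists>q\<in>?V. row q = row p - 1)"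
    by (rule v[THEN conjunct2, THEN conjunct2, THEN conjunct2])
  show "t = (lb p, lev (row p))" if "L p = Some t"
    using bspec[OF live, of p] that by (simp add: domI)
  show "letter (lb p) = u ! (p - 1) \<and> lb p \<in> G" if "p \<in> ?U" using bspec[OF U that] by blast
  show "2 \<le> row p" if "p \<in> ?U" "ph = Init" using bspec[OF U that(1)] that(2) by simp
  show "0 \<le> row p" if "p \<in> ?U" "ph \<noteq> Init" using bspec[OF U that(1)] that(2) by simp
  show "covers ph (left L p) (lb p) (lev (row p)) \<and> covers ph (right L p) (lb p) (lev (row p))"
    if "p \<in> ?U" "ph \<noteq> Init" using bspec[OF U that(1)] that(2) by simp
  show "ok (tags lb row (row p) {q \<in> ?V. q < p}) (lb p) (tags lb row (row p) {q \<in> ?V. p < q})"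
    if "p \<in> ?V" "0 \<le> row p" using bspec[OF ok that(1)] that(2) by simp
  show "\<exists>q\<in>?V. row q = row p - 1" if "p \<in> ?V" "(if ph = Init then 2 else 1) < row p"
    using bspec[OF con that(1)] that(2) by simp
qed

lemma validI:
  assumes "\<And>p t. L p = Some t \<Longrightarrow> t = (lb p, lev (row p))"
    "\<And>p. p \<in> {1..length u} - N \<Longrightarrow> letter (lb p) = u ! (p - 1) \<and> lb p \<in> G"
    "\<And>p. p \<in> {1..length u} - N \<Longrightarrow> ph = Init \<Longrightarrow> 2 \<le> row p"
    "\<And>p. p \<in> {1..length u} - N \<Longrightarrow> ph \<noteq> Init \<Longrightarrow> 0 \<le> row p"
    "\<And>p. p \<in> {1..length u} - N \<Longrightarrow> ph \<noteq> Init \<Longrightarrow>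
       covers ph (left L p) (lb p) (lev (row p)) \<and> covers ph (right L p) (lb p) (lev (row p))"
    "\<And>p. p \<in> dom L \<union> ({1..length u} - N) \<Longrightarrow> 0 \<le> row p \<Longrightarrow>
       ok (tags lb row (row p) {q \<in> dom L \<union> ({1..length u} - N). q < p}) (lb p)
         (tags lb row (row p) {q \<in> dom L \<union> ({1..length u} - N). p < q})"
    "\<And>p. p \<in> dom L \<union> ({1..length u} - N) \<Longrightarrow> (if ph = Init then 2 else 1) < row p \<Longrightarrow>
       \<exists>q\<in>dom L \<union> ({1..length u} - N). row q = row p - 1"
  shows "valid u (ph, L, N) lb row"
proof -
  have "\<forall>p\<in>dom L. L p = Some (lb p, lev (row p))" using assms(1) by blast
  then show ?thesis using assms(2-) unfolding valid_def Let_def by simp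
qed

lemma tags_cong:
  assumes "\<And>q. q \<in> S \<Longrightarrow> lb q = lb' q \<and> lev (row q - t) = lev (row' q - t')"
  shows "tags lb row t S = tags lb' row' t' S"
  unfolding tags_def using assms by (intro image_cong refl) auto

text \<open>Unread positions that are covered contribute nothing new: if \<open>q\<close> lies to
  the left of \<open>p\<close>, its tag also occurs on a live position left of \<open>q\<close>,
  hence left of \<open>p\<close>, and symmetrically on the right.\<close>

lemma tags_live:
  assumes live: "\<And>p t. L p = Some t \<Longrightarrow> t = (lb p, lev (row p))"
    and cov: "\<And>q. q \<in> U \<Longrightarrow> (lb q, lev (row q)) \<in> left L q \<and> (lb q, lev (row q)) \<in> right L q"
  shows "tags lb row 0 {q \<in> dom L \<union> U. q < p} = left L p"
    "tags lb row 0 {q \<in> dom L \<union> U. p < q} = right L p"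
proof -
  show "tags lb row 0 {q \<in> dom L \<union> U. q < p} = left L p"
  proof (intro equalityI subsetI)
    fix t assume "t \<in> tags lb row 0 {q \<in> dom L \<union> U. q < p}"
    then obtain q where q: "q \<in> dom L \<union> U" "q < p" "t = (lb q, lev (row q))" by (auto simp: tags_def)
    show "t \<in> left L p"
    proof (cases "q \<in> dom L")
      case True
      then show ?thesis using live q by (auto simp: left_def)
    next
      case False
      then obtain q' where "q' < q" "L q' = Some t" using cov[of q] q by (auto simp: left_def)
      then show ?thesis using q(2) by (auto simp: left_def intro!: exI[of _ q'])
    qed
  next
    fix t assume "t \<in> left L p"
    then obtain q where "q < p" "L q = Some t" by (auto simp: left_def)
    then show "t \<in> tags lb row 0 {q \<in> dom L \<union> U. q < p}" using live[of q t] by (auto simp: tags_def)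
  qed
  show "tags lb row 0 {q \<in> dom L \<union> U. p < q} = right L p"
  proof (intro equalityI subsetI)
    fix t assume "t \<in> tags lb row 0 {q \<in> dom L \<union> U. p < q}"
    then obtain q where q: "q \<in> dom L \<union> U" "p < q" "t = (lb q, lev (row q))" by (auto simp: tags_def)
    show "t \<in> right L p"
    proof (cases "q \<in> dom L")
      case True
      then show ?thesis using live q by (auto simp: right_def)
    next
      case False
      then obtain q' where "q < q'" "L q' = Some t" using cov[of q] q by (auto simp: right_def)
      then show ?thesis using q(2) by (auto simp: right_def intro!: exI[of _ q'])
    qed
  next
    fix t assume "t \<in> right L p"
    then obtain q where "p < q" "L q = Some t" by (auto simp: right_def)
    then show "t \<in> tags lb row 0 {q \<in> dom L \<union> U. p < q}" using live[of q t] by (auto simp: tags_def)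
  qed
qed

lemma covers_Chk: "covers Chk A g l \<longleftrightarrow> (g, l) \<in> A"
  by (auto simp: covers_def merge_def)

text \<open>Undoing an insertion turns \<open>p\<close> from live to unread, so the set of remaining
  positions is the same. Only coverage is at stake: whatever \<open>p\<close> covered is covered by
  the positions that cover \<open>p\<close>.\<close>

lemma valid_insert:
  assumes v: "valid u (ph, L(p \<mapsto> t), N \<union> {p}) lb row" and p: "p \<in> {1..length u} - N"
    and i: "ins ph (left L p) t (right L p) (u ! (p - 1))" and t: "t \<in> T" and inv: "dom L \<subseteq> N"
  shows "valid u (ph, L, N) lb row"
proof -
  let ?V = "dom L \<union> ({1..length u} - N)"
  have V: "dom (L(p \<mapsto> t)) \<union> ({1..length u} - (N \<union> {p})) = ?V" using p by auto
  have pL: "L p = None" using p inv by auto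
  have tp: "t = (lb p, lev (row p))" using validD(1)[OF v, of p t] by simp
  have c: "covers ph (left L q) (lb q) (lev (row q)) \<and> covers ph (right L q) (lb q) (lev (row q))"
    if q: "q \<in> {1..length u} - N" and ph: "ph \<noteq> Init" for q
  proof -
    have cp: "covers ph (left L p) (lb p) (lev (row p))" "covers ph (right L p) (lb p) (lev (row p))"
      using i ph by (auto simp: ins_def tp split: phase.splits)
    show ?thesis
    proof (cases "q = p")
      case False
      then have cq: "covers ph (left (L(p \<mapsto> t)) q) (lb q) (lev (row q))"
        "covers ph (right (L(p \<mapsto> t)) q) (lb q) (lev (row q))"
        using validD(5)[OF v, of q] q ph by auto
      have "covers ph (left L q) (lb q) (lev (row q))"
      proof -
        obtain l r where l: "r < q" "(L(p \<mapsto> t)) r = Some (lb q, l)" "merge ph l = merge ph (lev (row q))"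
          using cq(1) by (auto simp: covers_def left_def)
        show ?thesis
        proof (cases "r = p")
          case True
          then have "lb q = lb p" "merge ph (lev (row q)) = merge ph (lev (row p))" "p < q"
            using l tp by auto
          moreover from cp(1) obtain l' r' where "r' < p" "L r' = Some (lb p, l')"
            "merge ph l' = merge ph (lev (row p))"
            by (auto simp: covers_def left_def)
          ultimately show ?thesis
            unfolding covers_def left_def by (auto intro!: exI[of _ l'] exI[of _ r'])
        next
          case False
          then show ?thesis using l unfolding covers_def left_def by auto
        qed
      qed
      moreover have "covers ph (right L q) (lb q) (lev (row q))"
      proof -
        obtain l r where l: "q < r" "(L(p \<mapsto> t)) r = Some (lb q, l)" "merge ph l = merge ph (lev (row q))"
          using cq(2) by (auto simp: covers_def right_def)
        show ?thesis
        proof (cases "r = p")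
          case True
          then have "lb q = lb p" "merge ph (lev (row q)) = merge ph (lev (row p))" "q < p"
            using l tp by auto
          moreover from cp(2) obtain l' r' where "p < r'" "L r' = Some (lb p, l')"
            "merge ph l' = merge ph (lev (row p))"
            by (auto simp: covers_def right_def)
          ultimately show ?thesis
            unfolding covers_def right_def by (auto intro!: exI[of _ l'] exI[of _ r'])
        next
          case False
          then show ?thesis using l unfolding covers_def right_def by auto
        qed
      qed
      ultimately show ?thesis by blast
    qed (use cp in simp)
  qed
  have r: "(ph = Init \<longrightarrow> 2 \<le> row p) \<and> 0 \<le> row p"
    using i by (auto simp: ins_def tp lev_def max_def min_def split: phase.splits if_splits)
  show ?thesis
  proof (rule validI)
    show "s = (lb q, lev (row q))" if "L q = Some s" for q s
      using validD(1)[OF v, of q s] that pL by (cases "q = p") auto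
    show "letter (lb q) = u ! (q - 1) \<and> lb q \<in> G" if "q \<in> {1..length u} - N" for q
      using validD(2)[OF v, of q] that i t by (cases "q = p") (auto simp: ins_def tp T_def)
    show "2 \<le> row q" if "q \<in> {1..length u} - N" "ph = Init" for q
      using validD(3)[OF v, of q] that r by (cases "q = p") auto
    show "0 \<le> row q" if "q \<in> {1..length u} - N" "ph \<noteq> Init" for q
      using validD(4)[OF v, of q] that r by (cases "q = p") auto
  qed (use c validD(6,7)[OF v, unfolded V] in auto)
qed

text \<open>The deleted position is put back with the label and the level of its tag as label and
  row. It duplicates a tag present on both sides, so the contexts of the other positions that are
  still to be checked do not change.\<close>

lemma valid_delete:
  assumes v: "valid u (ph, L(p := None), N) lb row" and p: "L p = Some t"
    and d: "del ph (left L p) t (right L p)" and inv: "dom L \<subseteq> N"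
  shows "\<exists>lb row. valid u (ph, L, N) lb row"
proof -
  obtain g l where t: "t = (g, l)" by (cases t)
  have ph: "ph = Chk" and l: "(g, l) \<in> left L p" "(g, l) \<in> right L p" "l \<le> 0"
    and g: "l = 0 \<Longrightarrow> ok (left L p) g (right L p)"
    using d by (auto simp: del_def t)
  let ?lb = "lb(p := g)"
  have "-2 \<le> l"
  proof -
    obtain q where "q < p" "L q = Some (g, l)" using l(1) by (auto simp: left_def)
    then show ?thesis using validD(1)[OF v, of q "(g, l)"] by (auto simp: lev_def)
  qed
  let ?row = "row(p := l)"
  let ?U = "{1..length u} - N"
  let ?V = "dom L \<union> ?U" and ?V' = "dom (L(p := None)) \<union> ?U"
  have pU: "p \<notin> ?U" using p inv by auto
  have V: "?V = insert p ?V'" "p \<notin> ?V'" using p pU by auto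
  have ll: "lev l = l" using \<open>-2 \<le> l\<close> l(3) by (auto simp: lev_def)
  have live: "s = (?lb q, lev (?row q))" if "L q = Some s" for q s
    using validD(1)[OF v, of q s] that p t ll by (cases "q = p") auto
  have cov: "(?lb q, lev (?row q)) \<in> left L q \<and> (?lb q, lev (?row q)) \<in> right L q" if "q \<in> ?U" for q
  proof -
    have "q \<noteq> p" using that pU by blast
    moreover have "(lb q, lev (row q)) \<in> left (L(p := None)) q" "(lb q, lev (row q)) \<in> right (L(p := None)) q"
      using validD(5)[OF v that] by (simp_all add: ph covers_Chk)
    ultimately show ?thesis by (auto simp: left_def right_def split: if_splits)
  qed
  have good: "ok (tags ?lb ?row (?row q) {r \<in> ?V. r < q}) (?lb q) (tags ?lb ?row (?row q) {r \<in> ?V. q < r})"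
    if q: "q \<in> ?V" "0 \<le> ?row q" for q
  proof (cases "q = p")
    case True
    then have "l = 0" using q(2) l(3) by simp
    then show ?thesis using True g tags_live[of L ?lb ?row ?U p, OF live cov] by simp
  next
    case False
    then have q': "q \<in> ?V'" "0 \<le> row q" using q V by auto
    \<comment> \<open>For \<open>l\<close> equal to 0 or -1 the row of \<open>r\<close> is exactly
      \<open>l\<close>. For -2 it may be lower, but seen from a row \<open>row q \<ge> 0\<close>
      both lie at least two below.\<close>
    have same: "?lb p = lb r \<and> lev (?row p - row q) = lev (row r - row q)" if "L r = Some (g, l)" "r \<noteq> p" for r
    proof -
      have "lb r = g" "lev (row r) = l" using live[OF that(1)] that(2) by auto
      then show ?thesis using l(3) q'(2) \<open>-2 \<le> l\<close> by (auto simp: lev_def max_def min_def split: if_splits)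
    qed
    have "tags ?lb ?row (row q) {r \<in> ?V. r < q} = tags lb row (row q) {r \<in> ?V'. r < q}"
    proof -
      have "tags ?lb ?row (row q) {r \<in> ?V'. r < q} = tags lb row (row q) {r \<in> ?V'. r < q}"
        by (rule tags_cong) (use V(2) in auto)
      moreover have "(?lb p, lev (?row p - row q)) \<in> tags lb row (row q) {r \<in> ?V'. r < q}" if "p < q"
      proof -
        obtain r where r: "r < p" "L r = Some (g, l)" using l(1) by (auto simp: left_def)
        then have "r \<in> {r \<in> ?V'. r < q}" using that by auto
        then show ?thesis unfolding tags_def using same[OF r(2)] r(1) by (intro image_eqI[of _ _ r]) auto
      qed
      moreover have "{r \<in> ?V. r < q} = (if p < q then insert p {r \<in> ?V'. r < q} else {r \<in> ?V'. r < q})"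
        unfolding V(1) by auto
      ultimately show ?thesis by (auto simp: tags_def split: if_splits)
    qed
    moreover have "tags ?lb ?row (row q) {r \<in> ?V. q < r} = tags lb row (row q) {r \<in> ?V'. q < r}"
    proof -
      have "tags ?lb ?row (row q) {r \<in> ?V'. q < r} = tags lb row (row q) {r \<in> ?V'. q < r}"
        by (rule tags_cong) (use V(2) in auto)
      moreover have "(?lb p, lev (?row p - row q)) \<in> tags lb row (row q) {r \<in> ?V'. q < r}" if "q < p"
      proof -
        obtain r where r: "p < r" "L r = Some (g, l)" using l(2) by (auto simp: right_def)
        then have "r \<in> {r \<in> ?V'. q < r}" using that by auto
        then show ?thesis unfolding tags_def using same[OF r(2)] r(1) by (intro image_eqI[of _ _ r]) auto
      qed
      moreover have "{r \<in> ?V. q < r} = (if q < p then insert p {r \<in> ?V'. q < r} else {r \<in> ?V'. q < r})"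
        unfolding V(1) by auto
      ultimately show ?thesis by (auto simp: tags_def split: if_splits)
    qed
    ultimately show ?thesis using validD(6)[OF v q'] False by simp
  qed
  have "valid u (ph, L, N) ?lb ?row"
  proof (rule validI)
    show "letter (?lb q) = u ! (q - 1) \<and> ?lb q \<in> G" if "q \<in> ?U" for q
      using validD(2)[OF v that] pU that by auto
    show "2 \<le> ?row q" if "q \<in> ?U" "ph = Init" for q using that ph by simp
    show "0 \<le> ?row q" if "q \<in> ?U" for q
      using validD(4)[OF v that] pU that ph by auto
    show "covers ph (left L q) (?lb q) (lev (?row q)) \<and> covers ph (right L q) (?lb q) (lev (?row q))"
      if "q \<in> ?U" for q
      using cov[OF that] by (simp add: ph covers_Chk)
    show "\<exists>r\<in>?V. ?row r = ?row q - 1" if q: "q \<in> ?V" "(if ph = Init then 2 else 1) < ?row q" for q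
    proof -
      have "q \<noteq> p" using q(2) l(3) ph by auto
      then have "q \<in> ?V'" "1 < row q" using q V ph by auto
      then have "\<exists>r\<in>?V'. row r = row q - 1" by (intro validD(7)[OF v]) (simp_all add: ph)
      then obtain r where "r \<in> ?V'" "row r = row q - 1" by blast
      then show ?thesis using V \<open>q \<noteq> p\<close> by (intro bexI[of _ r]) auto
    qed
  qed (use live good in blast)+
  then show ?thesis by blast
qed

lemma covers_Ins_Chk:
  fixes A :: "('g \<times> int) set"
  shows "covers Chk A g l \<Longrightarrow> covers Ins A g l"
  unfolding covers_def merge_def by auto

lemma valid_shift_Ins:
  assumes v: "valid u (Chk, L', N) lb row" and L: "dom L' = dom L"
    "\<And>p t t'. L p = Some t \<Longrightarrow> L' p = Some t' \<Longrightarrow> retag Ins Chk t t'"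
  shows "valid u (Ins, L, N) lb row"
proof -
  have "L p = L' p" for p
  proof (cases "L p")
    case None
    then have "p \<notin> dom L'" using L(1) by auto
    then show ?thesis using None by (metis domIff)
  next
    case (Some t)
    then have "p \<in> dom L'" using L(1) by auto
    then obtain t' where "L' p = Some t'" by blast
    then show ?thesis using L(2)[OF Some] Some by (auto simp: retag_def split: prod.splits)
  qed
  then have "L' = L" by auto
  then have v': "valid u (Chk, L, N) lb row" using v by simp
  show ?thesis
  proof (rule validI)
    show "covers Ins (left L p) (lb p) (lev (row p)) \<and> covers Ins (right L p) (lb p) (lev (row p))"
      if "p \<in> {1..length u} - N" for p
      using validD(5)[OF v' that] covers_Ins_Chk by simp
  qed (use validD[OF v'] in auto)
qed

text \<open>
  Before the shift every row number is larger by one, except that the levels -1 and -2 both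
  become -2, so for live positions below the current row the number is read off the old tag.
\<close>

lemma valid_shift:
  assumes v: "valid u (Ins, L', N) lb row'" and ph: "ph \<noteq> Ins"
    and shift: "shift ph Ins {(left L p, t, right L p) | p t. L p = Some t}"
    and L: "dom L' = dom L"
    "\<And>p t t'. L p = Some t \<Longrightarrow> L' p = Some t' \<Longrightarrow> retag ph Ins t t'"
    and inv: "inv u (ph, L, N)"
  shows "\<exists>row. valid u (ph, L, N) lb row"
proof -
  let ?U = "{1..length u} - N"
  let ?V = "dom L \<union> ?U"
  define row where "row p = (case L p of Some (g, l) \<Rightarrow> if l < 0 then l else row' p + 1 | None \<Rightarrow> row' p + 1)" for p
  have dom: "dom L \<subseteq> N" using inv by (simp add: inv_def)
  have T: "-2 \<le> l \<and> l \<le> 2 \<and> (ph = Init \<longrightarrow> l = 2)" if "L p = Some (g, l)" for p g l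
  proof -
    have "(g, l) \<in> ran L" using that by (auto simp: ran_def)
    then show ?thesis using inv by (force simp: inv_def T_def)
  qed
  have lv: "\<exists>l'. L' p = Some (g, l') \<and> g = lb p \<and> l' = lev (row' p) \<and>
      (if l = 2 then l' = 1 \<or> l' = 2 else l' = max (-2) (l - 1))" if "L p = Some (g, l)" for p g l
  proof -
    obtain t' where t': "L' p = Some t'" using L(1) \<open>L p = Some (g, l)\<close> by blast
    then show ?thesis using L(2)[OF that t'] validD(1)[OF v t'] ph by (cases t') (auto simp: retag_def)
  qed
  have rU: "row p = row' p + 1" if "p \<in> ?U" for p
    using that dom by (auto simp: row_def split: option.splits)
  have neg: "row' p \<le> -2" if "L p = Some (g, l)" "l < 0" for p g l
    using lv[OF that(1)] that(2) T[OF that(1)] by (auto simp: lev_def max_def min_def split: if_splits)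
  have r: "row p = row' p + 1 \<or> row p < 0 \<and> row' p \<le> -2" for p
    using neg[of p] by (auto simp: row_def split: option.splits)
  have live: "t = (lb p, lev (row p))" if p: "L p = Some t" for p t
  proof -
    obtain g l where t: "t = (g, l)" by (cases t)
    note lv = lv[OF p[unfolded t]] and T = T[OF p[unfolded t]]
    have "g = lb p" using lv by auto
    moreover have "l = lev (row p)"
    proof (cases "l < 0")
      case True
      then show ?thesis using T by (auto simp: row_def p t lev_def)
    next
      case False
      then have "row p = row' p + 1" by (simp add: row_def p t)
      moreover have "if l = 2 then lev (row' p) \<in> {1, 2} else lev (row' p) = l - 1"
        using lv T False by (auto simp: max_def split: if_splits)
      ultimately show ?thesis using T False
        by (auto simp: lev_def max_def min_def split: if_splits)
    qed
    ultimately show ?thesis by (simp add: t)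
  qed
  \<comment> \<open>\<open>covers Ins\<close> confuses levels 1 and 2, but before the advance both
    were level 2, so coverage in terms of the old tags is exact.\<close>
  have cov: "(lb p, lev (row p)) \<in> left L p \<and> (lb p, lev (row p)) \<in> right L p" if "p \<in> ?U" for p
  proof -
    have r0: "0 \<le> row' p" using validD(4)[OF v that] by simp
    have *: "L q = Some (lb p, lev (row p))"
      if q: "L' q = Some (lb p, l')" "merge Ins l' = merge Ins (lev (row' p))" for q l'
    proof -
      obtain t where "L q = Some t" using q(1) L(1) by blast
      then obtain g l where gl: "L q = Some (g, l)" by (cases t) auto
      have "g = lb p" "if l = 2 then l' = 1 \<or> l' = 2 else l' = max (-2) (l - 1)" "-2 \<le> l" "l \<le> 2"
        using lv[OF gl] T[OF gl] q(1) by auto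
      moreover have "lev (row p) = l"
        using calculation(2-4) q(2) r0 rU[OF \<open>p \<in> ?U\<close>]
        by (auto simp: lev_def merge_def max_def min_def split: if_splits)
      ultimately show ?thesis using gl by simp
    qed
    have "covers Ins (left L' p) (lb p) (lev (row' p))" "covers Ins (right L' p) (lb p) (lev (row' p))"
      using validD(5)[OF v that] by auto
    then show ?thesis using * unfolding covers_def left_def right_def by blast
  qed
  \<comment> \<open>No position of the old current row is left unread when the sweep
    advances.\<close>
  have U1: "1 \<le> row p" if "p \<in> ?U" for p using validD(4)[OF v that] rU[OF that] by simp
  have U2: "2 \<le> row p" if p: "p \<in> ?U" "ph = Init" for p
  proof -
    obtain q where "L q = Some (lb p, lev (row p))" using cov[OF p(1)] by (auto simp: left_def)
    then have "lev (row p) = 2" using T p(2) by blast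
    then show ?thesis by (auto simp: lev_def)
  qed
  \<comment> \<open>The two numberings differ by a constant except at positions with
    \<open>row q < 0\<close> and \<open>row' q \<le> -2\<close>; seen from \<open>p\<close> these
    are at least two rows below in both numberings.\<close>
  have shifted: "tags lb row (row p) {q \<in> ?V. P q} = tags lb row' (row' p) {q \<in> ?V. P q}"
    if p: "p \<in> ?V" "1 \<le> row p" for p P
  proof (rule tags_cong)
    fix q assume "q \<in> {q \<in> ?V. P q}"
    have rp: "row p = row' p + 1" using r[of p] p(2) by auto
    then show "lb q = lb q \<and> lev (row q - row p) = lev (row' q - row' p)"
      using r[of q] p(2) by (auto simp: lev_def)
  qed
  have good: "ok (tags lb row (row p) {q \<in> ?V. q < p}) (lb p) (tags lb row (row p) {q \<in> ?V. p < q})"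
    if p: "p \<in> ?V" "0 \<le> row p" for p
  proof (cases "1 \<le> row p")
    case True
    then have "0 \<le> row' p" using r[of p] by auto
    then show ?thesis unfolding shifted[OF p(1) True] using validD(6)[OF v, unfolded L(1), OF p(1)] by simp
  next
    case False
    \<comment> \<open>This is the row being left: its remaining positions are live, and
      \<open>shift\<close> itself performed their check.\<close>
    then have r0: "row p = 0" using p(2) by simp
    have "p \<notin> ?U" using U1[of p] r0 by auto
    then obtain t where t: "L p = Some t" using p(1) by auto
    then have t': "t = (lb p, 0)" using live[OF t] r0 by (simp add: lev_def)
    have "ph \<noteq> Init" using T[of p "lb p" 0] t t' by auto
    then have Chk: "ph = Chk" using ph by (cases ph) auto
    have "(left L p, (lb p, 0), right L p) \<in> {(left L p, t, right L p) | p t. L p = Some t}"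
      using t t' by blast
    then have "ok (left L p) (lb p) (right L p)" by (rule shift_ChkD(1)[OF shift[unfolded Chk]])
    then show ?thesis using r0 tags_live[of L lb row ?U p, OF live cov] by simp
  qed
  have con: "\<exists>q\<in>?V. row q = row p - 1" if p: "p \<in> ?V" "(if ph = Init then 2 else 1) < row p" for p
  proof (cases "1 < row' p")
    case True
    then have "\<exists>q\<in>?V. row' q = row' p - 1"
      by (intro validD(7)[OF v, unfolded L(1), OF p(1)]) simp
    then obtain q where q: "q \<in> ?V" "row' q = row' p - 1" by blast
    moreover have "row p = row' p + 1" "row q = row' q + 1" using True q r[of p] r[of q] by auto
    ultimately show ?thesis by (intro bexI[of _ q]) auto
  next
    case False
    then have r2: "row p = 2" "ph \<noteq> Init" using p(2) r[of p] by (auto split: if_splits)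
    then have Chk: "ph = Chk" using ph by (cases ph) auto
    \<comment> \<open>After the advance, validity says nothing about what lies below rows 0 and 1.
      The missing instance of gap-freeness comes from the level test in \<open>shift\<close>, which
      needs a live position of level 2.\<close>
    have "\<exists>q. L q = Some (lb p, 2)"
    proof (cases "p \<in> ?U")
      case True
      then show ?thesis using cov[OF True] r2 by (auto simp: left_def lev_def)
    next
      case False
      then obtain t where "L p = Some t" using p(1) by auto
      then show ?thesis using live[of p t] r2 by (auto simp: lev_def)
    qed
    then obtain q' where "L q' = Some (lb p, 2)" by blast
    then have "(left L q', (lb p, 2), right L q') \<in> {(left L p, t, right L p) | p t. L p = Some t}"
      by blast
    from shift_ChkD(2)[OF shift[unfolded Chk] this] obtain g q where q: "L q = Some (g, 1)" by blast
    then have "lev (row q) = 1" using live by fastforce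
    then have "row q = 1" by (auto simp: lev_def max_def min_def split: if_splits)
    then show ?thesis using q r2 by (intro bexI[of _ q]) auto
  qed
  have "valid u (ph, L, N) lb row"
  proof (rule validI)
    show "covers ph (left L p) (lb p) (lev (row p)) \<and> covers ph (right L p) (lb p) (lev (row p))"
      if "p \<in> ?U" for p
      using cov[OF that] unfolding covers_def by blast
    show "letter (lb p) = u ! (p - 1) \<and> lb p \<in> G" if "p \<in> ?U" for p using validD(2)[OF v that] .
    show "0 \<le> row p" if "p \<in> ?U" for p using U1[OF that] by simp
  qed (use live U2 good con in blast)+
  then show ?thesis by blast
qed

lemma valid_mstep:
  assumes s: "mstep u c c'" and inv: "inv u c" and v: "valid u c' lb row"
  shows "\<exists>lb row. valid u c lb row"
  using s
proof cases
  case (insert p N t L ph)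
  then show ?thesis using valid_insert[of u ph L p t N lb row] v inv by (auto simp: inv_def)
next
  case (delete L p t ph N)
  then show ?thesis using valid_delete[of u ph L p N lb row t] v inv by (auto simp: inv_def)
next
  case (shift ph' ph L L' N)
  have v': "valid u (ph', L', N) lb row" using v shift(2) by simp
  show ?thesis
  proof (cases "ph = Ins")
    case True
    then have "ph' = Chk" using shift(4) by (auto simp: shift_def)
    then show ?thesis using valid_shift_Ins[of u L' N lb row L] v' shift True by blast
  next
    case False
    then have p: "ph' = Ins" using shift(4) by (auto simp: shift_def)
    have "\<exists>row. valid u (ph, L, N) lb row"
    proof (rule valid_shift)
      show "valid u (Ins, L', N) lb row" using v' p by simp
      show "shift ph Ins {(left L p, t, right L p) | p t. L p = Some t}" using shift(4) p by simp
      show "inv u (ph, L, N)" using inv shift(1) by simp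
    qed (use False shift p in auto)
    then show ?thesis using shift(1) by blast
  qed
qed

definition labelled :: "'a list \<Rightarrow> (nat \<Rightarrow> 'g) \<Rightarrow> (nat \<Rightarrow> int) \<Rightarrow> bool" where
  "labelled u lb row \<longleftrightarrow> rows {1..length u} row \<and> (\<forall>p\<in>{1..length u}.
     letter (lb p) = u ! (p - 1) \<and> lb p \<in> G \<and>
     ok (tags lb row (row p) {q \<in> {1..length u}. q < p}) (lb p)
       (tags lb row (row p) {q \<in> {1..length u}. p < q}))"

text \<open>In an accepting configuration with all rows passed, no check is outstanding, so the tags
  themselves serve as labels and rows. Carried back to the initial configuration, where every
  position is unread, validity becomes \<open>labelled\<close>.\<close>

lemma mlang_sound:
  assumes "u \<in> mlang"
  shows "u \<in> lists \<Sigma>" "if u = [] then empty_ok else \<exists>lb row. labelled u lb row"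
proof -
  obtain ph L where u: "u \<in> lists \<Sigma>" and a: "acc ph (ran L)"
    and run: "(mstep u)\<^sup>*\<^sup>* (Init, \<lambda>_. None, {}) (ph, L, {1..length u})"
    using assms unfolding mlang_def by blast
  show "u \<in> lists \<Sigma>" by fact
  have inv0: "inv u (Init, \<lambda>_. None, {})" by (simp add: inv_def ran_def)
  have inv: "inv u (ph, L, {1..length u})"
    using run
  proof (induction rule: rtranclp_induct)
    case base
    show ?case by (rule inv0)
  next
    case (step c c')
    then show ?case using inv_mstep by blast
  qed
  show "if u = [] then empty_ok else \<exists>lb row. labelled u lb row"
  proof (cases "ph = Init")
    case True
    then have "ran L = {}" "empty_ok" using a by (auto simp: acc_def)
    moreover from this have "L p = None" for p by (metis ranI empty_iff not_None_eq)
    then have "dom L = {}" by auto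
    ultimately have "{1..length u} = {}" "empty_ok" using inv True by (auto simp: inv_def)
    then show ?thesis by (cases u) simp_all
  next
    case False
    then have ph: "ph = Ins" "ran L \<noteq> {}" "\<forall>(g, l)\<in>ran L. l < 0" using a by (auto simp: acc_def)
    then have "dom L \<noteq> {}" by (auto simp: ran_def)
    then have "{1..length u} \<noteq> {}" using inv by (auto simp: inv_def)
    then have ne: "u \<noteq> []" by auto
    have neg: "l < 0 \<and> -2 \<le> l" if "L p = Some (g, l)" for p g l
    proof -
      have "(g, l) \<in> ran L" using that by (auto simp: ran_def)
      then show ?thesis using ph(3) inv by (auto simp: inv_def T_def)
    qed
    have "valid u (ph, L, {1..length u}) (\<lambda>p. fst (the (L p))) (\<lambda>p. snd (the (L p)))"
    proof (rule validI)
      show "t = (fst (the (L p)), lev (snd (the (L p))))" if "L p = Some t" for p t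
        using neg[of p "fst t" "snd t"] that by (simp add: lev_def prod_eq_iff)
      have neg': "snd (the (L p)) < 0" if "p \<in> dom L \<union> ({1..length u} - {1..length u})" for p
        using that neg by auto
      show "ok (tags (\<lambda>p. fst (the (L p))) (\<lambda>p. snd (the (L p))) (snd (the (L p)))
             {q \<in> dom L \<union> ({1..length u} - {1..length u}). q < p}) (fst (the (L p)))
           (tags (\<lambda>p. fst (the (L p))) (\<lambda>p. snd (the (L p))) (snd (the (L p)))
             {q \<in> dom L \<union> ({1..length u} - {1..length u}). p < q})"
        if "p \<in> dom L \<union> ({1..length u} - {1..length u})" "0 \<le> snd (the (L p))" for p
        using neg'[OF that(1)] that(2) by linarith
      show "\<exists>q\<in>dom L \<union> ({1..length u} - {1..length u}). snd (the (L q)) = snd (the (L p)) - 1"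
        if "p \<in> dom L \<union> ({1..length u} - {1..length u})" "(if ph = Init then 2 else 1) < snd (the (L p))" for p
        using neg'[OF that(1)] that(2) by (simp split: if_splits)
    qed simp_all
    then have fin: "\<exists>lb row. valid u (ph, L, {1..length u}) lb row" by blast
    have "inv u c \<longrightarrow> (\<exists>lb row. valid u c lb row)" if "(mstep u)\<^sup>*\<^sup>* c (ph, L, {1..length u})" for c
      using that
    proof (induction rule: converse_rtranclp_induct)
      case base
      show ?case using fin by blast
    next
      case (step c c')
      show ?case using step inv_mstep valid_mstep by blast
    qed
    then obtain lb row where v: "valid u (Init, \<lambda>_. None, {}) lb row" using run inv0 by blast
    have "labelled u lb row"
      using validD(2,3,6,7)[OF v] unfolding labelled_def rows_def by fastforce
    then show ?thesis using ne by auto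
  qed
qed

end

section \<open>Completeness\<close>

lemma rows_downward:
  assumes "rows V row" "p \<in> V" "2 \<le> k" "k \<le> row p"
  shows "\<exists>q\<in>V. row q = k"
  using assms(4,3)
proof (induction k rule: int_le_induct)
  case base
  then show ?case using assms(2) by blast
next
  case (step i)
  then obtain q where q: "q \<in> V" "row q = i" by auto
  then have "2 < row q" using step.prems by simp
  then obtain r where "r \<in> V" "row r = row q - 1" using assms(1) q(1) unfolding rows_def by blast
  then show ?case using q(2) by auto
qed

context grid_machine
begin

section \<open>The canonical run of a correctly labelled word\<close>

context
  fixes u :: "'a list" and lb :: "nat \<Rightarrow> 'g" and row :: "nat \<Rightarrow> int"
  assumes lab: "labelled u lb row"
begin

abbreviation V :: "nat set" where
  "V \<equiv> {1..length u}"

abbreviation tg :: "int \<Rightarrow> nat \<Rightarrow> 'g \<times> int" where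
  "tg t p \<equiv> (lb p, lev (row p - t))"

text \<open>The leftmost and the rightmost position of each tag relative to row \<open>t\<close>,
  expressed as the failure to lie strictly between two bearers of the own tag, which is what
  deletion and reading in phase \<open>Chk\<close> require.\<close>

definition ext :: "int \<Rightarrow> nat set" where
  "ext t = {p \<in> V. \<not> ((\<exists>q\<in>V. q < p \<and> tg t q = tg t p) \<and> (\<exists>q\<in>V. p < q \<and> tg t q = tg t p))}"

definition live :: "int \<Rightarrow> nat set \<Rightarrow> nat \<Rightarrow> ('g \<times> int) option" where
  "live t S p = (if p \<in> S then Some (tg t p) else None)"

lemma dom_live [simp]: "dom (live t S) = S"
  by (auto simp: live_def split: if_splits)

lemma left_live: "left (live t S) p = tags lb row t {q \<in> S. q < p}"
  by (auto simp: left_def live_def tags_def split: if_splits)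

lemma right_live: "right (live t S) p = tags lb row t {q \<in> S. p < q}"
  by (auto simp: right_def live_def tags_def split: if_splits)

lemma contexts_live:
  "{(left (live t S) p, s, right (live t S) p) | p s. live t S p = Some s} =
   {(tags lb row t {q \<in> S. q < p}, tg t p, tags lb row t {q \<in> S. p < q}) | p. p \<in> S}"
  unfolding left_live right_live by (auto simp: live_def split: if_splits)

lemma ran_live: "ran (live t S) = tg t ` S"
  by (auto simp: ran_def live_def)

lemma live_insert: "live t (insert p S) = (live t S)(p \<mapsto> tg t p)"
  by (auto simp: live_def fun_eq_iff)

lemma live_delete: "p \<notin> S \<Longrightarrow> live t S = (live t (insert p S))(p := None)"
  by (auto simp: live_def fun_eq_iff)

lemma V_facts:
  assumes "p \<in> V"
  shows "2 \<le> row p" "letter (lb p) = u ! (p - 1)" "lb p \<in> G" "tg t p \<in> T"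
    "ok (tags lb row (row p) {q \<in> V. q < p}) (lb p) (tags lb row (row p) {q \<in> V. p < q})"
  using lab assms by (auto simp: labelled_def rows_def T_def lev_def)

lemma ext_subset: "ext t \<subseteq> V"
  by (auto simp: ext_def)

lemma ext_min_max:
  assumes "p \<in> V"
  shows "Min {q \<in> V. tg t q = tg t p} \<in> ext t" "tg t (Min {q \<in> V. tg t q = tg t p}) = tg t p"
    "Min {q \<in> V. tg t q = tg t p} \<le> p"
    "Max {q \<in> V. tg t q = tg t p} \<in> ext t" "tg t (Max {q \<in> V. tg t q = tg t p}) = tg t p"
    "p \<le> Max {q \<in> V. tg t q = tg t p}"
proof -
  let ?C = "{q \<in> V. tg t q = tg t p}"
  have C: "finite ?C" "p \<in> ?C" using assms by auto
  then have m: "Min ?C \<in> ?C" "Max ?C \<in> ?C" using Min_in[of ?C] Max_in[of ?C] by blast+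
  have "\<not> q < Min ?C" if "q \<in> V" "tg t q = tg t (Min ?C)" for q
  proof -
    have "q \<in> ?C" using that m(1) by simp
    from Min_le[OF C(1) this] show ?thesis by (rule leD)
  qed
  then show "Min ?C \<in> ext t" using m(1) unfolding ext_def by blast
  have "\<not> Max ?C < q" if "q \<in> V" "tg t q = tg t (Max ?C)" for q
  proof -
    have "q \<in> ?C" using that m(2) by simp
    from Max_ge[OF C(1) this] show ?thesis by (rule leD)
  qed
  then show "Max ?C \<in> ext t" using m(2) unfolding ext_def by blast
  show "tg t (Min ?C) = tg t p" "tg t (Max ?C) = tg t p" using m by simp_all
  show "Min ?C \<le> p" "p \<le> Max ?C" using C by simp_all
qed

lemma ext_covers:
  assumes "p \<in> V" "p \<notin> ext t"
  shows "\<exists>q\<in>ext t. q < p \<and> tg t q = tg t p" "\<exists>q\<in>ext t. p < q \<and> tg t q = tg t p"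
proof -
  let ?C = "{q \<in> V. tg t q = tg t p}"
  note m = ext_min_max[OF assms(1), of t]
  have "Min ?C \<noteq> p" "Max ?C \<noteq> p" using m(1,4) assms(2) by metis+
  then have "Min ?C < p" "p < Max ?C" using m(3,6) by linarith+
  then show "\<exists>q\<in>ext t. q < p \<and> tg t q = tg t p" "\<exists>q\<in>ext t. p < q \<and> tg t q = tg t p"
    using m(1,2,4,5) by blast+
qed

text \<open>A tag occurs to the left of \<open>p\<close> iff its leftmost bearer lies there, and
  dually on the right, so the extrema alone produce the full contexts.\<close>

lemma tags_ext:
  assumes "ext t \<subseteq> S" "S \<subseteq> V"
  shows "tags lb row t {q \<in> S. q < p} = tags lb row t {q \<in> V. q < p}"
    "tags lb row t {q \<in> S. p < q} = tags lb row t {q \<in> V. p < q}"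
proof -
  have "tg t q \<in> tg t ` {r \<in> S. r < p}" if q: "q \<in> V" "q < p" for q
  proof -
    note m = ext_min_max(1-3)[OF q(1), of t]
    have "Min {r \<in> V. tg t r = tg t q} < p" using m(3) q(2) by (rule order_le_less_trans)
    with subsetD[OF assms(1) m(1)] have "Min {r \<in> V. tg t r = tg t q} \<in> {r \<in> S. r < p}"
      by (intro CollectI conjI)
    then show ?thesis
      by (rule image_eqI[where f = "tg t" and x = "Min {r \<in> V. tg t r = tg t q}", OF m(2)[symmetric]])
  qed
  then have "tg t ` {q \<in> V. q < p} \<subseteq> tg t ` {r \<in> S. r < p}" by (intro image_subsetI) simp
  moreover have "tg t ` {r \<in> S. r < p} \<subseteq> tg t ` {q \<in> V. q < p}"
    using assms(2) by (intro image_mono) auto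
  ultimately show "tags lb row t {q \<in> S. q < p} = tags lb row t {q \<in> V. q < p}"
    unfolding tags_def by (rule subset_antisym[rotated])
  have "tg t q \<in> tg t ` {r \<in> S. p < r}" if q: "q \<in> V" "p < q" for q
  proof -
    note m = ext_min_max(4-6)[OF q(1), of t]
    have "p < Max {r \<in> V. tg t r = tg t q}" using q(2) m(3) by (rule order_less_le_trans)
    with subsetD[OF assms(1) m(1)] have "Max {r \<in> V. tg t r = tg t q} \<in> {r \<in> S. p < r}"
      by (intro CollectI conjI)
    then show ?thesis
      by (rule image_eqI[where f = "tg t" and x = "Max {r \<in> V. tg t r = tg t q}", OF m(2)[symmetric]])
  qed
  then have "tg t ` {q \<in> V. p < q} \<subseteq> tg t ` {r \<in> S. p < r}" by (intro image_subsetI) simp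
  moreover have "tg t ` {r \<in> S. p < r} \<subseteq> tg t ` {q \<in> V. p < q}"
    using assms(2) by (intro image_mono) auto
  ultimately show "tags lb row t {q \<in> S. p < q} = tags lb row t {q \<in> V. p < q}"
    unfolding tags_def by (rule subset_antisym[rotated])
qed

lemma card_ext: "card (ext t) \<le> 10 * card G"
proof -
  let ?m = "\<lambda>s. Min {q \<in> V. tg t q = s}" and ?M = "\<lambda>s. Max {q \<in> V. tg t q = s}"
  have "p \<in> ?m ` T \<union> ?M ` T" if p: "p \<in> ext t" for p
  proof -
    have pV: "p \<in> V" using p ext_subset by blast
    note m = ext_min_max[OF pV, of t]
    have "?m (tg t p) \<in> V" "?M (tg t p) \<in> V" using m(1,4) ext_subset by blast+
    then have "p = ?m (tg t p) \<or> p = ?M (tg t p)"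
      using p m(2,3,5,6) unfolding ext_def by (metis (mono_tags, lifting) mem_Collect_eq order_le_less)
    then show ?thesis using V_facts(4)[OF pV, of t] by blast
  qed
  then have "card (ext t) \<le> card (?m ` T \<union> ?M ` T)"
    by (intro card_mono) (auto simp: finite_tags)
  also have "\<dots> \<le> card (?m ` T) + card (?M ` T)" by (rule card_Un_le)
  also have "\<dots> \<le> card T + card T" by (intro add_mono card_image_le finite_tags)
  also have "card T = card G * 5" by (simp add: T_def card_cartesian_product)
  finally show ?thesis by simp
qed

abbreviation run :: "(phase, 'g \<times> int) mconfig \<Rightarrow> (phase, 'g \<times> int) mconfig \<Rightarrow> bool" where
  "run \<equiv> (mstep u)\<^sup>*\<^sup>*"

lemma run_insert:
  assumes "finite X" "X \<subseteq> V - N" "finite S" "card (S \<union> X) \<le> 20 * card G + 2"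
    "X \<inter> S = {}"
    "\<And>p S'. p \<in> X \<Longrightarrow> S \<subseteq> S' \<Longrightarrow>
       ins ph (tags lb row t {q \<in> S'. q < p}) (tg t p) (tags lb row t {q \<in> S'. p < q}) (u ! (p - 1))"
  shows "run (ph, live t S, N) (ph, live t (S \<union> X), N \<union> X)"
  using assms(1,2,4-)
proof (induction X rule: finite_induct)
  case (insert p X)
  have fin: "finite (S \<union> X)" using assms(3) insert.hyps by simp
  have c: "card (S \<union> insert p X) = Suc (card (S \<union> X))"
    using insert.hyps insert.prems(3) fin by simp
  have "run (ph, live t S, N) (ph, live t (S \<union> X), N \<union> X)"
    using insert.prems c by (intro insert.IH) auto
  also have "mstep u (ph, live t (S \<union> X), N \<union> X)
      (ph, (live t (S \<union> X))(p \<mapsto> tg t p), N \<union> X \<union> {p})"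
  proof (rule mstep.insert)
    show "p \<in> {1..length u} - (N \<union> X)" using insert.prems(1) insert.hyps(2) by auto
    then show "tg t p \<in> T" using V_facts(4) by blast
    show "card (dom (live t (S \<union> X))) < 20 * card G + 2" using insert.prems(2) c by simp
    show "ins ph (left (live t (S \<union> X)) p) (tg t p) (right (live t (S \<union> X)) p) (u ! (p - 1))"
      unfolding left_live right_live using insert.prems(4)[of p "S \<union> X"] by simp
  qed
  also have "(live t (S \<union> X))(p \<mapsto> tg t p) = live t (S \<union> insert p X)"
    using live_insert[of t p "S \<union> X"] by simp
  also have "N \<union> X \<union> {p} = N \<union> insert p X" by simp
  finally show ?case .
qed simp

text \<open>The equation is kept as a premise so that a covering position \<open>q\<close> can be
  used to exhibit the tag of the position that it covers.\<close>

lemma tags_mem: "q \<in> S \<Longrightarrow> tg t q = s \<Longrightarrow> s \<in> tags lb row t S"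
  by (auto simp: tags_def)

text \<open>The covering positions are taken from \<open>S\<close>, which is never touched, so the
  order of deletion is irrelevant; \<open>row p < t\<close> gives a negative level.\<close>

lemma run_delete:
  assumes "finite X" "X \<inter> S = {}"
    "\<And>p. p \<in> X \<Longrightarrow> row p < t \<and> (\<exists>q\<in>S. q < p \<and> tg t q = tg t p) \<and> (\<exists>q\<in>S. p < q \<and> tg t q = tg t p)"
  shows "run (Chk, live t (S \<union> X), N) (Chk, live t S, N)"
  using assms
proof (induction X rule: finite_induct)
  case (insert p X)
  have p: "p \<notin> S \<union> X" using insert by auto
  let ?L = "live t (insert p (S \<union> X))"
  obtain q q' where q: "q \<in> S" "q < p" "tg t q = tg t p" "q' \<in> S" "p < q'" "tg t q' = tg t p"
    using insert.prems(2)[of p] by blast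
  have "mstep u (Chk, ?L, N) (Chk, ?L(p := None), N)"
  proof (rule mstep.delete)
    show "?L p = Some (tg t p)" by (simp add: live_def)
    have "tg t p \<in> left ?L p" unfolding left_live by (rule tags_mem[OF _ q(3)]) (use q in auto)
    moreover have "tg t p \<in> right ?L p" unfolding right_live by (rule tags_mem[OF _ q(6)]) (use q in auto)
    moreover have "lev (row p - t) < 0" using insert.prems(2)[of p] by (auto simp: lev_def)
    ultimately show "del Chk (left ?L p) (tg t p) (right ?L p)" by (simp add: del_def)
  qed
  also have "?L(p := None) = live t (S \<union> X)" using live_delete[OF p] by simp
  also have "run (Chk, live t (S \<union> X), N) (Chk, live t S, N)"
    using insert.prems by (intro insert.IH) auto
  finally show ?case by simp
qed simp

text \<open>Each position is deleted right after it is read, so at most one position beyond the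
  extrema is live, and at the check the contexts are those of the whole word.\<close>

lemma run_check:
  assumes "finite X" "X \<subseteq> V - N" "X \<inter> ext t = {}" "\<And>p. p \<in> X \<Longrightarrow> row p = t"
  shows "run (Chk, live t (ext t), N) (Chk, live t (ext t), N \<union> X)"
  using assms
proof (induction X rule: finite_induct)
  case (insert p X)
  let ?E = "ext t"
  let ?L = "live t (insert p ?E)"
  have p: "p \<in> V" "p \<notin> ?E" "p \<notin> N \<union> X" "row p = t" using insert by auto
  then have l0: "tg t p = (lb p, 0)" by (simp add: lev_def)
  obtain q q' where q: "q \<in> ?E" "q < p" "tg t q = tg t p" "q' \<in> ?E" "p < q'" "tg t q' = tg t p"
    using ext_covers[OF p(1,2)] by blast
  have cov: "tg t p \<in> tags lb row t {q \<in> S. q < p}" "tg t p \<in> tags lb row t {q \<in> S. p < q}"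
    if "?E \<subseteq> S" for S
  proof -
    show "tg t p \<in> tags lb row t {q \<in> S. q < p}" by (rule tags_mem[OF _ q(3)]) (use q that in auto)
    show "tg t p \<in> tags lb row t {q \<in> S. p < q}" by (rule tags_mem[OF _ q(6)]) (use q that in auto)
  qed
  have E: "?E \<subseteq> insert p ?E" "insert p ?E \<subseteq> V" using p(1) ext_subset[of t] by blast+
  have r0: "run (Chk, live t ?E, N) (Chk, live t ?E, N \<union> X)"
    using insert.prems by (intro insert.IH) auto
  have "mstep u (Chk, live t ?E, N \<union> X) (Chk, (live t ?E)(p \<mapsto> tg t p), N \<union> X \<union> {p})"
  proof (rule mstep.insert)
    show "p \<in> {1..length u} - (N \<union> X)" using p by blast
    show "tg t p \<in> T" using V_facts(4)[OF p(1)] .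
    show "card (dom (live t ?E)) < 20 * card G + 2" using card_ext[of t] by simp
    show "ins Chk (left (live t ?E) p) (tg t p) (right (live t ?E) p) (u ! (p - 1))"
      unfolding left_live right_live
      using cov[of ?E] V_facts(2)[OF p(1)] by (simp add: ins_def covers_Chk l0)
  qed
  then have r1: "mstep u (Chk, live t ?E, N \<union> X) (Chk, ?L, N \<union> X \<union> {p})"
    by (simp only: live_insert)
  have "mstep u (Chk, ?L, N \<union> X \<union> {p}) (Chk, ?L(p := None), N \<union> X \<union> {p})"
  proof (rule mstep.delete)
    show "?L p = Some (tg t p)" by (simp add: live_def)
    have "ok (left ?L p) (lb p) (right ?L p)"
      unfolding left_live right_live tags_ext[OF E] using V_facts(5)[OF p(1)] p(4) by simp
    then show "del Chk (left ?L p) (tg t p) (right ?L p)"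
      using cov[OF E(1)] unfolding l0 left_live right_live by (simp add: del_def)
  qed
  then have "mstep u (Chk, ?L, N \<union> X \<union> {p}) (Chk, live t ?E, N \<union> X \<union> {p})"
    by (simp only: live_delete[OF p(2), symmetric])
  with r0 r1 have "run (Chk, live t ?E, N) (Chk, live t ?E, N \<union> X \<union> {p})"
    by (meson rtranclp.rtrancl_into_rtrancl)
  then show ?case by simp
qed simp

text \<open>Above row \<open>t\<close> the advance only refines tag classes, because level 2 splits,
  and an extremum of a class is one of every subclass containing it.\<close>

lemma ext_step:
  assumes "p \<in> ext t" "t < row p"
  shows "p \<in> ext (t + 1)"
proof -
  have "tg t q = tg t p" if "tg (t + 1) q = tg (t + 1) p" for q
    using that assms(2) by (auto simp: lev_def max_def min_def split: if_splits)
  then show ?thesis using assms(1) unfolding ext_def by blast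
qed

text \<open>Up to row \<open>t + 1\<close> the advance only merges tag classes, because -1 and -2
  become one, and an extremum of the merged class was one of its own class before.\<close>

lemma ext_step_back:
  assumes "p \<in> ext (t + 1)" "row p \<le> t + 1"
  shows "p \<in> ext t"
proof -
  have "tg (t + 1) q = tg (t + 1) p" if "tg t q = tg t p" for q
    using that assms(2) by (auto simp: lev_def max_def min_def split: if_splits)
  then show ?thesis using assms(1) unfolding ext_def by blast
qed

lemma mstep_shift_live:
  assumes "shift ph ph' {(tags lb row t {q \<in> S. q < p}, tg t p, tags lb row t {q \<in> S. p < q}) | p. p \<in> S}"
    "S \<subseteq> V" "\<And>p. p \<in> S \<Longrightarrow> retag ph ph' (tg t p) (tg t' p)"
  shows "mstep u (ph, live t S, N) (ph', live t' S, N)"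
proof (rule mstep.shift)
  show "shift ph ph' {(left (live t S) p, s, right (live t S) p) | p s. live t S p = Some s}"
    unfolding contexts_live by (rule assms(1))
  show "ran (live t' S) \<subseteq> T" unfolding ran_live using assms(2) V_facts(4) by blast
  show "retag ph ph' s s'" if "live t S p = Some s" "live t' S p = Some s'" for p s s'
    using assms(3)[of p] that by (auto simp: live_def split: if_splits)
qed simp_all

text \<open>
  The configuration after rows up to \<open>t\<close> have been processed.  The live tags already
  refer to row \<open>t + 1\<close>, while the live positions are still the extrema with respect to \<open>t\<close>.
\<close>

definition stage :: "int \<Rightarrow> (phase, 'g \<times> int) mconfig" where
  "stage t = (Ins, live (t + 1) (ext t), {p \<in> V. row p \<le> t} \<union> ext t)"

text \<open>Relative to row 0 every level is 2, so \<open>Init\<close> reads all of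
  \<open>ext 0\<close>. The advance to the empty row 1 then allows retagging to separate the bottom
  row 2 from the rows above it.\<close>

lemma run_start: "run (Init, \<lambda>_. None, {}) (stage 0)"
proof -
  have l2: "tg 0 p = (lb p, 2)" if "p \<in> V" for p using V_facts(1)[OF that] by (simp add: lev_def)
  have e: "live 0 {} = (\<lambda>_. None)" by (simp add: live_def fun_eq_iff)
  have r0: "run (Init, live 0 {}, {}) (Init, live 0 ({} \<union> ext 0), {} \<union> ext 0)"
  proof (rule run_insert)
    show "finite (ext 0)" using ext_subset finite_subset by blast
    show "ext 0 \<subseteq> V - {}" using ext_subset by simp
    show "card ({} \<union> ext 0) \<le> 20 * card G + 2" using card_ext[of 0] by simp
    fix p S' assume "p \<in> ext 0"
    then have "p \<in> V" using ext_subset by blast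
    then show "ins Init (tags lb row 0 {q \<in> S'. q < p}) (tg 0 p) (tags lb row 0 {q \<in> S'. p < q}) (u ! (p - 1))"
      unfolding l2[OF \<open>p \<in> V\<close>] using V_facts(2) by (simp add: ins_def)
  qed auto
  have r1: "mstep u (Init, live 0 ({} \<union> ext 0), {} \<union> ext 0) (Ins, live 1 ({} \<union> ext 0), {} \<union> ext 0)"
  proof (rule mstep_shift_live)
    show "{} \<union> ext 0 \<subseteq> V" using ext_subset[of 0] by blast
    fix p assume "p \<in> {} \<union> ext 0"
    then have "2 \<le> row p" using V_facts(1) ext_subset by blast
    then show "retag Init Ins (tg 0 p) (tg 1 p)" by (auto simp: retag_def lev_def)
  qed (simp_all add: shift_def)
  have "\<not> row p \<le> 0" if "p \<in> V" for p using V_facts(1)[OF that] by simp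
  then have z: "{p \<in> V. row p \<le> 0} = {}" by blast
  have s: "stage 0 = (Ins, live 1 ({} \<union> ext 0), {} \<union> ext 0)" unfolding stage_def z by simp
  define c where "c = (Init, live 0 ({} \<union> ext 0), {} \<union> ext 0)"
  have "run (Init, \<lambda>_. None, {}) c" using r0 unfolding c_def e .
  moreover have "mstep u c (stage 0)" unfolding c_def s by (rule r1)
  ultimately show ?thesis by (rule rtranclp.rtrancl_into_rtrancl)
qed

text \<open>New extrema have to be read while the old ones still cover them, and old ones may be
  dropped only when the new ones cover them. So the extrema for two consecutive rows are live
  together, which accounts for twice the bound of \<open>card_ext\<close>.\<close>

lemma run_stage:
  assumes "0 \<le> t"
  shows "run (stage t) (stage (t + 1))"
proof -
  let ?E = "ext t" and ?F = "ext (t + 1)" and ?s = "t + 1"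
  let ?R = "{p \<in> V. row p \<le> t}"
  define N where "N = ?R \<union> ?E"
  have fin: "finite ?E" "finite ?F" using ext_subset finite_subset by blast+
  define X where "X = ?F - N"
  have EX: "card (?E \<union> X) \<le> 20 * card G + 2"
  proof -
    have "card (?E \<union> X) \<le> card ?E + card X" by (rule card_Un_le)
    also have "card X \<le> card ?F" unfolding X_def using fin by (intro card_mono) auto
    finally show ?thesis using card_ext[of t] card_ext[of ?s] by simp
  qed
  have s0: "stage t = (Ins, live ?s ?E, N)" by (simp add: stage_def N_def)
  have r1: "run (Ins, live ?s ?E, N) (Ins, live ?s (?E \<union> X), N \<union> X)"
  proof (rule run_insert)
    show "finite X" using fin by (simp add: X_def)
    show "X \<subseteq> V - N" using ext_subset[of ?s] unfolding X_def by blast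
    show "X \<inter> ?E = {}" by (auto simp: X_def N_def)
    fix p S' assume p: "p \<in> X" and S': "?E \<subseteq> S'"
    have "p \<in> ?F" "p \<notin> N" using p by (simp_all add: X_def)
    moreover from this have pV: "p \<in> V" using ext_subset by blast
    ultimately have "p \<in> ?F" "p \<notin> ?E" "t < row p" by (auto simp: N_def)
    \<comment> \<open>New extrema come only from the splitting of level 2, so their levels relative
      to row \<open>t + 1\<close> are 1 or 2, the two that phase \<open>Ins\<close> merges.\<close>
    then have r: "t + 2 \<le> row p" using ext_step_back[of p t] by force
    obtain q q' where q: "q \<in> ?E" "q < p" "tg t q = tg t p" "q' \<in> ?E" "p < q'" "tg t q' = tg t p"
      using ext_covers[OF pV \<open>p \<notin> ?E\<close>] by blast
    have m: "lb z = lb p \<and> merge Ins (lev (row z - ?s)) = merge Ins (lev (row p - ?s))"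
      if "tg t z = tg t p" for z
      using that r by (auto simp: lev_def merge_def max_def min_def split: if_splits)
    have "covers Ins (tags lb row ?s {q \<in> S'. q < p}) (lb p) (lev (row p - ?s))"
    proof -
      have "(lb p, lev (row q - ?s)) \<in> tags lb row ?s {q \<in> S'. q < p}"
        by (rule tags_mem[of q]) (use q(1,2) S' m[OF q(3)] in auto)
      then show ?thesis using m[OF q(3)] unfolding covers_def by blast
    qed
    moreover have "covers Ins (tags lb row ?s {q \<in> S'. p < q}) (lb p) (lev (row p - ?s))"
    proof -
      have "(lb p, lev (row q' - ?s)) \<in> tags lb row ?s {q \<in> S'. p < q}"
        by (rule tags_mem[of q']) (use q(4,5) S' m[OF q(6)] in auto)
      then show ?thesis using m[OF q(6)] unfolding covers_def by blast
    qed
    moreover have "1 \<le> lev (row p - ?s)" using r by (simp add: lev_def)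
    ultimately show "ins Ins (tags lb row ?s {q \<in> S'. q < p}) (tg ?s p) (tags lb row ?s {q \<in> S'. p < q})
        (u ! (p - 1))"
      using V_facts(2)[OF pV] by (simp add: ins_def)
  qed (rule fin EX)+
  have r2: "mstep u (Ins, live ?s (?E \<union> X), N \<union> X) (Chk, live ?s (?E \<union> X), N \<union> X)"
  proof (rule mstep_shift_live)
    show "?E \<union> X \<subseteq> V" using ext_subset[of t] ext_subset[of ?s] unfolding X_def by blast
    show "retag Ins Chk (tg ?s p) (tg ?s p)" for p by (simp add: retag_def)
  qed (simp add: shift_def)
  have r3: "run (Chk, live ?s (?E \<union> X), N \<union> X) (Chk, live ?s ?F, N \<union> X)"
  proof -
    have "p \<in> ?E \<union> X" if "p \<in> ?F" for p
      using that ext_step_back[OF that] unfolding X_def N_def by auto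
    moreover have "X \<subseteq> ?F" unfolding X_def by blast
    ultimately have "?E \<union> X = ?F \<union> (?E - ?F)" by blast
    moreover have "run (Chk, live ?s (?F \<union> (?E - ?F)), N \<union> X) (Chk, live ?s ?F, N \<union> X)"
    proof (rule run_delete)
      fix p assume p: "p \<in> ?E - ?F"
      then have "p \<in> V" "p \<notin> ?F" using ext_subset[of t] by blast+
      moreover have "\<not> t < row p" using ext_step[of p t] p by blast
      ultimately show "row p < ?s \<and> (\<exists>q\<in>?F. q < p \<and> tg ?s q = tg ?s p) \<and>
          (\<exists>q\<in>?F. p < q \<and> tg ?s q = tg ?s p)"
        by (intro conjI ext_covers) simp_all
    next
      show "finite (?E - ?F)" "(?E - ?F) \<inter> ?F = {}" using fin by blast+
    qed
    ultimately show ?thesis by simp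
  qed
  have r4: "run (Chk, live ?s ?F, N \<union> X) (Chk, live ?s ?F, N \<union> X \<union> ({p \<in> V. row p = ?s} - ?F))"
  proof (rule run_check)
    have "p \<notin> N" if "row p = ?s" "p \<notin> ?F" for p
      using that ext_step[of p t] by (auto simp: N_def)
    then show "{p \<in> V. row p = ?s} - ?F \<subseteq> V - (N \<union> X)" by (auto simp: X_def)
  qed auto
  have N': "N \<union> X \<union> ({p \<in> V. row p = ?s} - ?F) = {p \<in> V. row p \<le> ?s} \<union> ?F" (is "?N = ?N'")
  proof
    have "p \<in> ?R \<union> ?F" if "p \<in> ?E" for p
    proof (cases "row p \<le> t")
      case True
      then show ?thesis using that ext_subset[of t] by blast
    next
      case False
      then show ?thesis using ext_step[OF that] by simp
    qed
    moreover have "?R \<subseteq> ?N'" by auto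
    ultimately show "?N \<subseteq> ?N'" unfolding N_def X_def by auto
    show "?N' \<subseteq> ?N" unfolding N_def X_def by auto
  qed
  have r5: "mstep u (Chk, live ?s ?F, ?N') (Ins, live (?s + 1) ?F, ?N')"
  proof (rule mstep_shift_live)
    let ?X = "{(tags lb row ?s {q \<in> ?F. q < p}, tg ?s p, tags lb row ?s {q \<in> ?F. p < q}) | p. p \<in> ?F}"
    have "ok A g B" if X: "(A, (g, 0), B) \<in> ?X" for A g B
    proof -
      obtain p where p: "p \<in> ?F" "A = tags lb row ?s {q \<in> ?F. q < p}" "g = lb p"
        "B = tags lb row ?s {q \<in> ?F. p < q}" "lev (row p - ?s) = 0"
        using X by auto
      have "p \<in> V" using p(1) ext_subset by blast
      moreover have "row p = ?s" using p(5) by (auto simp: lev_def max_def min_def split: if_splits)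
      ultimately show ?thesis
        using V_facts(5)[of p] unfolding p(2-4) tags_ext[OF order_refl ext_subset] by simp
    qed
    \<comment> \<open>Rows have no gaps, so row \<open>t + 2\<close> is inhabited below any higher
      one; its element need not be live, but the leftmost bearer of its tag is.\<close>
    moreover have "\<exists>A g B. (A, (g, 1), B) \<in> ?X" if X: "(A, (g, 2), B) \<in> ?X" for A g B
    proof -
      obtain p where p: "p \<in> ?F" "lev (row p - ?s) = 2" using X by auto
      have "p \<in> V" using p(1) ext_subset by blast
      moreover have "?s + 1 \<le> row p"
        using p(2) by (auto simp: lev_def max_def min_def split: if_splits)
      ultimately obtain q where q: "q \<in> V" "row q = ?s + 1"
        using lab rows_downward[of V row p "?s + 1"] assms by (auto simp: labelled_def)
      obtain r where "r \<in> ?F" "tg ?s r = tg ?s q" using ext_min_max(1,2)[OF q(1), of ?s] by blast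
      moreover have "tg ?s q = (lb q, 1)" using q(2) by (simp add: lev_def)
      ultimately have "r \<in> ?F" "tg ?s r = (lb q, 1)" by simp_all
      then have "(tags lb row ?s {q \<in> ?F. q < r}, (lb q, 1), tags lb row ?s {q \<in> ?F. r < q}) \<in> ?X"
        by (intro CollectI exI[of _ r]) simp
      then show ?thesis by (intro exI)
    qed
    ultimately show "shift Chk Ins ?X" by (rule shift_ChkI)
    show "retag Chk Ins (tg ?s p) (tg (?s + 1) p)" for p
      by (auto simp: retag_def lev_def max_def min_def)
  qed (rule ext_subset)
  define c1 c2 c3 c4 where "c1 = (Ins, live ?s (?E \<union> X), N \<union> X)"
    and "c2 = (Chk, live ?s (?E \<union> X), N \<union> X)" and "c3 = (Chk, live ?s ?F, N \<union> X)"
    and "c4 = (Chk, live ?s ?F, ?N')"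
  note c = c1_def c2_def c3_def c4_def
  have "run (stage t) c1" unfolding c s0 by (rule r1)
  moreover have "mstep u c1 c2" unfolding c by (rule r2)
  moreover have "run c2 c3" unfolding c by (rule r3)
  moreover have "run c3 c4" unfolding c N'[symmetric] by (rule r4)
  moreover have "mstep u c4 (stage ?s)" unfolding c stage_def by (rule r5)
  ultimately show ?thesis by (meson rtranclp.rtrancl_into_rtrancl rtranclp_trans)
qed

lemma mlang_complete:
  assumes "u \<noteq> []" "u \<in> lists \<Sigma>"
  shows "u \<in> mlang"
proof -
  have *: "run (stage 0) (stage (int k))" for k
  proof (induction k)
    case (Suc k)
    then show ?case using run_stage[of "int k"] by (simp add: add.commute)
  qed simp
  \<comment> \<open>After the topmost row every position is read, and since a stage already carries
    tags for the next row, all live levels are negative.\<close>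
  define k where "k = nat (Max (row ` V))"
  have k: "row p \<le> int k" if "p \<in> V" for p
  proof -
    have "row p \<le> Max (row ` V)" using that by (intro Max_ge) auto
    then show ?thesis by (simp add: k_def)
  qed
  have N: "{p \<in> V. row p \<le> int k} \<union> ext (int k) = V" using k ext_subset by blast
  have one: "1 \<in> V" using assms(1) by (cases u) auto
  have "ext (int k) \<noteq> {}" using ext_min_max(1)[OF one] by blast
  moreover have "l < 0" if gl: "(g, l) \<in> tg (int k + 1) ` ext (int k)" for g l
  proof -
    obtain p where "p \<in> ext (int k)" "l = lev (row p - (int k + 1))" using gl by auto
    moreover from this have "row p \<le> int k" using k ext_subset by blast
    ultimately show ?thesis by (simp add: lev_def)
  qed
  ultimately have "acc Ins (ran (live (int k + 1) (ext (int k))))" unfolding ran_live acc_def by auto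
  moreover have "run (Init, \<lambda>_. None, {}) (Ins, live (int k + 1) (ext (int k)), V)"
    using rtranclp_trans[OF run_start *[of k]] N by (simp add: stage_def)
  ultimately show ?thesis using assms(2) unfolding mlang_def by blast
qed

end

section \<open>The machine language and the language of the sentence\<close>

lemma mlang_iff:
  "u \<in> mlang \<longleftrightarrow> u \<in> lists \<Sigma> \<and> (if u = [] then empty_ok else \<exists>lb row. labelled u lb row)"
proof (cases "u = []")
  case True
  have "[] \<in> mlang" if empty_ok
  proof -
    have "acc Init (ran (\<lambda>_. None))" unfolding acc_def using that by simp
    moreover have "{1..length []} = ({} :: nat set)" by simp
    ultimately show ?thesis unfolding mlang_def by (force intro: rtranclp.rtrancl_refl)
  qed
  then show ?thesis using True mlang_sound[of u] by auto
next
  case False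
  then show ?thesis using mlang_sound[of u] mlang_complete[of u] by auto
qed

end

lemma lang_fo2_iff:
  assumes "sentence_over \<Sigma> \<psi>"
  shows "u \<in> lang_fo2 \<Sigma> \<psi> \<longleftrightarrow> u \<in> lists \<Sigma> \<and>
    (if u = [] then models (grid [] (\<lambda>_. 0)) \<psi> else \<exists>lb row. good_labelling \<psi> u lb row)"
proof (cases "u = []")
  case True
  have "models (grid [] row) \<psi> \<longleftrightarrow> models (grid [] (\<lambda>_. 0)) \<psi>" for row
    by (simp add: grid_def)
  then have "(\<exists>row. models (grid [] row) \<psi>) \<longleftrightarrow> models (grid [] (\<lambda>_. 0)) \<psi>" by blast
  moreover have "rows {1..length ([] :: 'a list)} row" for row by (simp add: rows_def)
  ultimately show ?thesis using lang_fo2_grid[OF assms, of u] True by simp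
next
  case False
  have "fv \<psi> = {}" using assms by (simp add: sentence_over_def)
  then have "rows {1..length u} row \<and> models (grid u row) \<psi> \<longleftrightarrow> (\<exists>lb. good_labelling \<psi> u lb row)" for row
    using models_iff_good_labelling[OF _ False] by (auto simp: good_labelling_def)
  then show ?thesis using lang_fo2_grid[OF assms, of u] False by auto
qed

theorem theorem3:
  fixes \<Sigma> :: "'a set" and \<psi> :: "'a fo2"
  assumes "finite \<Sigma>" and "sentence_over \<Sigma> \<psi>"
  shows "\<exists>A :: ('a, nat) pia. is_pia A \<and> alphabet A = \<Sigma> \<and> lang_fo2 \<Sigma> \<psi> = lang_pia A"
proof -
  \<comment> \<open>Restricting labels to quantified subformulas of \<psi> makes the label set
    finite. Over the empty word all row functions give the same structure, so the constant 0 is an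
    arbitrary choice.\<close>
  interpret grid_machine \<Sigma> "\<Sigma> \<times> Pow (exs \<psi>)" fst "good \<psi>" "models (grid [] (\<lambda>_. 0)) \<psi>"
    using assms(1) by unfold_locales (simp_all add: finite_exs)
  have "good_labelling \<psi> u = labelled u" if "u \<in> lists \<Sigma>" for u
  proof (intro HOL.ext)
    fix lb row
    have "fst (lb p) = u ! (p - 1) \<and> snd (lb p) \<subseteq> exs \<psi> \<longleftrightarrow>
        fst (lb p) = u ! (p - 1) \<and> lb p \<in> \<Sigma> \<times> Pow (exs \<psi>)" if p: "p \<in> {1..length u}" for p
    proof -
      have "p - 1 < length u" using p by auto
      then have "u ! (p - 1) \<in> \<Sigma>" using \<open>u \<in> lists \<Sigma>\<close> by (simp add: in_listsD)
      then show ?thesis by (auto simp: mem_Times_iff)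
    qed
    then show "good_labelling \<psi> u lb row \<longleftrightarrow> labelled u lb row"
      unfolding good_labelling_def labelled_def by (metis (no_types, lifting))
  qed
  then have "u \<in> lang_fo2 \<Sigma> \<psi> \<longleftrightarrow> u \<in> mlang" for u
    unfolding lang_fo2_iff[OF assms(2)] mlang_iff by (cases "u \<in> lists \<Sigma>") simp_all
  then have "lang_fo2 \<Sigma> \<psi> = mlang" by blast
  then show ?thesis using mlang_pia by metis
qed

end
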